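(* Fix an integer $\kappa\ge 1$. If $1<p<2$, then almost surely $$\lim_{N\to\infty}\frac{1}{N^{1/p^*}}\,\mathbf{GP}_{N,p}=2^{\frac12-\frac2p}\big(\mathbb{E}|g|^{p^*}\big)^{1/p^*},$$ where $p^*$ is the Hölder conjugate of $p$ (i.e. $1/p+1/p^*=1$) and $g$ is a standard Gaussian random variable. On the other hand, for $p=1$ and $p=2$, almost surely $$\lim_{N\to\infty}\frac{1}{\sqrt{\log N}}\,\mathbf{GP}_{N,1}=\sqrt2=\lim_{N\to\infty}\frac{1}{\sqrt N}\,\mathbf{GP}_{N,2}.$$
   Context: Let $(g_{ij})_{i,j\ge1}$ be independent standard Gaussian random variables. For $N\ge 1$, a configuration is $\sigma=(\sigma_1,\dots,\sigma_N)\in(\mathbb{R}^\kappa)^N$ with $\sigma_i\in\mathbb{R}^\kappa$; $(\cdot,\cdot)$ is the Euclidean inner product and $\|\cdot\|_2$ the Euclidean norm on $\mathbb{R}^\kappa$. Define $\|\sigma\|_{p,2}^p=\sum_{i=1}^N\|\sigma_i\|_2^p$. The $\ell^p$-Gaussian-Grothendieck problem with vector spins is $$\mathbf{GP}_{N,p}=\max\Big\{\sum_{i,j=1}^N g_{ij}(\sigma_i,\sigma_j)\;:\;\sigma\in(\mathbb{R}^\kappa)^N,\ \|\sigma\|_{p,2}=1\Big\}.$$ *)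

theory Defs
  imports "HOL-Probability.Probability"
begin

definition configs :: "nat \<Rightarrow> (nat \<Rightarrow> real ^ 'k) set" where
  "configs N = {1..N} \<rightarrow>\<^sub>E UNIV"

definition norm_p2 :: "real \<Rightarrow> nat \<Rightarrow> (nat \<Rightarrow> real ^ 'k) \<Rightarrow> real" where
  "norm_p2 p N \<sigma> = (\<Sum>i = 1..N. norm (\<sigma> i) powr p) powr (1 / p)"

definition energy :: "(nat \<Rightarrow> nat \<Rightarrow> real) \<Rightarrow> nat \<Rightarrow> (nat \<Rightarrow> real ^ 'k) \<Rightarrow> real" where
  "energy a N \<sigma> = (\<Sum>i = 1..N. \<Sum>j = 1..N. a i j * (\<sigma> i \<bullet> \<sigma> j))"

text \<open>The maximum over the infinite feasible set is written as a supremum; it is attained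
  for every \<open>N \<ge> 1\<close> and \<open>p > 0\<close> (lemma \<open>GP_is_max\<close> below). The type argument carries the
  spin dimension \<open>\<kappa> = CARD('k)\<close>, which the result type \<open>real\<close> does not determine.\<close>

definition GP :: "'k::finite itself \<Rightarrow> real \<Rightarrow> nat \<Rightarrow> (nat \<Rightarrow> nat \<Rightarrow> real) \<Rightarrow> real" where
  "GP \<kappa> p N a = (SUP \<sigma> \<in> {\<sigma> :: nat \<Rightarrow> real ^ 'k. \<sigma> \<in> configs N \<and> norm_p2 p N \<sigma> = 1}. energy a N \<sigma>)"

lemma norm_p2_eq_1_iff:
  assumes "p > 0"
  shows "norm_p2 p N \<sigma> = 1 \<longleftrightarrow> (\<Sum>i = 1..N. norm (\<sigma> i) powr p) = 1"
proof -
  have nn: "(\<Sum>i = 1..N. norm (\<sigma> i) powr p) \<ge> 0" by (intro sum_nonneg) simp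
  show ?thesis
  proof
    assume "norm_p2 p N \<sigma> = 1"
    then have "((\<Sum>i = 1..N. norm (\<sigma> i) powr p) powr (1 / p)) powr p = 1"
      by (simp add: norm_p2_def)
    then show "(\<Sum>i = 1..N. norm (\<sigma> i) powr p) = 1"
      using assms nn by (simp add: powr_powr)
  qed (simp add: norm_p2_def)
qed

lemma compact_feasible:
  fixes p :: real
  assumes "p > 0"
  shows "compact {\<sigma> :: nat \<Rightarrow> real ^ 'k. \<sigma> \<in> configs N \<and> norm_p2 p N \<sigma> = 1}" (is "compact ?S")
proof -
  define K :: "(nat \<Rightarrow> real ^ 'k) set"
    where "K = (\<Pi>\<^sub>E i\<in>UNIV. if i \<in> {1..N} then cball 0 1 else {undefined})"
  define T :: "(nat \<Rightarrow> real ^ 'k) set"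
    where "T = (\<lambda>\<sigma>. \<Sum>i = 1..N. norm (\<sigma> i) powr p) -` {1}"
  have "compactin (product_topology (\<lambda>i. euclidean) UNIV) K"
    unfolding K_def compactin_PiE by (auto simp: compactin_euclidean_iff)
  then have "compact K"
    by (simp add: euclidean_product_topology compactin_euclidean_iff)
  moreover have "closed T"
    unfolding T_def using assms
    by (intro closed_vimage continuous_on_sum continuous_on_powr' continuous_intros) auto
  moreover have "?S = T \<inter> K"
  proof (intro set_eqI iffI)
    fix \<sigma> assume s: "\<sigma> \<in> ?S"
    then have 1: "(\<Sum>i = 1..N. norm (\<sigma> i) powr p) = 1"
      using assms by (simp add: norm_p2_eq_1_iff)
    have "norm (\<sigma> i) \<le> 1" if "i \<in> {1..N}" for i
    proof (rule ccontr)
      assume "\<not> norm (\<sigma> i) \<le> 1"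
      then have "1 < norm (\<sigma> i) powr p" using assms by (simp add: gr_one_powr)
      also have "\<dots> \<le> (\<Sum>i = 1..N. norm (\<sigma> i) powr p)"
        using that by (intro member_le_sum) auto
      finally show False using 1 by simp
    qed
    then show "\<sigma> \<in> T \<inter> K" using s 1
      by (auto simp: T_def K_def configs_def PiE_def extensional_def)
  next
    fix \<sigma> assume s: "\<sigma> \<in> T \<inter> K"
    have "\<sigma> i = undefined" if "i \<notin> {1..N}" for i
    proof -
      have "\<sigma> i \<in> (if i \<in> {1..N} then cball 0 1 else {undefined})"
        using s by (auto simp only: K_def PiE_iff Int_iff UNIV_I)
      then show ?thesis using that by (simp only: if_False singleton_iff)
    qed
    then show "\<sigma> \<in> ?S" using s assms
      by (auto simp: T_def configs_def PiE_def extensional_def norm_p2_eq_1_iff)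
  qed
  ultimately show ?thesis by (simp add: closed_Int_compact)
qed

lemma GP_is_max:
  fixes a :: "nat \<Rightarrow> nat \<Rightarrow> real"
  assumes "N \<ge> 1" "p > 0"
  shows "\<exists>\<sigma> :: nat \<Rightarrow> real ^ 'k. \<sigma> \<in> configs N \<and> norm_p2 p N \<sigma> = 1
           \<and> energy a N \<sigma> = GP TYPE('k) p N a
           \<and> (\<forall>\<tau> :: nat \<Rightarrow> real ^ 'k. \<tau> \<in> configs N \<and> norm_p2 p N \<tau> = 1 \<longrightarrow> energy a N \<tau> \<le> energy a N \<sigma>)"
proof -
  let ?S = "{\<sigma> :: nat \<Rightarrow> real ^ 'k. \<sigma> \<in> configs N \<and> norm_p2 p N \<sigma> = 1}"
  obtain e :: "real ^ 'k" where e: "norm e = 1"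
    using vector_choose_size[of 1] by auto
  define \<sigma>0 :: "nat \<Rightarrow> real ^ 'k"
    where "\<sigma>0 = restrict (\<lambda>i. if i = 1 then e else 0) {1..N}"
  have "(\<Sum>i = 1..N. norm (\<sigma>0 i) powr p) = (\<Sum>i = 1..N. if i = 1 then 1 else 0)"
    by (rule sum.cong) (auto simp: \<sigma>0_def e)
  also have "\<dots> = 1" using assms by simp
  finally have "\<sigma>0 \<in> ?S"
    using assms by (simp add: norm_p2_eq_1_iff configs_def \<sigma>0_def)
  then have ne: "?S \<noteq> {}" by blast
  have "continuous_on ?S (energy a N)"
    unfolding energy_def by (intro continuous_intros continuous_on_subset[OF continuous_on_product_coordinates]) auto
  from continuous_attains_sup[OF compact_feasible[OF assms(2)] ne this]
  obtain \<sigma> where \<sigma>: "\<sigma> \<in> ?S" "\<And>\<tau>. \<tau> \<in> ?S \<Longrightarrow> energy a N \<tau> \<le> energy a N \<sigma>" by blast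
  then have "GP TYPE('k) p N a = energy a N \<sigma>"
    unfolding GP_def by (intro cSup_eq_maximum) auto
  with \<sigma> show ?thesis by auto
qed

end

theory Submission
  imports Defs
begin

text \<open>
  By Minkowski's inequality vector spins do no better than scalar ones, so everything reduces to the
  quadratic form \<open>\<langle>x, G x\<rangle>\<close> on the unit sphere of \<open>\<ell>\<^sub>p\<close>.
  The upper bound for \<open>1 < p \<le> 2\<close> is Slepian's comparison with the process
  \<open>sqrt 2 \<bar>x\<bar> \<langle>h, x\<rangle>\<close>, whose supremum concentrates by the law of large numbers for
  \<open>\<Sum>j. \<bar>h j\<bar> powr q\<close>. For \<open>1 < p < 2\<close> it is attained asymptotically by half of the mass on one coordinate
  and the other half spread along the dual vector of the corresponding symmetrised row.
  For \<open>p = 2\<close> the lower bound eliminates one coordinate after the other: the form minus \<open>T \<bar>x\<bar>\<^sup>2\<close> can be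
  nonpositive only if the same holds for the minor plus a rank-one term of weight \<open>c' = b\<^sup>2 / (T - c)\<close>, with
  \<open>b\<^sup>2\<close> about \<open>N / 2\<close>, and this iteration has no fixed point below \<open>T = 2 b\<close>.
  For \<open>p = 1\<close> union bounds over the entries suffice.
  Every estimate fails with probability \<open>O(N powr (-a))\<close>; since the maxima are monotone in \<open>N\<close>, the
  Borel-Cantelli lemma along a sparse subsequence gives almost sure convergence.
\<close>

subsection \<open>Gaussian integration by parts\<close>

text \<open>The limit formula for \<open>1 < p < 2\<close> does not extend to \<open>p = 2\<close>,
  where it would read \<open>1 / sqrt 2\<close>. It rests on splitting off the coordinates of size
  at least \<delta>: the others have Euclidean norm at most \<open>\<delta> powr (1 - p/2)\<close>,
  which is small only for \<open>p < 2\<close>. At \<open>p = 2\<close> no such split exists, and a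
  localised test vector falls short by a factor 2; this is why that lower bound goes through
  elimination instead. Slepian's inequality is used for probabilities, not for expectations. Crude
  bounds from Chebyshev and Markov, of order \<open>1/N\<close>, therefore transfer directly from a
  single Gaussian row to the whole form, and concentration of measure never enters. In the
  elimination, \<open>c = b\<^sup>2 / (T - c)\<close> is a quadratic equation with discriminant
  \<open>T\<^sup>2 - 4 * b\<^sup>2\<close>. When it is negative, every step raises \<open>c\<close>
  by a fixed fraction of \<open>b\<close>. The number of eliminated coordinates is then bounded
  independently of \<open>N\<close>, so that the minors keep asymptotically full size and only
  boundedly many failure probabilities add up.\<close>

abbreviation std_gauss :: "real measure" where
  "std_gauss \<equiv> density lborel (\<lambda>x. ennreal (std_normal_density x))"

lemma prob_space_std_gauss: "prob_space std_gauss"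
  by (rule prob_space_normal_density) simp

lemma std_normal_density_at_top: "(std_normal_density \<longlongrightarrow> 0) at_top"
  unfolding std_normal_density_def[abs_def] by real_asymp

lemma std_normal_density_at_bot: "(std_normal_density \<longlongrightarrow> 0) at_bot"
  unfolding std_normal_density_def[abs_def] by real_asymp

lemma std_normal_density_deriv:
  "(std_normal_density has_real_derivative - x * std_normal_density x) (at x)"
proof -
  have "((\<lambda>x. C * exp (- x\<^sup>2 / 2)) has_real_derivative - x * (C * exp (- x\<^sup>2 / 2))) (at x)" for C :: real
    by (auto intro!: derivative_eq_intros)
  then show ?thesis unfolding std_normal_density_def[abs_def] .
qed

text \<open>The density \<phi> satisfies \<phi>' = -x \<phi>, so the derivative of f \<phi> is (f' -
  x f) \<phi>. For bounded f the product f \<phi> vanishes at both infinities, hence this derivative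
  integrates to 0.\<close>

lemma std_gauss_integration_by_parts:
  fixes f f' :: "real \<Rightarrow> real"
  assumes d: "\<And>x. (f has_real_derivative f' x) (at x)" and c: "continuous_on UNIV f'"
    and B: "\<And>x. \<bar>f x\<bar> \<le> B" "\<And>x. \<bar>f' x\<bar> \<le> B'"
  shows "(\<integral>x. x * f x \<partial>std_gauss) = (\<integral>x. f' x \<partial>std_gauss)"
proof -
  have cf: "continuous_on UNIV f"
    using d by (meson DERIV_isCont continuous_at_imp_continuous_on)
  have [measurable]: "f \<in> borel_measurable borel" "f' \<in> borel_measurable borel"
    using cf c by (auto intro: borel_measurable_continuous_onI)
  let ?F = "\<lambda>x. f x * std_normal_density x"
  let ?F' = "\<lambda>x. f' x * std_normal_density x - x * f x * std_normal_density x"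
  have i1: "integrable lborel (\<lambda>x. f' x * std_normal_density x)"
    by (rule Bochner_Integration.integrable_bound[where f="\<lambda>x. B' * std_normal_density x"])
       (auto simp: abs_mult intro!: mult_right_mono order.trans[OF B(2)])
  have i2: "integrable lborel (\<lambda>x. x * f x * std_normal_density x)"
  proof (rule Bochner_Integration.integrable_bound)
    show "integrable lborel (\<lambda>x. B * (std_normal_density x * \<bar>x\<bar> ^ 1))"
      using integrable_std_normal_moment_abs[of 1] by (intro integrable_mult_right) auto
    have "B \<ge> 0" using B(1)[of 0] by linarith
    then show "AE x in lborel. norm (x * f x * std_normal_density x)
        \<le> norm (B * (std_normal_density x * \<bar>x\<bar> ^ 1))"
      using mult_right_mono[OF B(1), of "\<bar>x\<bar> * std_normal_density x" for x]
      by (intro AE_I2) (simp add: abs_mult mult_ac)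
  qed simp
  have D: "(?F has_real_derivative ?F' x) (at x)" for x
    by (auto intro!: derivative_eq_intros d std_normal_density_deriv simp: algebra_simps)
  have lim: "(?F \<longlongrightarrow> 0) G" if "(std_normal_density \<longlongrightarrow> 0) G" for G
  proof (rule tendsto_rabs_zero_cancel, rule tendsto_sandwich[where f="\<lambda>_. 0"])
    show "((\<lambda>x. B * std_normal_density x) \<longlongrightarrow> 0) G"
      using tendsto_mult_right_zero[OF that] .
    show "\<forall>\<^sub>F x in G. \<bar>?F x\<bar> \<le> B * std_normal_density x"
      by (auto simp: abs_mult intro!: always_eventually mult_right_mono B)
  qed auto
  have "(LBINT x=-\<infinity>..\<infinity>. ?F' x) = 0 - 0"
  proof (rule interval_integral_FTC_integrable)
    show "(?F has_vector_derivative ?F' x) (at x)" for x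
      using D by (simp add: has_real_derivative_iff_has_vector_derivative)
    show "isCont ?F' x" for x
      using c cf by (intro continuous_intros)
        (auto simp: continuous_on_eq_continuous_at std_normal_density_def[abs_def])
    show "set_integrable lborel (einterval (-\<infinity>) \<infinity>) ?F'"
      using i1 i2 by (simp add: set_integrable_def)
    show "((?F \<circ> real_of_ereal) \<longlongrightarrow> 0) (at_right (-\<infinity>))"
      by (simp only: ereal_tendsto_simps) (rule lim[OF std_normal_density_at_bot])
    show "((?F \<circ> real_of_ereal) \<longlongrightarrow> 0) (at_left \<infinity>)"
      by (simp only: ereal_tendsto_simps) (rule lim[OF std_normal_density_at_top])
  qed simp
  then have "integral\<^sup>L lborel ?F' = 0"
    by (simp add: interval_lebesgue_integral_def set_lebesgue_integral_def)
  then have "(\<integral>x. f' x * std_normal_density x \<partial>lborel) = (\<integral>x. x * f x * std_normal_density x \<partial>lborel)"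
    using i1 i2 by simp
  then show ?thesis
    by (subst (1 2) integral_density) (auto simp: mult_ac)
qed

text \<open>The mean value inequality bounds all difference quotients by \<open>B\<close>, so
  dominated convergence applies along every sequence tending to \<open>t\<close>.\<close>

lemma has_derivative_expectation:
  fixes f f' :: "real \<Rightarrow> 'a \<Rightarrow> real"
  assumes f: "\<And>t. integrable M (f t)" and f': "\<And>t. f' t \<in> borel_measurable M"
    and d: "\<And>t \<omega>. \<omega> \<in> space M \<Longrightarrow> ((\<lambda>t. f t \<omega>) has_real_derivative f' t \<omega>) (at t)"
    and B: "\<And>t \<omega>. \<omega> \<in> space M \<Longrightarrow> \<bar>f' t \<omega>\<bar> \<le> B \<omega>" "integrable M B"
  shows "((\<lambda>t. \<integral>\<omega>. f t \<omega> \<partial>M) has_real_derivative (\<integral>\<omega>. f' t \<omega> \<partial>M)) (at t)"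
  unfolding has_field_derivative_iff tendsto_at_iff_sequentially comp_def
proof (intro allI impI)
  fix X :: "nat \<Rightarrow> real" assume X: "\<forall>i. X i \<in> UNIV - {t}" "X \<longlonglongrightarrow> t"
  have [measurable]: "f t \<in> borel_measurable M" for t using f by auto
  note f'[measurable]
  have mvt: "\<bar>(f (X i) \<omega> - f t \<omega>) / (X i - t)\<bar> \<le> B \<omega>" if w: "\<omega> \<in> space M" for i \<omega>
  proof -
    have "norm (f (X i) \<omega> - f t \<omega>) \<le> B \<omega> * norm (X i - t)"
      using d[OF w] B(1)[OF w] by (intro field_differentiable_bound[where S=UNIV and f'="\<lambda>t. f' t \<omega>"]) auto
    then show ?thesis using X(1) by (simp add: divide_le_eq)
  qed
  have "(\<lambda>i. \<integral>\<omega>. (f (X i) \<omega> - f t \<omega>) / (X i - t) \<partial>M) \<longlonglongrightarrow> (\<integral>\<omega>. f' t \<omega> \<partial>M)"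
  proof (rule integral_dominated_convergence[where w=B])
    show "AE \<omega> in M. (\<lambda>i. (f (X i) \<omega> - f t \<omega>) / (X i - t)) \<longlonglongrightarrow> f' t \<omega>"
    proof (rule AE_I2)
      fix \<omega> assume "\<omega> \<in> space M"
      from d[OF this, of t] show "(\<lambda>i. (f (X i) \<omega> - f t \<omega>) / (X i - t)) \<longlonglongrightarrow> f' t \<omega>"
        unfolding has_field_derivative_iff tendsto_at_iff_sequentially comp_def using X by blast
    qed
  qed (use mvt B in auto)
  then show "(\<lambda>i. ((\<integral>\<omega>. f (X i) \<omega> \<partial>M) - (\<integral>\<omega>. f t \<omega> \<partial>M)) / (X i - t)) \<longlonglongrightarrow> (\<integral>\<omega>. f' t \<omega> \<partial>M)"
    using f by simp
qed

section \<open>Products of standard Gaussians and smooth comparison\<close>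

abbreviation PiG :: "'k set \<Rightarrow> ('k \<Rightarrow> real) measure" where
  "PiG K \<equiv> PiM K (\<lambda>_. std_gauss)"

lemma prob_space_PiG: "prob_space (PiG K)"
  by (intro prob_space_PiM prob_space_std_gauss)

lemma integrable_PiG_component:
  assumes "finite K" "k \<in> K"
  shows "integrable (PiG K) (\<lambda>x. x k)"
proof -
  interpret product_prob_space "\<lambda>_. std_gauss" K
    by (intro product_prob_spaceI prob_space_std_gauss)
  have "integrable std_gauss (\<lambda>x. x)"
    using integrable_std_normal_moment[of 1] by (subst integrable_density) auto
  then have "integrable (distr (PiG K) std_gauss (\<lambda>x. x k)) (\<lambda>x. x)"
    using PiM_component[of k] assms by simp
  then show ?thesis
    by (subst (asm) integrable_distr_eq) (use assms in auto)
qed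

text \<open>Fubini isolates coordinate \<open>k\<close>, and the one-dimensional formula is applied
  in that slot. The hypotheses are therefore phrased through \<open>x(k:=y)\<close>.\<close>

lemma PiG_integration_by_parts:
  fixes F F' :: "('k \<Rightarrow> real) \<Rightarrow> real"
  assumes K: "finite K" "k \<in> K"
    and [measurable]: "F \<in> borel_measurable (PiG K)" "F' \<in> borel_measurable (PiG K)"
    and d: "\<And>x y. ((\<lambda>y. F (x(k:=y))) has_real_derivative F' (x(k:=y))) (at y)"
    and c: "\<And>x. continuous_on UNIV (\<lambda>y. F' (x(k:=y)))"
    and B: "\<And>x. \<bar>F x\<bar> \<le> B" "\<And>x. \<bar>F' x\<bar> \<le> B'"
  shows "integrable (PiG K) (\<lambda>x. x k * F x)" "integrable (PiG K) F'"
    and "(\<integral>x. x k * F x \<partial>PiG K) = (\<integral>x. F' x \<partial>PiG K)"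
proof -
  interpret product_sigma_finite "\<lambda>_. std_gauss"
    by (intro product_sigma_finite.intro prob_space_imp_sigma_finite prob_space_std_gauss)
  interpret prob_space "PiG K" by (rule prob_space_PiG)
  define L where "L = K - {k}"
  have L: "finite L" "k \<notin> L" "K = insert k L" using K by (auto simp: L_def)
  have [measurable]: "(\<lambda>x. x k) \<in> borel_measurable (PiG K)" using K by simp
  show i1: "integrable (PiG K) (\<lambda>x. x k * F x)"
  proof (rule Bochner_Integration.integrable_bound)
    show "integrable (PiG K) (\<lambda>x. B * x k)"
      using integrable_PiG_component[OF K] by simp
    have "B \<ge> 0" using B(1)[of undefined] by linarith
    then show "AE x in PiG K. norm (x k * F x) \<le> norm (B * x k)"
      by (intro AE_I2) (auto simp: abs_mult intro: order.trans[OF mult_left_mono[OF B(1)]])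
  qed simp
  show i2: "integrable (PiG K) F'"
    by (rule integrable_const_bound[where B=B']) (use B in auto)
  have "(\<integral>x. x k * F x \<partial>PiG K) = (\<integral>x. (\<integral>y. y * F (x(k:=y)) \<partial>std_gauss) \<partial>PiG L)"
    using product_integral_insert[OF L(1,2), of "\<lambda>x. x k * F x"] i1 by (simp add: L(3))
  also have "\<dots> = (\<integral>x. (\<integral>y. F' (x(k:=y)) \<partial>std_gauss) \<partial>PiG L)"
    by (intro Bochner_Integration.integral_cong refl std_gauss_integration_by_parts[where B=B and B'=B'] d c B)
  also have "\<dots> = (\<integral>x. F' x \<partial>PiG K)"
    using product_integral_insert[OF L(1,2), of F'] i2 by (simp add: L(3))
  finally show "(\<integral>x. x k * F x \<partial>PiG K) = (\<integral>x. F' x \<partial>PiG K)" .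
qed

text \<open>This bound and the next one keep the first and second derivatives of the test function
  bounded, although the exponentials inside it are not.\<close>

lemma times_exp_minus_le: "y * exp (- y) \<le> 1" for y :: real
proof -
  have "y \<le> exp y" using exp_ge_add_one_self[of y] by linarith
  then show ?thesis by (simp add: exp_minus divide_simps)
qed

lemma square_exp_minus_le: "0 \<le> y \<Longrightarrow> y\<^sup>2 * exp (- y) \<le> 4" for y :: real
proof -
  assume "0 \<le> y"
  have "(y/2 * exp (- (y/2)))\<^sup>2 \<le> 1\<^sup>2"
    using times_exp_minus_le[of "y/2"] \<open>0 \<le> y\<close> by (intro power_mono) auto
  moreover have "(y/2 * exp (- (y/2)))\<^sup>2 = y\<^sup>2 * exp (- y) / 4"
    by (simp add: power_mult_distrib power2_eq_square exp_add[symmetric] field_simps)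
  ultimately show ?thesis by simp
qed

text \<open>The test function \<open>exp (- (\<Sum>t. exp (\<beta> z\<^sub>t - \<alpha>\<^sub>t)))\<close> is bounded with
  nonnegative mixed second derivatives, and it approximates the indicator of
  \<open>\<forall>t. z\<^sub>t \<le> \<tau>\<^sub>t\<close>.\<close>

lemma slepian_smooth:
  fixes A B :: "'t \<Rightarrow> 'k \<Rightarrow> real" and \<beta> :: real and \<alpha> :: "'t \<Rightarrow> real"
  assumes T: "finite T" and K: "finite K"
    and orth: "\<And>s t. s \<in> T \<Longrightarrow> t \<in> T \<Longrightarrow> (\<Sum>k\<in>K. A s k * B t k) = 0"
    and var: "\<And>t. t \<in> T \<Longrightarrow> (\<Sum>k\<in>K. (A t k)\<^sup>2) = (\<Sum>k\<in>K. (B t k)\<^sup>2)"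
    and cov: "\<And>s t. s \<in> T \<Longrightarrow> t \<in> T \<Longrightarrow> (\<Sum>k\<in>K. B s k * B t k) \<le> (\<Sum>k\<in>K. A s k * A t k)"
  shows "(\<integral>x. exp (- (\<Sum>t\<in>T. exp (\<beta> * (\<Sum>k\<in>K. B t k * x k) - \<alpha> t))) \<partial>PiG K)
       \<le> (\<integral>x. exp (- (\<Sum>t\<in>T. exp (\<beta> * (\<Sum>k\<in>K. A t k * x k) - \<alpha> t))) \<partial>PiG K)"
proof -
  interpret prob_space "PiG K" by (rule prob_space_PiG)
  \<comment> \<open>The interpolation follows a quarter circle from \<open>A\<close> at angle 0 to
    \<open>B\<close> at angle pi/2. Because \<open>A\<close> and \<open>B\<close> are orthogonal
    with equal variances, the variance stays constant along it; \<open>c'\<close> is the derivative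
    of \<open>c\<close> in the angle.\<close>
  define c where "c \<theta> t k = cos \<theta> * A t k + sin \<theta> * B t k" for \<theta> t k
  define c' where "c' \<theta> t k = cos \<theta> * B t k - sin \<theta> * A t k" for \<theta> t k
  define E where "E \<theta> t x = exp (\<beta> * (\<Sum>k\<in>K. c \<theta> t k * x k) - \<alpha> t)" for \<theta> t x
  define R where "R \<theta> x = (\<Sum>t\<in>T. E \<theta> t x)" for \<theta> x
  \<comment> \<open>Up to sign and powers of \<beta>, \<open>G\<close> is the derivative of
    \<open>exp (- R)\<close> in one value of the process and \<open>G2\<close> its mixed second
    derivative; \<open>dG\<close> is the derivative of \<open>G\<close> in the coordinate
    \<open>x k\<close>.\<close>
  define G where "G \<theta> s x = E \<theta> s x * exp (- R \<theta> x)" for \<theta> s x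
  define G2 where "G2 \<theta> s t x = E \<theta> s x * E \<theta> t x * exp (- R \<theta> x)" for \<theta> s t x
  define dG where "dG \<theta> k s x = \<beta> * c \<theta> s k * G \<theta> s x - \<beta> * (\<Sum>t\<in>T. c \<theta> t k * G2 \<theta> s t x)" for \<theta> k s x
  define \<psi> where "\<psi> \<theta> = (\<integral>x. exp (- R \<theta> x) \<partial>PiG K)" for \<theta>
  define D where "D \<theta> x = - \<beta> * (\<Sum>s\<in>T. \<Sum>k\<in>K. c' \<theta> s k * (x k * G \<theta> s x))" for \<theta> x
  have Epos: "E \<theta> t x > 0" for \<theta> t x by (simp add: E_def)
  have Rnn: "R \<theta> x \<ge> 0" for \<theta> x unfolding R_def by (intro sum_nonneg less_imp_le Epos)
  have ER: "E \<theta> t x \<le> R \<theta> x" if "t \<in> T" for \<theta> t x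
    unfolding R_def using that T Epos by (intro member_le_sum) (auto intro: less_imp_le)
  have G_bd: "\<bar>G \<theta> s x\<bar> \<le> 1" if "s \<in> T" for \<theta> s x
  proof -
    have "\<bar>G \<theta> s x\<bar> \<le> R \<theta> x * exp (- R \<theta> x)"
      unfolding G_def using ER[OF that, of \<theta> x] Epos[of \<theta> s x]
      by (auto simp: abs_mult intro!: mult_right_mono)
    then show ?thesis using times_exp_minus_le[of "R \<theta> x"] by linarith
  qed
  have G2_bd: "\<bar>G2 \<theta> s t x\<bar> \<le> 4" if "s \<in> T" "t \<in> T" for \<theta> s t x
  proof -
    have "\<bar>G2 \<theta> s t x\<bar> \<le> (R \<theta> x)\<^sup>2 * exp (- R \<theta> x)"
      unfolding G2_def using ER[OF that(1), of \<theta> x] ER[OF that(2), of \<theta> x] Epos[of \<theta> s x] Epos[of \<theta> t x] Rnn[of \<theta> x]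
      by (auto simp: abs_mult power2_eq_square intro!: mult_right_mono mult_mono)
    then show ?thesis using square_exp_minus_le[OF Rnn[of \<theta> x]] by linarith
  qed
  have [measurable]: "(\<lambda>x. x k) \<in> borel_measurable (PiG K)" if "k \<in> K" for k
    using that by simp
  have E_meas[measurable]: "E \<theta> t \<in> borel_measurable (PiG K)" for \<theta> t
    unfolding E_def by measurable
  have R_meas[measurable]: "R \<theta> \<in> borel_measurable (PiG K)" for \<theta>
    unfolding R_def by measurable
  have G_meas[measurable]: "G \<theta> s \<in> borel_measurable (PiG K)" for \<theta> s
    unfolding G_def by measurable
  have G2_meas[measurable]: "G2 \<theta> s t \<in> borel_measurable (PiG K)" for \<theta> s t
    unfolding G2_def by measurable
  have dG_meas[measurable]: "dG \<theta> k s \<in> borel_measurable (PiG K)" for \<theta> k s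
    unfolding dG_def by measurable
  have lin: "(\<Sum>j\<in>K. c \<theta> t j * (x(k:=y)) j) = (\<Sum>j\<in>K-{k}. c \<theta> t j * x j) + c \<theta> t k * y"
    if "k \<in> K" for \<theta> t x k y
    using K that by (subst sum.remove[of _ k]) (auto intro!: sum.cong)
  have dE: "((\<lambda>y. E \<theta> t (x(k:=y))) has_real_derivative \<beta> * c \<theta> t k * E \<theta> t (x(k:=y))) (at y)"
    if "k \<in> K" for \<theta> t x k y
    unfolding E_def lin[OF that] by (auto intro!: derivative_eq_intros)
  have dR: "((\<lambda>y. R \<theta> (x(k:=y))) has_real_derivative (\<Sum>t\<in>T. \<beta> * c \<theta> t k * E \<theta> t (x(k:=y)))) (at y)"
    if "k \<in> K" for \<theta> x k y
    unfolding R_def by (intro derivative_intros dE that)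
  have cE: "continuous_on UNIV (\<lambda>y. E \<theta> t (x(k:=y)))" if "k \<in> K" for \<theta> t x k
    unfolding E_def lin[OF that] by (intro continuous_intros)
  have cG: "continuous_on UNIV (\<lambda>y. dG \<theta> k s (x(k:=y)))" if "k \<in> K" for \<theta> s x k
    unfolding dG_def G_def G2_def R_def by (intro continuous_intros cE that)
  have ibp: "integrable (PiG K) (\<lambda>x. x k * G \<theta> s x)" "integrable (PiG K) (dG \<theta> k s)"
      "(\<integral>x. x k * G \<theta> s x \<partial>PiG K) = (\<integral>x. dG \<theta> k s x \<partial>PiG K)" 
    if "s \<in> T" "k \<in> K" for \<theta> s k
  proof -
    have d: "((\<lambda>y. G \<theta> s (x(k:=y))) has_real_derivative dG \<theta> k s (x(k:=y))) (at y)" for x y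
      unfolding G_def dG_def G2_def using that
      by (auto intro!: derivative_eq_intros dE dR simp: sum_distrib_left sum_distrib_right algebra_simps)
    have b: "\<bar>dG \<theta> k s x\<bar> \<le> \<bar>\<beta>\<bar> * \<bar>c \<theta> s k\<bar> + \<bar>\<beta>\<bar> * (\<Sum>t\<in>T. \<bar>c \<theta> t k\<bar> * 4)" for x
    proof -
      have "\<bar>dG \<theta> k s x\<bar> \<le> \<bar>\<beta> * c \<theta> s k * G \<theta> s x\<bar> + \<bar>\<beta> * (\<Sum>t\<in>T. c \<theta> t k * G2 \<theta> s t x)\<bar>"
        unfolding dG_def by linarith
      also have "\<dots> \<le> \<bar>\<beta>\<bar> * \<bar>c \<theta> s k\<bar> * 1 + \<bar>\<beta>\<bar> * (\<Sum>t\<in>T. \<bar>c \<theta> t k\<bar> * 4)"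
        unfolding abs_mult
        by (intro add_mono mult_left_mono order.trans[OF sum_abs] sum_mono G_bd that)
           (auto simp: abs_mult intro!: mult_left_mono G2_bd that)
      finally show ?thesis by simp
    qed
    note I = PiG_integration_by_parts[OF K that(2) G_meas dG_meas d cG[OF that(2)] G_bd[OF that(1)] b]
    show "integrable (PiG K) (\<lambda>x. x k * G \<theta> s x)" "integrable (PiG K) (dG \<theta> k s)"
      "(\<integral>x. x k * G \<theta> s x \<partial>PiG K) = (\<integral>x. dG \<theta> k s x \<partial>PiG K)"
      by (fact I)+
  qed
  have iG: "integrable (PiG K) (G \<theta> s)" if "s \<in> T" for \<theta> s
    by (rule integrable_const_bound[where B=1]) (use G_bd that in auto)
  have iG2: "integrable (PiG K) (G2 \<theta> s t)" if "s \<in> T" "t \<in> T" for \<theta> s t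
    by (rule integrable_const_bound[where B=4]) (use G2_bd that in auto)
  have deriv: "(\<psi> has_real_derivative (\<integral>x. D \<theta> x \<partial>PiG K)) (at \<theta>)" for \<theta>
    unfolding \<psi>_def
  proof (rule has_derivative_expectation)
    show "integrable (PiG K) (\<lambda>x. exp (- R t x))" for t
      by (rule integrable_const_bound[where B=1]) (use Rnn in auto)
    show "D t \<in> borel_measurable (PiG K)" for t
      unfolding D_def by measurable
    show "((\<lambda>t. exp (- R t x)) has_real_derivative D t x) (at t)" for t x
      unfolding R_def E_def c_def D_def G_def c'_def
      by (auto intro!: derivative_eq_intros simp: sum_distrib_left sum_distrib_right sum_negf sum_subtractf algebra_simps)
    show "\<bar>D t x\<bar> \<le> \<bar>\<beta>\<bar> * (\<Sum>s\<in>T. \<Sum>k\<in>K. (\<bar>A s k\<bar> + \<bar>B s k\<bar>) * \<bar>x k\<bar>)" for t x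
    proof -
      have c'b: "\<bar>c' t s k\<bar> \<le> \<bar>A s k\<bar> + \<bar>B s k\<bar>" for s k
      proof -
        have "\<bar>c' t s k\<bar> \<le> \<bar>cos t\<bar> * \<bar>B s k\<bar> + \<bar>sin t\<bar> * \<bar>A s k\<bar>"
          unfolding c'_def by (metis abs_mult abs_triangle_ineq4)
        also have "\<dots> \<le> 1 * \<bar>B s k\<bar> + 1 * \<bar>A s k\<bar>"
          by (intro add_mono mult_right_mono) auto
        finally show ?thesis by simp
      qed
      have "\<bar>c' t s k * (x k * G t s x)\<bar> \<le> (\<bar>A s k\<bar> + \<bar>B s k\<bar>) * (\<bar>x k\<bar> * 1)" if "s \<in> T" for s k
        unfolding abs_mult using c'b G_bd[OF that]
        by (intro mult_mono mult_left_mono) auto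
      then show ?thesis
        unfolding D_def abs_mult abs_minus_cancel
        by (intro mult_left_mono order.trans[OF sum_abs] sum_mono) (auto simp: abs_mult)
    qed
    show "integrable (PiG K) (\<lambda>x. \<bar>\<beta>\<bar> * (\<Sum>s\<in>T. \<Sum>k\<in>K. (\<bar>A s k\<bar> + \<bar>B s k\<bar>) * \<bar>x k\<bar>))"
      using integrable_PiG_component[OF K] by (intro integrable_mult_right Bochner_Integration.integrable_sum integrable_abs)
  qed
  have Dle: "(\<integral>x. D \<theta> x \<partial>PiG K) \<le> 0" if "0 \<le> \<theta>" "\<theta> \<le> pi/2" for \<theta>
  proof -
    have sc: "0 \<le> sin \<theta> * cos \<theta>"
      using that by (intro mult_nonneg_nonneg sin_ge_zero cos_ge_zero) auto
    \<comment> \<open>The mixed sums over \<open>A\<close> and \<open>B\<close> drop out by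
      \<open>orth\<close>; only the difference of the two covariances survives, with a nonnegative
      factor on the quarter circle.\<close>
    have cc: "(\<Sum>k\<in>K. c' \<theta> s k * c \<theta> t k)
        = sin \<theta> * cos \<theta> * ((\<Sum>k\<in>K. B s k * B t k) - (\<Sum>k\<in>K. A s k * A t k))" if "s \<in> T" "t \<in> T" for s t
    proof -
      have "(\<Sum>k\<in>K. c' \<theta> s k * c \<theta> t k) =
        (cos \<theta>)\<^sup>2 * (\<Sum>k\<in>K. A t k * B s k) - (sin \<theta>)\<^sup>2 * (\<Sum>k\<in>K. A s k * B t k)
         + sin \<theta> * cos \<theta> * ((\<Sum>k\<in>K. B s k * B t k) - (\<Sum>k\<in>K. A s k * A t k))"
        unfolding c_def c'_def
        by (simp add: sum_distrib_left sum_subtractf[symmetric] sum.distrib[symmetric] algebra_simps power2_eq_square)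
      then show ?thesis using orth that by simp
    qed
    have "(\<integral>x. D \<theta> x \<partial>PiG K) = - \<beta> * (\<Sum>s\<in>T. \<Sum>k\<in>K. c' \<theta> s k * (\<integral>x. x k * G \<theta> s x \<partial>PiG K))"
      unfolding D_def using ibp(1) by (simp add: Bochner_Integration.integral_sum)
    also have "\<dots> = - \<beta> * (\<Sum>s\<in>T. \<Sum>k\<in>K. c' \<theta> s k *
        (\<beta> * c \<theta> s k * (\<integral>x. G \<theta> s x \<partial>PiG K) - \<beta> * (\<Sum>t\<in>T. c \<theta> t k * (\<integral>x. G2 \<theta> s t x \<partial>PiG K))))"
      by (intro arg_cong2[where f="(*)"] refl sum.cong, subst ibp(3))
         (auto simp: dG_def[abs_def] iG iG2)
    also have "\<dots> = - \<beta>\<^sup>2 * (\<Sum>s\<in>T. (\<Sum>k\<in>K. c' \<theta> s k * c \<theta> s k) * (\<integral>x. G \<theta> s x \<partial>PiG K)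
        - (\<Sum>t\<in>T. (\<Sum>k\<in>K. c' \<theta> s k * c \<theta> t k) * (\<integral>x. G2 \<theta> s t x \<partial>PiG K)))"
    proof -
      have "(\<Sum>k\<in>K. c' \<theta> s k * (\<beta> * c \<theta> s k * g - \<beta> * (\<Sum>t\<in>T. c \<theta> t k * h t))) =
        \<beta> * ((\<Sum>k\<in>K. c' \<theta> s k * c \<theta> s k) * g - (\<Sum>t\<in>T. (\<Sum>k\<in>K. c' \<theta> s k * c \<theta> t k) * h t))" for s g and h :: "'t \<Rightarrow> real"
        unfolding sum_distrib_right sum.swap[of _ K T]
        by (simp add: sum_distrib_left right_diff_distrib sum_subtractf mult_ac)
      then show ?thesis by (simp add: sum_distrib_left[symmetric] power2_eq_square mult.assoc)
    qed
    \<comment> \<open>The terms with \<open>G\<close> carry the diagonal covariances, which vanish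
      by \<open>var\<close>. What is left has the sign of the covariance differences, since
      \<open>G2\<close> is nonnegative.\<close>
    also have "\<dots> = \<beta>\<^sup>2 * (\<Sum>s\<in>T. \<Sum>t\<in>T. (\<Sum>k\<in>K. c' \<theta> s k * c \<theta> t k) * (\<integral>x. G2 \<theta> s t x \<partial>PiG K))"
      using cc var by (simp add: power2_eq_square sum_negf)
    also have "\<dots> \<le> 0"
    proof (rule mult_nonneg_nonpos)
      have "(\<Sum>k\<in>K. c' \<theta> s k * c \<theta> t k) * (\<integral>x. G2 \<theta> s t x \<partial>PiG K) \<le> 0" if st: "s \<in> T" "t \<in> T" for s t
      proof (rule mult_nonpos_nonneg)
        show "(\<Sum>k\<in>K. c' \<theta> s k * c \<theta> t k) \<le> 0"
          unfolding cc[OF st] using sc cov[OF st] by (intro mult_nonneg_nonpos) auto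
        show "(\<integral>x. G2 \<theta> s t x \<partial>PiG K) \<ge> 0"
          by (intro Bochner_Integration.integral_nonneg) (auto simp: G2_def intro!: mult_nonneg_nonneg less_imp_le[OF Epos])
      qed
      then show "(\<Sum>s\<in>T. \<Sum>t\<in>T. (\<Sum>k\<in>K. c' \<theta> s k * c \<theta> t k) * (\<integral>x. G2 \<theta> s t x \<partial>PiG K)) \<le> 0"
        by (intro sum_nonpos) auto
    qed simp
    finally show ?thesis .
  qed
  have "\<psi> (pi/2) \<le> \<psi> 0"
    by (rule DERIV_nonpos_imp_nonincreasing) (use deriv Dle in auto)
  then show ?thesis
    by (simp add: \<psi>_def R_def E_def c_def)
qed

subsection \<open>Slepian's inequality\<close>

text \<open>The shift \<open>sqrt n\<close> decides the boundary case: at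
  \<open>Z t = \<tau> t\<close> the exponent still tends to minus infinity, while a strict excess of
  order \<open>n\<close> outweighs the shift.\<close>

lemma slepian_indicator_limit:
  fixes Z \<tau> :: "'t \<Rightarrow> real"
  assumes T: "finite T"
  shows "(\<lambda>n. exp (- (\<Sum>t\<in>T. exp (real n * Z t - (real n * \<tau> t + sqrt (real n))))))
    \<longlonglongrightarrow> (if \<forall>t\<in>T. Z t \<le> \<tau> t then 1 else 0)"
proof (cases "\<forall>t\<in>T. Z t \<le> \<tau> t")
  case True
  have "(\<lambda>n. exp (real n * Z t - (real n * \<tau> t + sqrt (real n)))) \<longlonglongrightarrow> 0" if "t \<in> T" for t
  proof (rule tendsto_sandwich[where f="\<lambda>_. 0"])
    show "(\<lambda>n. exp (- sqrt (real n))) \<longlonglongrightarrow> 0" by real_asymp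
    show "\<forall>\<^sub>F n in sequentially. exp (real n * Z t - (real n * \<tau> t + sqrt (real n))) \<le> exp (- sqrt (real n))"
      using True that by (auto intro!: always_eventually mult_left_mono)
  qed auto
  then have "(\<lambda>n. exp (- (\<Sum>t\<in>T. exp (real n * Z t - (real n * \<tau> t + sqrt (real n))))))
    \<longlonglongrightarrow> exp (- (\<Sum>t\<in>T. 0))"
    by (intro tendsto_intros)
  then show ?thesis using True by simp
next
  case False
  then obtain t where t: "t \<in> T" "Z t > \<tau> t" by force
  define d where "d = Z t - \<tau> t"
  have d: "d > 0" using t by (simp add: d_def)
  have "(\<lambda>n. exp (- (\<Sum>t\<in>T. exp (real n * Z t - (real n * \<tau> t + sqrt (real n)))))) \<longlonglongrightarrow> 0"
  proof (rule tendsto_sandwich[where f="\<lambda>_. 0"])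
    show "(\<lambda>n. exp (- exp (real n * d - sqrt (real n)))) \<longlonglongrightarrow> 0"
      using d by real_asymp
    have "exp (real n * d - sqrt (real n)) \<le> (\<Sum>t\<in>T. exp (real n * Z t - (real n * \<tau> t + sqrt (real n))))" for n
      using member_le_sum[of t T "\<lambda>t. exp (real n * Z t - (real n * \<tau> t + sqrt (real n)))"] t T
      by (simp add: d_def algebra_simps)
    then show "\<forall>\<^sub>F n in sequentially. exp (- (\<Sum>t\<in>T. exp (real n * Z t - (real n * \<tau> t + sqrt (real n)))))
        \<le> exp (- exp (real n * d - sqrt (real n)))"
      by (auto intro!: always_eventually)
  qed auto
  then show ?thesis using False by auto
qed

lemma slepian_PiG:
  fixes A B :: "'t \<Rightarrow> 'k \<Rightarrow> real"
  assumes T: "finite T" and K: "finite K"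
    and orth: "\<And>s t. s \<in> T \<Longrightarrow> t \<in> T \<Longrightarrow> (\<Sum>k\<in>K. A s k * B t k) = 0"
    and var: "\<And>t. t \<in> T \<Longrightarrow> (\<Sum>k\<in>K. (A t k)\<^sup>2) = (\<Sum>k\<in>K. (B t k)\<^sup>2)"
    and cov: "\<And>s t. s \<in> T \<Longrightarrow> t \<in> T \<Longrightarrow> (\<Sum>k\<in>K. B s k * B t k) \<le> (\<Sum>k\<in>K. A s k * A t k)"
  shows "measure (PiG K) {x\<in>space (PiG K). \<forall>t\<in>T. (\<Sum>k\<in>K. B t k * x k) \<le> \<tau> t}
       \<le> measure (PiG K) {x\<in>space (PiG K). \<forall>t\<in>T. (\<Sum>k\<in>K. A t k * x k) \<le> \<tau> t}"
proof -
  interpret prob_space "PiG K" by (rule prob_space_PiG)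
  let ?I = "\<lambda>A n. \<integral>x. exp (- (\<Sum>t\<in>T. exp (real n * (\<Sum>k\<in>K. A t k * x k) - (real n * \<tau> t + sqrt (real n))))) \<partial>PiG K"
  have [measurable]: "(\<lambda>x. x k) \<in> borel_measurable (PiG K)" if "k \<in> K" for k
    using that by simp
  have lim: "?I A \<longlonglongrightarrow> measure (PiG K) {x\<in>space (PiG K). \<forall>t\<in>T. (\<Sum>k\<in>K. A t k * x k) \<le> \<tau> t}" for A
  proof -
    let ?S = "{x\<in>space (PiG K). \<forall>t\<in>T. (\<Sum>k\<in>K. A t k * x k) \<le> \<tau> t}"
    have S[measurable]: "?S \<in> sets (PiG K)" using T by measurable
    have "?I A \<longlonglongrightarrow> (\<integral>x. indicator ?S x \<partial>PiG K)"
    proof (rule integral_dominated_convergence[where w="\<lambda>_. 1"])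
      show "AE x in PiG K. (\<lambda>n. exp (- (\<Sum>t\<in>T. exp (real n * (\<Sum>k\<in>K. A t k * x k) - (real n * \<tau> t + sqrt (real n))))))
          \<longlonglongrightarrow> indicator ?S x"
      proof (rule AE_I2)
        fix x assume x: "x \<in> space (PiG K)"
        have eq: "indicator ?S x = (if \<forall>t\<in>T. (\<Sum>k\<in>K. A t k * x k) \<le> \<tau> t then 1 else 0 :: real)"
          using x by (auto simp: indicator_def)
        show "(\<lambda>n. exp (- (\<Sum>t\<in>T. exp (real n * (\<Sum>k\<in>K. A t k * x k) - (real n * \<tau> t + sqrt (real n))))))
          \<longlonglongrightarrow> indicator ?S x"
          unfolding eq by (rule slepian_indicator_limit[OF T])
      qed
    qed (auto simp: sum_nonneg)
    then show ?thesis using S by simp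
  qed
  show ?thesis
    by (rule LIMSEQ_le[OF lim lim]) (intro exI[of _ 0] allI impI slepian_smooth[OF T K orth var cov])
qed

text \<open>The index set is arbitrary, so that the same estimates serve the whole matrix, a single
  row and a symmetrised row.\<close>

locale iid_std_normal = prob_space +
  fixes X :: "'k \<Rightarrow> 'a \<Rightarrow> real" and I :: "'k set"
  assumes indep: "indep_vars (\<lambda>_. borel) X I"
    and dist: "k \<in> I \<Longrightarrow> distributed M lborel (X k) std_normal_density"
begin

lemma X_measurable[measurable]: "k \<in> I \<Longrightarrow> X k \<in> borel_measurable M"
  using dist distributed_measurable by fastforce

lemma distr_X: "k \<in> I \<Longrightarrow> distr M borel (X k) = std_gauss"
  using distributed_distr_eq_density[OF dist, of k] distr_cong[OF refl, of lborel borel M "X k" "X k"] by simp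

lemma joint_distr:
  assumes "K \<subseteq> I" "K \<noteq> {}"
  shows "distr M (PiG K) (\<lambda>\<omega>. \<lambda>k\<in>K. X k \<omega>) = PiG K"
proof -
  have "distr M (PiM K (\<lambda>_. borel)) (\<lambda>\<omega>. \<lambda>k\<in>K. X k \<omega>) = PiM K (\<lambda>k. distr M borel (X k))"
    using indep_vars_subset[OF indep assms(1)] assms X_measurable
    by (subst indep_vars_iff_distr_eq_PiM'[symmetric]) auto
  also have "\<dots> = PiG K"
    using assms distr_X by (intro PiM_cong) auto
  finally show ?thesis
    by (subst (asm) distr_cong[OF refl _ refl, of _ "PiG K"]) (auto intro!: sets_PiM_cong)
qed

lemma prob_eq_PiG:
  assumes K: "K \<subseteq> I" "finite K" "K \<noteq> {}" and T: "finite T"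
  shows "prob {\<omega>\<in>space M. \<forall>t\<in>T. (\<Sum>k\<in>K. A t k * X k \<omega>) \<le> \<tau> t} =
    measure (PiG K) {x\<in>space (PiG K). \<forall>t\<in>T. (\<Sum>k\<in>K. A t k * x k) \<le> \<tau> t}"
proof -
  have [measurable]: "(\<lambda>x. x k) \<in> borel_measurable (PiG K)" if "k \<in> K" for k
    using that by simp
  have m: "(\<lambda>\<omega>. \<lambda>k\<in>K. X k \<omega>) \<in> measurable M (PiG K)"
    using K(1) by (intro measurable_restrict) auto
  have S: "{x\<in>space (PiG K). \<forall>t\<in>T. (\<Sum>k\<in>K. A t k * x k) \<le> \<tau> t} \<in> sets (PiG K)" (is "?S \<in> _")
    using T by measurable
  have "measure (PiG K) ?S = measure (distr M (PiG K) (\<lambda>\<omega>. \<lambda>k\<in>K. X k \<omega>)) ?S"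
    using joint_distr[OF K(1,3)] by simp
  also have "\<dots> = prob {\<omega>\<in>space M. \<forall>t\<in>T. (\<Sum>k\<in>K. A t k * X k \<omega>) \<le> \<tau> t}"
    using m S by (subst measure_distr) (auto intro!: arg_cong[where f=prob] simp: space_PiM)
  finally show ?thesis ..
qed

lemma slepian_finite:
  fixes A B :: "'t \<Rightarrow> 'k \<Rightarrow> real"
  assumes T: "finite T" and K: "K \<subseteq> I" "finite K"
    and orth: "\<And>s t. s \<in> T \<Longrightarrow> t \<in> T \<Longrightarrow> (\<Sum>k\<in>K. A s k * B t k) = 0"
    and var: "\<And>t. t \<in> T \<Longrightarrow> (\<Sum>k\<in>K. (A t k)\<^sup>2) = (\<Sum>k\<in>K. (B t k)\<^sup>2)"
    and cov: "\<And>s t. s \<in> T \<Longrightarrow> t \<in> T \<Longrightarrow> (\<Sum>k\<in>K. B s k * B t k) \<le> (\<Sum>k\<in>K. A s k * A t k)"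
  shows "prob {\<omega>\<in>space M. \<forall>t\<in>T. (\<Sum>k\<in>K. B t k * X k \<omega>) \<le> \<tau> t}
       \<le> prob {\<omega>\<in>space M. \<forall>t\<in>T. (\<Sum>k\<in>K. A t k * X k \<omega>) \<le> \<tau> t}"
proof (cases "K = {}")
  case False
  show ?thesis
    unfolding prob_eq_PiG[OF K False T] by (rule slepian_PiG[OF T K(2) orth var cov])
qed simp

lemma slepian_countable:
  fixes A B :: "'t \<Rightarrow> 'k \<Rightarrow> real"
  assumes T: "countable T" and K: "K \<subseteq> I" "finite K"
    and orth: "\<And>s t. s \<in> T \<Longrightarrow> t \<in> T \<Longrightarrow> (\<Sum>k\<in>K. A s k * B t k) = 0"
    and var: "\<And>t. t \<in> T \<Longrightarrow> (\<Sum>k\<in>K. (A t k)\<^sup>2) = (\<Sum>k\<in>K. (B t k)\<^sup>2)"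
    and cov: "\<And>s t. s \<in> T \<Longrightarrow> t \<in> T \<Longrightarrow> (\<Sum>k\<in>K. B s k * B t k) \<le> (\<Sum>k\<in>K. A s k * A t k)"
  shows "prob {\<omega>\<in>space M. \<forall>t\<in>T. (\<Sum>k\<in>K. B t k * X k \<omega>) \<le> \<tau> t}
       \<le> prob {\<omega>\<in>space M. \<forall>t\<in>T. (\<Sum>k\<in>K. A t k * X k \<omega>) \<le> \<tau> t}"
proof (cases "T = {}")
  case False
  define e where "e = from_nat_into T"
  have e: "range e = T" using False T by (simp add: e_def range_from_nat_into)
  have [measurable]: "X k \<in> borel_measurable M" if "k \<in> K" for k using that K by auto
  let ?S = "\<lambda>A n. {\<omega>\<in>space M. \<forall>t\<in>e ` {..n}. (\<Sum>k\<in>K. A t k * X k \<omega>) \<le> \<tau> t}"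
  have lim: "(\<lambda>n. prob (?S A n)) \<longlonglongrightarrow> prob {\<omega>\<in>space M. \<forall>t\<in>T. (\<Sum>k\<in>K. A t k * X k \<omega>) \<le> \<tau> t}" for A
  proof -
    have "(\<lambda>n. prob (?S A n)) \<longlonglongrightarrow> prob (\<Inter>n. ?S A n)"
      by (intro finite_Lim_measure_decseq) (auto simp: decseq_def)
    also have "(\<Inter>n. ?S A n) = {\<omega>\<in>space M. \<forall>t\<in>T. (\<Sum>k\<in>K. A t k * X k \<omega>) \<le> \<tau> t}"
      unfolding e[symmetric] by auto
    finally show ?thesis .
  qed
  show ?thesis
  proof (rule LIMSEQ_le[OF lim lim], intro exI[of _ 0] allI impI)
    fix n
    have sub: "t \<in> T" if "t \<in> e ` {..n}" for t using that e by auto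
    show "prob (?S B n) \<le> prob (?S A n)"
      by (rule slepian_finite[OF _ K orth var cov]) (auto dest!: sub)
  qed
qed simp

text \<open>With continuous coefficients and thresholds each constraint is closed in
  \<open>t\<close>, so both events are already decided on a countable dense subset of
  \<open>T\<close>.\<close>

lemma slepian:
  fixes A B :: "'t::{metric_space, second_countable_topology} \<Rightarrow> 'k \<Rightarrow> real"
  assumes K: "K \<subseteq> I" "finite K"
    and cA: "\<And>k. continuous_on UNIV (\<lambda>t. A t k)" and cB: "\<And>k. continuous_on UNIV (\<lambda>t. B t k)"
    and ct: "continuous_on UNIV \<tau>"
    and orth: "\<And>s t. s \<in> T \<Longrightarrow> t \<in> T \<Longrightarrow> (\<Sum>k\<in>K. A s k * B t k) = 0"
    and var: "\<And>t. t \<in> T \<Longrightarrow> (\<Sum>k\<in>K. (A t k)\<^sup>2) = (\<Sum>k\<in>K. (B t k)\<^sup>2)"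
    and cov: "\<And>s t. s \<in> T \<Longrightarrow> t \<in> T \<Longrightarrow> (\<Sum>k\<in>K. B s k * B t k) \<le> (\<Sum>k\<in>K. A s k * A t k)"
  shows "prob {\<omega>\<in>space M. \<forall>t\<in>T. (\<Sum>k\<in>K. B t k * X k \<omega>) \<le> \<tau> t}
       \<le> prob {\<omega>\<in>space M. \<forall>t\<in>T. (\<Sum>k\<in>K. A t k * X k \<omega>) \<le> \<tau> t}"
proof -
  obtain D where D: "countable D" "D \<subseteq> T" "T \<subseteq> closure D"
    using separable by blast
  have eq: "{\<omega>\<in>space M. \<forall>t\<in>T. (\<Sum>k\<in>K. A t k * X k \<omega>) \<le> \<tau> t} = {\<omega>\<in>space M. \<forall>t\<in>D. (\<Sum>k\<in>K. A t k * X k \<omega>) \<le> \<tau> t}"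
    if "\<And>k. continuous_on UNIV (\<lambda>t. A t k)" for A
  proof (intro Collect_cong conj_cong refl iffI ballI)
    fix \<omega> t assume t: "\<forall>t\<in>D. (\<Sum>k\<in>K. A t k * X k \<omega>) \<le> \<tau> t" "t \<in> T"
    have "closed {t. (\<Sum>k\<in>K. A t k * X k \<omega>) \<le> \<tau> t}"
      by (intro closed_Collect_le continuous_intros that ct)
    then have "closure D \<subseteq> {t. (\<Sum>k\<in>K. A t k * X k \<omega>) \<le> \<tau> t}"
      using t by (intro closure_minimal) auto
    then show "(\<Sum>k\<in>K. A t k * X k \<omega>) \<le> \<tau> t" using D t by auto
  qed (use D in auto)
  show ?thesis
    unfolding eq[OF cA] eq[OF cB]
    by (rule slepian_countable[OF D(1) K orth var cov]) (use D in auto)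
qed

end

subsection \<open>Sums of independent standard Gaussians\<close>

definition abs_moment :: "real \<Rightarrow> real" where
  "abs_moment q = (\<integral>x. \<bar>x\<bar> powr q \<partial>std_gauss)"

lemma integrable_abs_powr:
  assumes "q \<ge> 0" shows "integrable std_gauss (\<lambda>x. \<bar>x\<bar> powr q)"
proof -
  define n where "n = nat \<lceil>q\<rceil>"
  have n: "q \<le> real n" unfolding n_def by linarith
  have bd: "\<bar>x\<bar> powr q \<le> 1 + \<bar>x\<bar> ^ n" for x :: real
  proof (cases "\<bar>x\<bar> \<le> 1")
    case True
    then have "\<bar>x\<bar> powr q \<le> 1" using assms by (simp add: powr_le1)
    then show ?thesis by (simp add: add_increasing2)
  next
    case False
    then have "\<bar>x\<bar> powr q \<le> \<bar>x\<bar> powr real n" using n by (intro powr_mono) auto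
    then show ?thesis using False by (simp add: powr_realpow)
  qed
  have "integrable lborel (\<lambda>x. std_normal_density x * \<bar>x\<bar> ^ n)"
    by (rule integrable_std_normal_moment_abs)
  then have "integrable std_gauss (\<lambda>x. \<bar>x\<bar> ^ n)"
    by (subst integrable_density) auto
  moreover have "integrable std_gauss (\<lambda>x. 1::real)"
    using prob_space_std_gauss
    by (intro finite_measure.integrable_const prob_space.finite_measure)
  ultimately have "integrable std_gauss (\<lambda>x. 1 + \<bar>x\<bar> ^ n)"
    by (rule Bochner_Integration.integrable_add[rotated])
  then show ?thesis
    by (rule Bochner_Integration.integrable_bound) (auto intro!: AE_I2 order.trans[OF bd])
qed

lemma abs_moment_nonneg: "abs_moment q \<ge> 0"
  by (simp add: abs_moment_def)

lemma abs_moment_2: "abs_moment 2 = 1"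
proof -
  have "abs_moment 2 = (\<integral>x. std_normal_density x * x ^ (2*1) \<partial>lborel)"
    unfolding abs_moment_def by (subst integral_density) auto
  also have "\<dots> = 1" by (subst integral_std_normal_moment_even) simp
  finally show ?thesis .
qed

text \<open>A vanishing moment would force x = 0 almost everywhere and contradict the second moment
  1.\<close>

lemma abs_moment_pos:
  assumes "q > 0" shows "abs_moment q > 0"
proof (rule ccontr)
  assume "\<not> abs_moment q > 0"
  then have "abs_moment q = 0" using abs_moment_nonneg[of q] by linarith
  then have "AE x in std_gauss. \<bar>x\<bar> powr q = 0"
    using integrable_abs_powr[of q] assms
    by (subst (asm) abs_moment_def, subst (asm) integral_nonneg_eq_0_iff_AE) auto
  then have "AE x in std_gauss. \<bar>x\<bar> powr 2 = 0" by eventually_elim auto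
  then have "abs_moment 2 = 0"
    unfolding abs_moment_def by (rule integral_eq_zero_AE)
  then show False by (simp add: abs_moment_2)
qed

context iid_std_normal
begin

lemma expectation_X:
  fixes f :: "real \<Rightarrow> real"
  assumes "k \<in> I" "f \<in> borel_measurable borel"
  shows "expectation (\<lambda>\<omega>. f (X k \<omega>)) = (\<integral>x. f x \<partial>std_gauss)"
proof -
  have "(\<integral>x. f x \<partial>std_gauss) = (\<integral>x. f x \<partial>distr M borel (X k))" using distr_X assms by simp
  also have "\<dots> = expectation (\<lambda>\<omega>. f (X k \<omega>))" using assms by (subst integral_distr) auto
  finally show ?thesis ..
qed

lemma integrable_X:
  fixes f :: "real \<Rightarrow> real"
  assumes "k \<in> I" "integrable std_gauss f"
  shows "integrable M (\<lambda>\<omega>. f (X k \<omega>))"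
proof -
  have "f \<in> borel_measurable borel" using assms(2) by auto
  moreover have "integrable (distr M borel (X k)) f" using distr_X assms by simp
  ultimately show ?thesis using assms by (subst (asm) integrable_distr_eq) auto
qed

lemma prob_X: 
  assumes "k \<in> I" "S \<in> sets borel"
  shows "prob {\<omega>\<in>space M. X k \<omega> \<in> S} = measure std_gauss S"
proof -
  have "measure std_gauss S = measure (distr M borel (X k)) S" using distr_X assms by simp
  also have "\<dots> = prob {\<omega>\<in>space M. X k \<omega> \<in> S}"
    using assms by (subst measure_distr) (auto intro!: arg_cong[where f=prob])
  finally show ?thesis ..
qed

lemma expectation_X_mult:
  fixes f :: "real \<Rightarrow> real"
  assumes ij: "i \<in> I" "j \<in> I" "i \<noteq> j" and f: "integrable std_gauss f"
  shows "integrable M (\<lambda>\<omega>. f (X i \<omega>) * f (X j \<omega>))"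
    "expectation (\<lambda>\<omega>. f (X i \<omega>) * f (X j \<omega>)) = (\<integral>x. f x \<partial>std_gauss)\<^sup>2"
proof -
  have [measurable]: "f \<in> borel_measurable borel" using f by auto
  have iv: "indep_vars (\<lambda>_. borel) (\<lambda>k \<omega>. f (X k \<omega>)) {i,j}"
    using ij by (intro indep_vars_compose2[OF indep_vars_subset[OF indep]]) auto
  have int: "integrable M (\<lambda>\<omega>. f (X k \<omega>))" if "k \<in> {i,j}" for k
    using that ij integrable_X[OF _ f] by auto
  show "integrable M (\<lambda>\<omega>. f (X i \<omega>) * f (X j \<omega>))"
    using indep_vars_integrable[OF _ iv int] ij by simp
  show "expectation (\<lambda>\<omega>. f (X i \<omega>) * f (X j \<omega>)) = (\<integral>x. f x \<partial>std_gauss)\<^sup>2"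
    using indep_vars_lebesgue_integral[OF _ iv int] ij expectation_X[of _ f]
    by (simp add: power2_eq_square)
qed

text \<open>Chebyshev's inequality: products of two different centred summands have expectation 0,
  and each variance is at most \<open>abs_moment (2*q)\<close>.\<close>

lemma abs_powr_sum_deviation:
  assumes J: "J \<subseteq> I" "finite J" "J \<noteq> {}" and q: "q \<ge> 0" and \<epsilon>: "\<epsilon> > 0"
  shows "prob {\<omega>\<in>space M. \<epsilon> * real (card J) \<le> \<bar>(\<Sum>j\<in>J. \<bar>X j \<omega>\<bar> powr q) - real (card J) * abs_moment q\<bar>}
    \<le> abs_moment (2*q) / (\<epsilon>\<^sup>2 * real (card J))"
proof -
  define f where "f x = \<bar>x\<bar> powr q - abs_moment q" for x :: real
  define S where "S \<omega> = (\<Sum>j\<in>J. f (X j \<omega>))" for \<omega>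
  interpret G: prob_space std_gauss by (rule prob_space_std_gauss)
  note i1 = integrable_abs_powr[OF q]
  have i2: "integrable std_gauss (\<lambda>x. \<bar>x\<bar> powr (2*q))" using q by (intro integrable_abs_powr) auto
  have sq: "(f x)\<^sup>2 = \<bar>x\<bar> powr (2*q) - 2 * abs_moment q * \<bar>x\<bar> powr q + (abs_moment q)\<^sup>2" for x
    by (simp add: f_def power2_eq_square algebra_simps powr_add[symmetric])
  have fi: "integrable std_gauss f" unfolding f_def using i1 by auto
  have fsi: "integrable std_gauss (\<lambda>x. (f x)\<^sup>2)" unfolding sq using i1 i2 by auto
  have f0: "(\<integral>x. f x \<partial>std_gauss) = 0"
    unfolding f_def using i1 G.prob_space by (simp add: abs_moment_def)
  have f2: "(\<integral>x. (f x)\<^sup>2 \<partial>std_gauss) \<le> abs_moment (2*q)"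
    unfolding sq using i1 i2 G.prob_space by (simp add: abs_moment_def[symmetric] power2_eq_square)
  have XI: "j \<in> I" if "j \<in> J" for j using J that by auto
  have [measurable]: "f \<in> borel_measurable borel" unfolding f_def by measurable
  have int: "integrable M (\<lambda>\<omega>. f (X i \<omega>) * f (X j \<omega>))" if "i \<in> J" "j \<in> J" for i j
    using integrable_X[OF XI fsi, of i] expectation_X_mult(1)[OF XI XI _ fi, of i j] that
    by (cases "i = j") (auto simp: power2_eq_square)
  have ex: "expectation (\<lambda>\<omega>. f (X i \<omega>) * f (X j \<omega>)) = (if i = j then (\<integral>x. (f x)\<^sup>2 \<partial>std_gauss) else 0)"
    if "i \<in> J" "j \<in> J" for i j
    using expectation_X[OF XI, of i "\<lambda>x. (f x)\<^sup>2"] expectation_X_mult(2)[OF XI XI _ fi, of i j] that f0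
    by (auto simp: power2_eq_square)
  have S2: "(S \<omega>)\<^sup>2 = (\<Sum>i\<in>J. \<Sum>j\<in>J. f (X i \<omega>) * f (X j \<omega>))" for \<omega>
    by (simp add: S_def power2_eq_square sum_product)
  have Si: "integrable M (\<lambda>\<omega>. (S \<omega>)\<^sup>2)"
    unfolding S2 by (intro Bochner_Integration.integrable_sum int)
  have "expectation (\<lambda>\<omega>. (S \<omega>)\<^sup>2) = (\<Sum>i\<in>J. \<Sum>j\<in>J. expectation (\<lambda>\<omega>. f (X i \<omega>) * f (X j \<omega>)))"
    unfolding S2 using int by (simp add: Bochner_Integration.integral_sum)
  also have "\<dots> = (\<Sum>i\<in>J. \<Sum>j\<in>J. (if i = j then (\<integral>x. (f x)\<^sup>2 \<partial>std_gauss) else 0))"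
    by (intro sum.cong refl ex)
  also have "\<dots> \<le> real (card J) * abs_moment (2*q)"
    using J f2 by (simp add: mult_left_mono)
  finally have E: "expectation (\<lambda>\<omega>. (S \<omega>)\<^sup>2) \<le> real (card J) * abs_moment (2*q)" .
  have n: "real (card J) > 0" using J by (simp add: card_gt_0_iff)
  define c where "c = (\<epsilon> * real (card J))\<^sup>2"
  have c: "c > 0" using n \<epsilon> by (simp add: c_def)
  have S_eq: "S \<omega> = (\<Sum>j\<in>J. \<bar>X j \<omega>\<bar> powr q) - real (card J) * abs_moment q" for \<omega>
    by (simp add: S_def f_def sum_subtractf)
  have "{\<omega>\<in>space M. \<epsilon> * real (card J) \<le> \<bar>(\<Sum>j\<in>J. \<bar>X j \<omega>\<bar> powr q) - real (card J) * abs_moment q\<bar>}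
      = {\<omega>\<in>space M. (S \<omega>)\<^sup>2 \<ge> c}"
    unfolding S_eq[symmetric] c_def using n \<epsilon> by (auto simp: abs_le_square_iff[symmetric])
  also have "prob \<dots> \<le> expectation (\<lambda>\<omega>. (S \<omega>)\<^sup>2) / c"
    by (rule integral_Markov_inequality_measure[OF Si, of "{}"]) (use c in auto)
  also have "\<dots> \<le> (real (card J) * abs_moment (2*q)) / c"
    using E c by (intro divide_right_mono) auto
  also have "\<dots> = abs_moment (2*q) / (\<epsilon>\<^sup>2 * real (card J))"
    using n by (simp add: c_def power2_eq_square)
  finally show ?thesis .
qed

text \<open>A union bound over \<open>J\<close> with Markov's inequality for the moment of order
  \<open>q\<close>; the free choice of \<open>q\<close> sets the power of \<open>card J\<close> in
  the result.\<close>

lemma prob_exists_large: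
  assumes J: "J \<subseteq> I" "finite J" and q: "q > 0" and s: "s > 0"
  shows "prob {\<omega>\<in>space M. \<exists>j\<in>J. \<bar>X j \<omega>\<bar> \<ge> s} \<le> real (card J) * abs_moment q / s powr q"
proof -
  have [measurable]: "X j \<in> borel_measurable M" if "j \<in> J" for j using J that by auto
  have "prob {\<omega>\<in>space M. \<exists>j\<in>J. \<bar>X j \<omega>\<bar> \<ge> s} = prob (\<Union>j\<in>J. {\<omega>\<in>space M. \<bar>X j \<omega>\<bar> \<ge> s})"
    by (rule arg_cong[where f=prob]) auto
  also have "\<dots> \<le> (\<Sum>j\<in>J. prob {\<omega>\<in>space M. \<bar>X j \<omega>\<bar> \<ge> s})"
    using J(2) by (intro finite_measure_subadditive_finite) auto
  also have "\<dots> \<le> (\<Sum>j\<in>J. abs_moment q / s powr q)"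
  proof (rule sum_mono)
    fix j assume j: "j \<in> J"
    have i: "integrable M (\<lambda>\<omega>. \<bar>X j \<omega>\<bar> powr q)"
      using integrable_X[of j] integrable_abs_powr[of q] j J q by auto
    have "prob {\<omega>\<in>space M. \<bar>X j \<omega>\<bar> \<ge> s} = prob {\<omega>\<in>space M. \<bar>X j \<omega>\<bar> powr q \<ge> s powr q}"
    proof -
      have "s powr q \<le> \<bar>y\<bar> powr q \<longleftrightarrow> s \<le> \<bar>y\<bar>" for y
        using q s powr_mono2[of q s "\<bar>y\<bar>"] powr_less_mono2[of q "\<bar>y\<bar>" s] by force
      then show ?thesis by simp
    qed
    also have "\<dots> \<le> expectation (\<lambda>\<omega>. \<bar>X j \<omega>\<bar> powr q) / s powr q"
      by (rule integral_Markov_inequality_measure[OF i, of "{}"]) (use s in auto)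
    also have "\<dots> = abs_moment q / s powr q"
      using expectation_X[of j "\<lambda>x. \<bar>x\<bar> powr q"] j J by (auto simp: abs_moment_def)
    finally show "prob {\<omega>\<in>space M. \<bar>X j \<omega>\<bar> \<ge> s} \<le> abs_moment q / s powr q" .
  qed
  finally show ?thesis by simp
qed

text \<open>Symmetry: the events \<open>X k \<ge> 0\<close> and \<open>- X k \<ge> 0\<close> are
  equally likely and cover the space.\<close>

lemma prob_X_nonneg:
  assumes "k \<in> I" shows "prob {\<omega>\<in>space M. X k \<omega> \<ge> 0} \<ge> 1/2"
proof -
  have [measurable]: "X k \<in> borel_measurable M" using assms by simp
  have "distributed M lborel (\<lambda>\<omega>. 0 + (-1) * X k \<omega>) (normal_density (0 + (-1) * 0) (\<bar>-1\<bar> * 1))"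
    by (rule normal_density_affine[OF dist[OF assms]]) auto
  then have "distributed M lborel (\<lambda>\<omega>. - X k \<omega>) std_normal_density" by simp
  from distributed_distr_eq_density[OF this]
  have "distr M borel (\<lambda>\<omega>. - X k \<omega>) = std_gauss"
    using distr_cong[OF refl, of lborel borel M "\<lambda>\<omega>. - X k \<omega>" "\<lambda>\<omega>. - X k \<omega>"] by simp
  then have "measure (distr M borel (\<lambda>\<omega>. - X k \<omega>)) {0..} = measure (distr M borel (X k)) {0..}"
    using distr_X[OF assms] by simp
  then have "prob {\<omega>\<in>space M. - X k \<omega> \<ge> 0} = prob {\<omega>\<in>space M. X k \<omega> \<ge> 0}"
    by (simp add: measure_distr vimage_def Int_def conj_commute)
  moreover have "1 \<le> prob {\<omega>\<in>space M. - X k \<omega> \<ge> 0} + prob {\<omega>\<in>space M. X k \<omega> \<ge> 0}"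
  proof -
    have "1 = prob ({\<omega>\<in>space M. - X k \<omega> \<ge> 0} \<union> {\<omega>\<in>space M. X k \<omega> \<ge> 0})"
      by (subst prob_space[symmetric], rule arg_cong[where f=prob]) auto
    also have "\<dots> \<le> prob {\<omega>\<in>space M. - X k \<omega> \<ge> 0} + prob {\<omega>\<in>space M. X k \<omega> \<ge> 0}"
      by (rule measure_Un_le) auto
    finally show ?thesis .
  qed
  ultimately show ?thesis by linarith
qed

text \<open>Fubini for two independent blocks: a bound that holds with the first block frozen at any
  value holds outright. The elimination step freezes a row and column in this way and keeps only the
  minor random.\<close>

lemma prob_le_section:
  assumes A: "A \<subseteq> I" and B: "B \<subseteq> I" and AB: "A \<inter> B = {}"
    and Q: "Q \<in> sets (PiM A (\<lambda>_. borel) \<Otimes>\<^sub>M PiM B (\<lambda>_. borel))"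
    and \<delta>: "\<And>x. x \<in> space (PiM A (\<lambda>_. borel)) \<Longrightarrow> prob {\<omega>\<in>space M. (x, \<lambda>k\<in>B. X k \<omega>) \<in> Q} \<le> \<delta>"
  shows "prob {\<omega>\<in>space M. (\<lambda>k\<in>A. X k \<omega>, \<lambda>k\<in>B. X k \<omega>) \<in> Q} \<le> \<delta>"
proof -
  let ?PA = "PiM A (\<lambda>_. borel :: real measure)" and ?PB = "PiM B (\<lambda>_. borel :: real measure)"
  let ?XA = "\<lambda>\<omega>. \<lambda>k\<in>A. X k \<omega>" and ?XB = "\<lambda>\<omega>. \<lambda>k\<in>B. X k \<omega>"
  have iv: "indep_var ?PA ?XA ?PB ?XB"
    by (rule indep_var_restrict[OF indep AB A B])
  have mA[measurable]: "?XA \<in> measurable M ?PA" and mB[measurable]: "?XB \<in> measurable M ?PB"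
    using A B by (auto intro!: measurable_restrict)
  interpret A: prob_space "distr M ?PA ?XA" by (rule prob_space_distr) simp
  interpret B: prob_space "distr M ?PB ?XB" by (rule prob_space_distr) simp
  have eq: "distr M ?PA ?XA \<Otimes>\<^sub>M distr M ?PB ?XB = distr M (?PA \<Otimes>\<^sub>M ?PB) (\<lambda>\<omega>. (?XA \<omega>, ?XB \<omega>))"
    using iv by (simp add: indep_var_distribution_eq)
  obtain x0 where "x0 \<in> space ?PA" by (auto simp: space_PiM PiE_eq_empty_iff ex_in_conv[symmetric] intro: that[of "\<lambda>k\<in>A. 0"])
  then have \<delta>0: "\<delta> \<ge> 0" using \<delta>[of x0] measure_nonneg order_trans by blast
  have "emeasure M {\<omega>\<in>space M. (?XA \<omega>, ?XB \<omega>) \<in> Q} = emeasure (distr M (?PA \<Otimes>\<^sub>M ?PB) (\<lambda>\<omega>. (?XA \<omega>, ?XB \<omega>))) Q"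
    using Q by (subst emeasure_distr) (auto intro!: arg_cong[where f="emeasure M"])
  also have "\<dots> = (\<integral>\<^sup>+x. emeasure (distr M ?PB ?XB) (Pair x -` Q) \<partial>distr M ?PA ?XA)"
    unfolding eq[symmetric] using Q by (intro B.emeasure_pair_measure_alt) (simp cong: sets_pair_measure_cong)
  also have "\<dots> \<le> (\<integral>\<^sup>+x. ennreal \<delta> \<partial>distr M ?PA ?XA)"
  proof (rule nn_integral_mono)
    fix x assume x: "x \<in> space (distr M ?PA ?XA)"
    have "emeasure (distr M ?PB ?XB) (Pair x -` Q) = emeasure M {\<omega>\<in>space M. (x, ?XB \<omega>) \<in> Q}"
      using Q by (subst emeasure_distr) (auto intro!: arg_cong[where f="emeasure M"] sets_Pair1)
    also have "\<dots> \<le> ennreal \<delta>"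
      using \<delta>[of x] x by (simp add: emeasure_eq_measure ennreal_leI)
    finally show "emeasure (distr M ?PB ?XB) (Pair x -` Q) \<le> ennreal \<delta>" .
  qed
  also have "\<dots> = ennreal \<delta>" using A.emeasure_space_1 by simp
  finally show ?thesis using \<delta>0 by (simp add: emeasure_eq_measure)
qed

end

subsection \<open>The Gaussian quadratic form\<close>

text \<open>The index set is a parameter because minors occur as well. Vectors are total functions
  on \<open>nat\<close>, whose product topology supplies the countable dense sets for comparison and
  measurability.\<close>

definition quad :: "nat set \<Rightarrow> (nat \<Rightarrow> nat \<Rightarrow> real) \<Rightarrow> (nat \<Rightarrow> real) \<Rightarrow> real" where
  "quad J a x = (\<Sum>i\<in>J. \<Sum>j\<in>J. a i j * (x i * x j))"

definition inner_on :: "nat set \<Rightarrow> (nat \<Rightarrow> real) \<Rightarrow> (nat \<Rightarrow> real) \<Rightarrow> real" where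
  "inner_on J x y = (\<Sum>i\<in>J. x i * y i)"

lemma inner_on_self: "inner_on J x x = (L2_set x J)\<^sup>2"
  by (simp add: inner_on_def L2_set_def sum_nonneg power2_eq_square)

lemma sum_sum_rank_one: 
  "(\<Sum>i\<in>J. \<Sum>j\<in>J. (x i * x j) * (y i * y j)) = (inner_on J x y)\<^sup>2"
  by (simp add: inner_on_def power2_eq_square sum_product mult_ac)

lemma continuous_on_coordinate[continuous_intros]: "continuous_on S (\<lambda>x::nat \<Rightarrow> real. x i)"
  by (rule continuous_on_subset[OF continuous_on_product_coordinates]) auto

lemma continuous_on_L2_set[continuous_intros]: "continuous_on S (\<lambda>x::nat \<Rightarrow> real. L2_set x J)"
  unfolding L2_set_def by (intro continuous_intros)

lemma continuous_on_quad[continuous_intros]: "continuous_on S (\<lambda>x. quad J a x)"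
  unfolding quad_def by (intro continuous_intros)

lemma continuous_on_inner_on[continuous_intros]: "continuous_on S (\<lambda>x. inner_on J u x)"
  unfolding inner_on_def by (intro continuous_intros)

text \<open>By continuity in \<open>t\<close> the uncountable quantifier can be restricted to a
  countable dense subset of \<open>T\<close>.\<close>

lemma sets_Collect_ball_separable:
  fixes F :: "'t::{metric_space, second_countable_topology} \<Rightarrow> 'a \<Rightarrow> real"
  assumes c: "\<And>\<omega>. continuous_on UNIV (\<lambda>t. F t \<omega>)" and m: "\<And>t. F t \<in> borel_measurable M"
  shows "{\<omega>\<in>space M. \<forall>t\<in>T. F t \<omega> \<le> \<tau>} \<in> sets M"
proof -
  obtain D where D: "countable D" "D \<subseteq> T" "T \<subseteq> closure D"
    using separable by blast
  have "(\<forall>t\<in>T. F t \<omega> \<le> \<tau>) \<longleftrightarrow> (\<forall>t\<in>D. F t \<omega> \<le> \<tau>)" for \<omega>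
  proof
    assume t: "\<forall>t\<in>D. F t \<omega> \<le> \<tau>"
    have "closed {t. F t \<omega> \<le> \<tau>}"
      by (intro closed_Collect_le continuous_intros c)
    then have "closure D \<subseteq> {t. F t \<omega> \<le> \<tau>}"
      using t by (intro closure_minimal) auto
    then show "\<forall>t\<in>T. F t \<omega> \<le> \<tau>" using D by auto
  qed (use D in auto)
  then have "{\<omega>\<in>space M. \<forall>t\<in>T. F t \<omega> \<le> \<tau>} = {\<omega>\<in>space M. \<forall>t\<in>D. F t \<omega> \<le> \<tau>}" by simp
  also have "\<dots> \<in> sets M"
    using D(1) m by (intro sets.sets_Collect_countable_All' borel_measurable_le borel_measurable_const)
  finally show ?thesis .
qed

lemma sets_Collect_bex_separable:
  fixes F :: "'t::{metric_space, second_countable_topology} \<Rightarrow> 'a \<Rightarrow> real"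
  assumes c: "\<And>\<omega>. continuous_on UNIV (\<lambda>t. F t \<omega>)" and m: "\<And>t. F t \<in> borel_measurable M"
  shows "{\<omega>\<in>space M. \<exists>t\<in>T. \<tau> < F t \<omega>} \<in> sets M"
proof -
  have "{\<omega>\<in>space M. \<exists>t\<in>T. \<tau> < F t \<omega>} = space M - {\<omega>\<in>space M. \<forall>t\<in>T. F t \<omega> \<le> \<tau>}"
    by (auto simp: not_le)
  then show ?thesis using sets_Collect_ball_separable[OF assms] by simp
qed

section \<open>Comparison and rotation invariance for the Gaussian matrix\<close>

locale gaussian_matrix = prob_space +
  fixes g :: "nat \<Rightarrow> nat \<Rightarrow> 'a \<Rightarrow> real"
  assumes entries_indep: "indep_vars (\<lambda>_. borel) (\<lambda>(i, j). g i j) ({1..} \<times> {1..})"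
    and entries_dist: "\<And>i j. i \<ge> 1 \<Longrightarrow> j \<ge> 1 \<Longrightarrow> distributed M lborel (g i j) std_normal_density"

sublocale gaussian_matrix \<subseteq> iid_std_normal M "\<lambda>(i, j). g i j" "{1..} \<times> {1..}"
  by unfold_locales (use entries_indep entries_dist in auto)

context gaussian_matrix
begin

abbreviation G :: "'a \<Rightarrow> nat \<Rightarrow> nat \<Rightarrow> real" where
  "G \<omega> \<equiv> \<lambda>i j. g i j \<omega>"

abbreviation quad_below :: "real \<Rightarrow> nat \<Rightarrow> real \<Rightarrow> 'a \<Rightarrow> bool" where
  "quad_below p N B \<omega> \<equiv> \<forall>x. (\<Sum>i=1..N. \<bar>x i\<bar> powr p) = 1 \<longrightarrow> quad {1..N} (G \<omega>) x \<le> B"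

abbreviation quad_above :: "real \<Rightarrow> nat \<Rightarrow> real \<Rightarrow> 'a \<Rightarrow> bool" where
  "quad_above p N B \<omega> \<equiv> \<exists>x. (\<Sum>i=1..N. \<bar>x i\<bar> powr p) = 1 \<and> B \<le> quad {1..N} (G \<omega>) x"

lemma g_measurable[measurable]: "i \<ge> 1 \<Longrightarrow> j \<ge> 1 \<Longrightarrow> g i j \<in> borel_measurable M"
  using X_measurable[of "(i, j)"] by simp

lemma quad_measurable[measurable]:
  assumes "J \<subseteq> {1..}" shows "(\<lambda>\<omega>. quad J (G \<omega>) x) \<in> borel_measurable M"
  unfolding quad_def using assms
  by (intro borel_measurable_sum borel_measurable_times g_measurable borel_measurable_const) auto

text \<open>An entry outside \<open>A\<close> is independent of the block and nonnegative with
  probability at least 1/2. This later removes the auxiliary Gaussian of the comparison at the price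
  of a factor 2.\<close>

lemma prob_le_conditioned:
  assumes A: "A \<subseteq> {1..} \<times> {1..}" and k: "1 \<le> r" "1 \<le> s" "(r, s) \<notin> A"
    and Q: "Q \<in> sets (PiM A (\<lambda>_. borel))"
  shows "prob {\<omega>\<in>space M. (\<lambda>(i, j)\<in>A. g i j \<omega>) \<in> Q} 
    \<le> 2 * prob {\<omega>\<in>space M. (\<lambda>(i, j)\<in>A. g i j \<omega>) \<in> Q \<and> 0 \<le> g r s \<omega>}"
proof -
  let ?XA = "\<lambda>\<omega>. \<lambda>k\<in>A. (case k of (i, j) \<Rightarrow> g i j) \<omega>"
  let ?XB = "\<lambda>\<omega>. \<lambda>k\<in>{(r,s)}. (case k of (i, j) \<Rightarrow> g i j) \<omega>"
  let ?R = "{x\<in>space (PiM {(r,s)} (\<lambda>_. borel)). (0::real) \<le> x (r,s)}"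
  have eq: "(\<lambda>(i, j)\<in>A. g i j \<omega>) = ?XA \<omega>" for \<omega>
    by (auto simp: fun_eq_iff restrict_def)
  have iv: "indep_var (PiM A (\<lambda>_. borel)) ?XA (PiM {(r,s)} (\<lambda>_. borel)) ?XB"
    by (rule indep_var_restrict[OF indep]) (use A k in auto)
  have R: "?R \<in> sets (PiM {(r,s)} (\<lambda>_. borel))" by measurable
  have "prob {\<omega>\<in>space M. ?XA \<omega> \<in> Q \<and> 0 \<le> g r s \<omega>} = prob ((\<lambda>x. (?XA x, ?XB x)) -` (Q \<times> ?R) \<inter> space M)"
    by (rule arg_cong[where f=prob]) (auto simp: space_PiM)
  also have "\<dots> = prob (?XA -` Q \<inter> space M) * prob (?XB -` ?R \<inter> space M)"
    by (rule indep_varD[OF iv Q R])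
  also have "?XA -` Q \<inter> space M = {\<omega>\<in>space M. ?XA \<omega> \<in> Q}" by auto
  also have "?XB -` ?R \<inter> space M = {\<omega>\<in>space M. 0 \<le> g r s \<omega>}" by (auto simp: space_PiM)
  finally have e: "prob {\<omega>\<in>space M. ?XA \<omega> \<in> Q \<and> 0 \<le> g r s \<omega>}
      = prob {\<omega>\<in>space M. ?XA \<omega> \<in> Q} * prob {\<omega>\<in>space M. 0 \<le> g r s \<omega>}" .
  have "prob {\<omega>\<in>space M. ?XA \<omega> \<in> Q} * (1/2) \<le> prob {\<omega>\<in>space M. ?XA \<omega> \<in> Q} * prob {\<omega>\<in>space M. 0 \<le> g r s \<omega>}"
    using prob_X_nonneg[of "(r,s)"] k by (intro mult_left_mono) auto
  then show ?thesis unfolding eq e by simp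
qed

text \<open>The quadratic form plus \<open>\<bar>x\<bar>\<^sup>2 z\<close> with an independent Gaussian \<open>z\<close> has covariance
  \<open>\<langle>x,y\<rangle>\<^sup>2 + \<bar>x\<bar>\<^sup>2\<bar>y\<bar>\<^sup>2\<close>, which exceeds the covariance \<open>2 \<bar>x\<bar> \<bar>y\<bar> \<langle>x,y\<rangle>\<close> of the
  linear process by \<open>(\<bar>x\<bar> \<bar>y\<bar> - \<langle>x,y\<rangle>)\<^sup>2\<close>.\<close>

lemma prob_quad_gt_le:
  fixes V :: "(nat \<Rightarrow> real) set"
  assumes J: "finite J" "J \<subseteq> {1..}" and r: "1 \<le> r" "r \<notin> J" and s: "s\<^sup>2 = (1::real)"
  shows "prob {\<omega>\<in>space M. \<exists>x\<in>V. t < s * quad J (G \<omega>) x}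
    \<le> 2 * prob {\<omega>\<in>space M. \<exists>x\<in>V. t < sqrt 2 * L2_set x J * inner_on J (\<lambda>j. g r j \<omega>) x}"
proof -
  \<comment> \<open>The entry \<open>(r,r)\<close> serves as the auxiliary Gaussian and the row
    \<open>r\<close> as the linear process; both are disjoint from the block since
    \<open>r \<notin> J\<close>. The sign \<open>s\<close> is 1 or -1, so that the form can also be
    bounded from below.\<close>
  define K where "K = J \<times> J \<union> {(r,r)} \<union> {r} \<times> J"
  define A where "A x k = (if k \<in> J \<times> J then s * (x (fst k) * x (snd k))
      else if k = (r,r) then (L2_set x J)\<^sup>2 else 0)" for x k
  define B where "B x k = (if k \<in> {r} \<times> J then sqrt 2 * L2_set x J * x (snd k) else 0)" for x k
  have K: "K \<subseteq> {1..} \<times> {1..}" "finite K" using J r by (auto simp: K_def)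
  have sumK: "(\<Sum>k\<in>K. F k) = (\<Sum>i\<in>J. \<Sum>j\<in>J. F (i,j)) + F (r,r) + (\<Sum>j\<in>J. F (r,j))" for F :: "nat \<times> nat \<Rightarrow> real"
  proof -
    have "(\<Sum>k\<in>K. F k) = (\<Sum>k\<in>J\<times>J. F k) + (\<Sum>k\<in>{(r,r)}. F k) + (\<Sum>k\<in>{r}\<times>J. F k)"
      unfolding K_def using J r by (subst sum.union_disjoint, auto)+
    moreover have "(\<Sum>k\<in>{r}\<times>J. F k) = (\<Sum>j\<in>J. F (r,j))"
    proof -
      have "{r} \<times> J = Pair r ` J" by auto
      then show ?thesis using sum.reindex[of "Pair r" J F] by (simp add: inj_on_def)
    qed
    ultimately show ?thesis by (simp add: sum.cartesian_product)
  qed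
  have neq: "j \<noteq> r" if "j \<in> J" for j using that r by auto
  have simpA: "A x (i,j) = s * (x i * x j)" if "i \<in> J" "j \<in> J" for x i j using that by (simp add: A_def)
  have simpA2: "A x (r,r) = (L2_set x J)\<^sup>2" for x using r by (simp add: A_def)
  have simpA3: "A x (r,j) = 0" if "j \<in> J" for x j using that r by (auto simp: A_def)
  have simpB: "B x (i,j) = 0" if "i \<in> J" for x i j using that r by (auto simp: B_def)
  have simpB2: "B x (r,r) = 0" for x using r by (simp add: B_def)
  have simpB3: "B x (r,j) = sqrt 2 * L2_set x J * x j" if "j \<in> J" for x j using that r by (auto simp: B_def)
  note simps = simpA simpA2 simpA3 simpB simpB2 simpB3
  have covA: "(\<Sum>k\<in>K. A x k * A y k) = (inner_on J x y)\<^sup>2 + (L2_set x J)\<^sup>2 * (L2_set y J)\<^sup>2" for x y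
  proof -
    have "(\<Sum>k\<in>K. A x k * A y k) = s\<^sup>2 * (\<Sum>i\<in>J. \<Sum>j\<in>J. (x i * x j) * (y i * y j)) + (L2_set x J)\<^sup>2 * (L2_set y J)\<^sup>2"
      unfolding sumK by (simp add: simps sum_distrib_left power2_eq_square mult_ac)
    then show ?thesis by (simp add: s sum_sum_rank_one)
  qed
  have covB: "(\<Sum>k\<in>K. B x k * B y k) = 2 * (L2_set x J * L2_set y J) * inner_on J x y" for x y
  proof -
    have e: "(sqrt 2 * a * b) * (sqrt 2 * c * d) = 2 * (a * c) * (b * d)" for a b c d :: real
      using real_sqrt_mult_self[of 2] by (simp add: algebra_simps)
    show ?thesis
      unfolding sumK inner_on_def sum_distrib_left by (simp add: simps e)
  qed
  have linA: "(\<Sum>k\<in>K. A x k * (case k of (i, j) \<Rightarrow> g i j) \<omega>) = s * quad J (G \<omega>) x + (L2_set x J)\<^sup>2 * g r r \<omega>" for x \<omega>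
    unfolding sumK quad_def by (simp add: simps sum_distrib_left mult_ac)
  have linB: "(\<Sum>k\<in>K. B x k * (case k of (i, j) \<Rightarrow> g i j) \<omega>) = sqrt 2 * L2_set x J * inner_on J (\<lambda>j. g r j \<omega>) x" for x \<omega>
    unfolding sumK inner_on_def by (simp add: simps sum_distrib_left mult_ac)
  have sl: "prob {\<omega>\<in>space M. \<forall>x\<in>V. (\<Sum>k\<in>K. B x k * (case k of (i, j) \<Rightarrow> g i j) \<omega>) \<le> t}
       \<le> prob {\<omega>\<in>space M. \<forall>x\<in>V. (\<Sum>k\<in>K. A x k * (case k of (i, j) \<Rightarrow> g i j) \<omega>) \<le> t}"
  proof (rule slepian[OF K])
    show "continuous_on UNIV (\<lambda>x. A x k)" for k
      unfolding A_def by (cases "k \<in> J \<times> J"; cases "k = (r,r)"; simp; intro continuous_intros)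
    show "continuous_on UNIV (\<lambda>x. B x k)" for k
      unfolding B_def by (cases "k \<in> {r} \<times> J"; simp only: if_True if_False; intro continuous_intros)
    show "(\<Sum>k\<in>K. A x k * B y k) = 0" for x y unfolding sumK by (simp add: simps)
    show "(\<Sum>k\<in>K. (A x k)\<^sup>2) = (\<Sum>k\<in>K. (B x k)\<^sup>2)" for x
      using covA[of x x] covB[of x x] by (simp add: power2_eq_square inner_on_self)
    show "(\<Sum>k\<in>K. B x k * B y k) \<le> (\<Sum>k\<in>K. A x k * A y k)" for x y
      unfolding covA covB using zero_le_power2[of "L2_set x J * L2_set y J - inner_on J x y"]
      by (simp add: power2_diff power_mult_distrib mult_ac)
  qed (intro continuous_intros)
  note m = borel_measurable_sum borel_measurable_times borel_measurable_const borel_measurable_add g_measurable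
  have mX: "(\<lambda>\<omega>. quad J (G \<omega>) x) \<in> borel_measurable M" for x
    by (rule quad_measurable[OF J(2)])
  have mh: "(\<lambda>\<omega>. inner_on J (\<lambda>j. g r j \<omega>) x) \<in> borel_measurable M" for x
    unfolding inner_on_def using J r by (intro m) auto
  have mz: "g r r \<in> borel_measurable M" using r by simp
  let ?A = "{\<omega>\<in>space M. \<exists>x\<in>V. t < s * quad J (G \<omega>) x + (L2_set x J)\<^sup>2 * g r r \<omega>}"
  let ?B = "{\<omega>\<in>space M. \<exists>x\<in>V. t < sqrt 2 * L2_set x J * inner_on J (\<lambda>j. g r j \<omega>) x}"
  have sA: "?A \<in> sets M"
    by (rule sets_Collect_bex_separable) (auto intro!: continuous_intros m mX mz)
  have sB: "?B \<in> sets M"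
    by (rule sets_Collect_bex_separable) (auto intro!: continuous_intros m mh)
  have "prob ?A = 1 - prob {\<omega>\<in>space M. \<forall>x\<in>V. s * quad J (G \<omega>) x + (L2_set x J)\<^sup>2 * g r r \<omega> \<le> t}"
    by (subst prob_compl[symmetric], rule sets_Collect_ball_separable)
      (auto intro!: continuous_intros m mX mz arg_cong[where f=prob] simp: not_le)
  moreover have "prob ?B = 1 - prob {\<omega>\<in>space M. \<forall>x\<in>V. sqrt 2 * L2_set x J * inner_on J (\<lambda>j. g r j \<omega>) x \<le> t}"
    by (subst prob_compl[symmetric], rule sets_Collect_ball_separable)
      (auto intro!: continuous_intros m mh arg_cong[where f=prob] simp: not_le)
  ultimately have le: "prob ?A \<le> prob ?B" using sl unfolding linA linB by linarith
  let ?N = "PiM (J \<times> J) (\<lambda>_. borel :: real measure)"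
  let ?Q = "{y\<in>space ?N. \<exists>x\<in>V. t < s * quad J (\<lambda>i j. y (i,j)) x}"
  have Q: "?Q \<in> sets ?N"
  proof (rule sets_Collect_bex_separable)
    show "(\<lambda>y. s * quad J (\<lambda>i j. y (i,j)) x) \<in> borel_measurable ?N" for x
      unfolding quad_def by (intro m measurable_component_singleton) auto
  qed (intro continuous_intros)
  have res: "quad J (\<lambda>i j. (\<lambda>(i, j)\<in>J\<times>J. g i j \<omega>) (i,j)) x = quad J (G \<omega>) x" for x \<omega>
    unfolding quad_def by (intro sum.cong) auto
  have memQ: "(\<lambda>(i, j)\<in>J\<times>J. g i j \<omega>) \<in> ?Q \<longleftrightarrow> (\<exists>x\<in>V. t < s * quad J (G \<omega>) x)" for \<omega>
    unfolding mem_Collect_eq res by (auto simp: space_PiM)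
  \<comment> \<open>On the event \<open>g r r \<omega> \<ge> 0\<close> the added term
    \<open>\<bar>x\<bar>\<^sup>2 z\<close> can only help to exceed \<open>t\<close>.\<close>
  have "prob {\<omega>\<in>space M. (\<lambda>(i, j)\<in>J\<times>J. g i j \<omega>) \<in> ?Q}
    \<le> 2 * prob {\<omega>\<in>space M. (\<lambda>(i, j)\<in>J\<times>J. g i j \<omega>) \<in> ?Q \<and> 0 \<le> g r r \<omega>}"
    using J r by (intro prob_le_conditioned Q) auto
  also have "\<dots> \<le> 2 * prob ?A"
  proof (intro mult_left_mono finite_measure_mono sA subsetI)
    fix \<omega> assume "\<omega> \<in> {\<omega>\<in>space M. (\<lambda>(i, j)\<in>J\<times>J. g i j \<omega>) \<in> ?Q \<and> 0 \<le> g r r \<omega>}"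
    then obtain x where x: "\<omega> \<in> space M" "x \<in> V" "t < s * quad J (G \<omega>) x" "0 \<le> g r r \<omega>"
      unfolding memQ by auto
    have "0 \<le> (L2_set x J)\<^sup>2 * g r r \<omega>" using x(4) by simp
    then have "t < s * quad J (G \<omega>) x + (L2_set x J)\<^sup>2 * g r r \<omega>"
      using x(3) by linarith
    with x show "\<omega> \<in> ?A" by blast
  qed simp
  finally show ?thesis unfolding memQ using le by linarith
qed

text \<open>By Slepian's inequality in both directions, as the covariances agree. The two blocks have to be
  disjoint, which costs a detour through the shifted block in the rotation invariance below.\<close>

lemma prob_ball_quad_shift:
  fixes T :: "(nat \<Rightarrow> real) set" and \<phi> \<psi> :: "(nat \<Rightarrow> real) \<Rightarrow> nat \<Rightarrow> real"
  assumes J: "J \<subseteq> {1..m}"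
    and c: "\<And>i. continuous_on UNIV (\<lambda>x. \<phi> x i)" "\<And>i. continuous_on UNIV (\<lambda>x. \<psi> x i)" "continuous_on UNIV \<tau>"
    and inner: "\<And>x y. x \<in> T \<Longrightarrow> y \<in> T \<Longrightarrow> inner_on J (\<phi> x) (\<phi> y) = inner_on J (\<psi> x) (\<psi> y)"
  shows "prob {\<omega>\<in>space M. \<forall>x\<in>T. quad J (G \<omega>) (\<phi> x) \<le> \<tau> x} =
    prob {\<omega>\<in>space M. \<forall>x\<in>T. quad J (\<lambda>i j. g (i+m) (j+m) \<omega>) (\<psi> x) \<le> \<tau> x}"
proof -
  let ?s = "\<lambda>(i,j). (i + m, j + m)"
  \<comment> \<open>Adding \<open>m\<close> carries positive indices out of \<open>{1..m}\<close>,
    so the shifted block shares no entry with the original one.\<close>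
  define K where "K = J \<times> J \<union> ?s ` (J \<times> J)"
  define A where "A x k = (if k \<in> J \<times> J then \<phi> x (fst k) * \<phi> x (snd k) else 0)" for x k
  define B where "B x k = (if k \<in> ?s ` (J \<times> J) then \<psi> x (fst k - m) * \<psi> x (snd k - m) else 0)" for x k
  have fin: "finite J" using J finite_subset by blast
  have K: "K \<subseteq> {1..} \<times> {1..}" "finite K" using J fin by (auto simp: K_def)
  have notin: "(i + m, j + m) \<notin> J \<times> J" if "i \<in> J" "j \<in> J" for i j using that by (auto dest!: subsetD[OF J])
  have sumK: "(\<Sum>k\<in>K. F k) = (\<Sum>i\<in>J. \<Sum>j\<in>J. F (i,j)) + (\<Sum>i\<in>J. \<Sum>j\<in>J. F (i+m,j+m))" for F :: "nat \<times> nat \<Rightarrow> real"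
  proof -
    have "(\<Sum>k\<in>K. F k) = (\<Sum>k\<in>J\<times>J. F k) + (\<Sum>k\<in>?s`(J\<times>J). F k)"
      unfolding K_def using fin notin by (intro sum.union_disjoint) auto
    also have "(\<Sum>k\<in>?s`(J\<times>J). F k) = (\<Sum>(i,j)\<in>J\<times>J. F (i+m,j+m))"
      by (subst sum.reindex) (auto simp: inj_on_def split_beta)
    finally show ?thesis by (simp add: sum.cartesian_product split_beta)
  qed
  have sA: "A x (i,j) = \<phi> x i * \<phi> x j" if "i \<in> J" "j \<in> J" for x i j using that by (simp add: A_def)
  have sA2: "A x (i+m,j+m) = 0" if "i \<in> J" "j \<in> J" for x i j using notin[OF that] unfolding A_def by (simp only: if_False)
  have sB: "B x (i,j) = 0" if "i \<in> J" "j \<in> J" for x i j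
  proof -
    have "(i, j) \<notin> ?s ` (J \<times> J)" using that by (auto dest!: subsetD[OF J])
    then show ?thesis unfolding B_def by (simp only: if_False)
  qed
  have sB2: "B x (i+m,j+m) = \<psi> x i * \<psi> x j" if "i \<in> J" "j \<in> J" for x i j
    using that by (auto simp: B_def image_iff)
  note simps = sA sA2 sB sB2
  have covA: "(\<Sum>k\<in>K. A x k * A y k) = (inner_on J (\<phi> x) (\<phi> y))\<^sup>2" for x y
    unfolding sumK sum_sum_rank_one[symmetric] by (simp add: simps)
  have covB: "(\<Sum>k\<in>K. B x k * B y k) = (inner_on J (\<psi> x) (\<psi> y))\<^sup>2" for x y
    unfolding sumK sum_sum_rank_one[symmetric] by (simp add: simps)
  have orth: "(\<Sum>k\<in>K. A x k * B y k) = 0" for x y unfolding sumK by (simp add: simps)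
  have orth': "(\<Sum>k\<in>K. B x k * A y k) = 0" for x y using orth[of y x] by (simp add: mult.commute)
  have cA: "continuous_on UNIV (\<lambda>x. A x k)" for k
    unfolding A_def by (cases "k \<in> J \<times> J"; simp only: if_True if_False; intro continuous_intros c)
  have cB: "continuous_on UNIV (\<lambda>x. B x k)" for k
    unfolding B_def by (cases "k \<in> ?s ` (J \<times> J)"; simp only: if_True if_False; intro continuous_intros c)
  have var: "(\<Sum>k\<in>K. (A x k)\<^sup>2) = (\<Sum>k\<in>K. (B x k)\<^sup>2)" if "x \<in> T" for x
    using covA[of x x] covB[of x x] inner[OF that that] by (simp add: power2_eq_square)
  have linA: "(\<Sum>k\<in>K. A x k * (case k of (i, j) \<Rightarrow> g i j) \<omega>) = quad J (G \<omega>) (\<phi> x)" for x \<omega>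
    unfolding sumK quad_def by (simp add: simps mult_ac)
  have linB: "(\<Sum>k\<in>K. B x k * (case k of (i, j) \<Rightarrow> g i j) \<omega>) = quad J (\<lambda>i j. g (i+m) (j+m) \<omega>) (\<psi> x)" for x \<omega>
    unfolding sumK quad_def by (simp add: simps mult_ac)
  show ?thesis
  proof (rule antisym)
    show "prob {\<omega>\<in>space M. \<forall>x\<in>T. quad J (G \<omega>) (\<phi> x) \<le> \<tau> x} \<le>
      prob {\<omega>\<in>space M. \<forall>x\<in>T. quad J (\<lambda>i j. g (i+m) (j+m) \<omega>) (\<psi> x) \<le> \<tau> x}"
      unfolding linA[symmetric] linB[symmetric]
      by (rule slepian[OF K cB cA c(3)]) (simp_all add: orth' var inner covA covB)
    show "prob {\<omega>\<in>space M. \<forall>x\<in>T. quad J (\<lambda>i j. g (i+m) (j+m) \<omega>) (\<psi> x) \<le> \<tau> x} \<le>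
      prob {\<omega>\<in>space M. \<forall>x\<in>T. quad J (G \<omega>) (\<phi> x) \<le> \<tau> x}"
      unfolding linA[symmetric] linB[symmetric]
      by (rule slepian[OF K cA cB c(3)]) (simp_all add: orth var inner covA covB)
  qed
qed

text \<open>The law of the form is invariant under orthogonal maps, and some reflection carries
  \<open>u\<close> to \<open>u'\<close>. Only the length of the rank-one direction matters, so it
  may be replaced by a coordinate vector.\<close>

lemma prob_quad_rotation:
  assumes J: "J \<subseteq> {1..m}" and u: "inner_on J u u = 1" "inner_on J u' u' = 1"
  shows "prob {\<omega>\<in>space M. \<forall>x. quad J (G \<omega>) x + c * (inner_on J u x)\<^sup>2 \<le> T * inner_on J x x}
    = prob {\<omega>\<in>space M. \<forall>x. quad J (G \<omega>) x + c * (inner_on J u' x)\<^sup>2 \<le> T * inner_on J x x}"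
proof (cases "\<forall>i\<in>J. u i = u' i")
  case True
  then have "inner_on J u x = inner_on J u' x" for x by (simp add: inner_on_def)
  then show ?thesis by simp
next
  case False
  have fin: "finite J" using J finite_subset by blast
  define v where "v i = u i - u' i" for i
  define d where "d = inner_on J v v"
  have d: "d > 0"
  proof -
    obtain i where i: "i \<in> J" "v i \<noteq> 0" using False by (auto simp: v_def)
    have "0 < v i * v i" using i by (auto simp: zero_less_mult_iff)
    also have "\<dots> \<le> d" unfolding d_def inner_on_def using i fin by (intro member_le_sum[of i J]) auto
    finally show ?thesis .
  qed
  \<comment> \<open>The Householder reflection in the hyperplane orthogonal to
    \<open>u - u'\<close>; as both vectors have length 1, it exchanges them on
    \<open>J\<close>.\<close>
  define Q where "Q x i = x i - 2 * inner_on J v x / d * v i" for x :: "nat \<Rightarrow> real" and i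
  have comm: "inner_on J x y = inner_on J y x" for x y by (simp add: inner_on_def mult.commute)
  have lin: "inner_on J y (Q x) = inner_on J y x - 2 * inner_on J v x / d * inner_on J v y" for x y
  proof -
    have "(\<Sum>i\<in>J. y i * (x i - k * v i)) = (\<Sum>i\<in>J. y i * x i) - k * (\<Sum>i\<in>J. v i * y i)" for k
      by (simp add: sum_distrib_left sum_subtractf[symmetric] algebra_simps)
    from this[of "2 * inner_on J v x / d"] show ?thesis
      unfolding inner_on_def[of J y] inner_on_def[of J v y] Q_def .
  qed
  have vQ: "inner_on J v (Q x) = - inner_on J v x" for x
    unfolding lin using d by (simp add: d_def[symmetric])
  have QQ: "Q (Q x) = x" for x
    using d by (simp add: fun_eq_iff Q_def[of "Q x"] vQ) (simp add: Q_def)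
  have iQ: "inner_on J (Q x) (Q y) = inner_on J x y" for x y
    using lin[of "Q x" y] lin[of y x] vQ[of x] comm[of "Q x" y] comm[of x y] by simp
  have uv: "2 * inner_on J v u = d" 
  proof -
    have "d = inner_on J u u - 2 * inner_on J u' u + inner_on J u' u'" "inner_on J v u = inner_on J u u - inner_on J u' u"
      unfolding d_def inner_on_def v_def by (simp_all add: sum_distrib_left sum_subtractf sum.distrib algebra_simps)
    then show ?thesis using u by simp
  qed
  have Qu: "Q u i = u' i" for i using uv d by (simp add: Q_def v_def)
  have u'Q: "inner_on J u' (Q x) = inner_on J u x" for x
  proof -
    have "inner_on J u' (Q x) = inner_on J (Q u) (Q x)" using Qu by (simp add: inner_on_def)
    then show ?thesis by (simp add: iQ)
  qed
  have cQ: "continuous_on UNIV (\<lambda>x. Q x i)" for i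
    unfolding Q_def using d by (intro continuous_intros) auto
  have cx: "continuous_on UNIV (\<lambda>x. T * inner_on J x x - c * (inner_on J u x)\<^sup>2)"
    unfolding inner_on_def by (intro continuous_intros)
  have "prob {\<omega>\<in>space M. \<forall>x. quad J (G \<omega>) x + c * (inner_on J u x)\<^sup>2 \<le> T * inner_on J x x}
    = prob {\<omega>\<in>space M. \<forall>x\<in>UNIV. quad J (G \<omega>) x \<le> T * inner_on J x x - c * (inner_on J u x)\<^sup>2}"
    by (simp add: algebra_simps)
  \<comment> \<open>Both the identity and \<open>Q\<close> preserve inner products, so each is
    compared with the same shifted block, which then cancels.\<close>
  also have "\<dots> = prob {\<omega>\<in>space M. \<forall>x\<in>UNIV. quad J (\<lambda>i j. g (i+m) (j+m) \<omega>) x \<le> T * inner_on J x x - c * (inner_on J u x)\<^sup>2}"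
    by (rule prob_ball_quad_shift[OF J _ _ cx]) (intro continuous_intros refl)+
  also have "\<dots> = prob {\<omega>\<in>space M. \<forall>x\<in>UNIV. quad J (G \<omega>) (Q x) \<le> T * inner_on J x x - c * (inner_on J u x)\<^sup>2}"
    by (rule prob_ball_quad_shift[OF J cQ _ cx, symmetric]) (intro continuous_intros iQ)+
  also have "\<dots> = prob {\<omega>\<in>space M. \<forall>x. quad J (G \<omega>) (Q x) + c * (inner_on J u' (Q x))\<^sup>2 \<le> T * inner_on J (Q x) (Q x)}"
    by (simp add: iQ u'Q algebra_simps)
  also have "\<dots> = prob {\<omega>\<in>space M. \<forall>x. quad J (G \<omega>) x + c * (inner_on J u' x)\<^sup>2 \<le> T * inner_on J x x}"
    by (intro arg_cong[where f=prob] Collect_cong conj_cong refl) (metis QQ)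
  finally show ?thesis .
qed

end

subsection \<open>Reduction to scalar spins\<close>

lemma quad_scale: "quad J a (\<lambda>i. c * x i) = c\<^sup>2 * quad J a x"
  by (simp add: quad_def sum_distrib_left power2_eq_square mult_ac)

lemma energy_eq_sum_quad:
  fixes \<sigma> :: "nat \<Rightarrow> real ^ 'k"
  shows "energy a N \<sigma> = (\<Sum>k\<in>UNIV. quad {1..N} a (\<lambda>i. \<sigma> i $ k))"
proof -
  have "energy a N \<sigma> = (\<Sum>i=1..N. \<Sum>j=1..N. \<Sum>k\<in>UNIV. a i j * (\<sigma> i $ k * \<sigma> j $ k))"
    by (simp add: energy_def inner_vec_def sum_distrib_left)
  also have "\<dots> = (\<Sum>i=1..N. \<Sum>k\<in>UNIV. \<Sum>j=1..N. a i j * (\<sigma> i $ k * \<sigma> j $ k))"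
    by (intro sum.cong refl sum.swap)
  also have "\<dots> = (\<Sum>k\<in>UNIV. quad {1..N} a (\<lambda>i. \<sigma> i $ k))"
    unfolding quad_def by (rule sum.swap)
  finally show ?thesis .
qed

text \<open>The form is homogeneous of degree 2 and the last factor is the squared p-norm. The zero
  vector is treated apart, as it cannot be normalised.\<close>

lemma quad_le_homogeneous:
  assumes fin: "finite J" and p: "p > 0"
    and B: "\<And>x. (\<Sum>i\<in>J. \<bar>x i\<bar> powr p) = 1 \<Longrightarrow> quad J a x \<le> B"
  shows "quad J a x \<le> B * (\<Sum>i\<in>J. \<bar>x i\<bar> powr p) powr (2 / p)"
proof -
  define S where "S = (\<Sum>i\<in>J. \<bar>x i\<bar> powr p)"
  have S0: "S \<ge> 0" by (simp add: S_def sum_nonneg)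
  show ?thesis
  proof (cases "S = 0")
    case True
    then have "x i = 0" if "i \<in> J" for i
      using that fin by (simp add: S_def sum_nonneg_eq_0_iff)
    then have "quad J a x = 0" by (simp add: quad_def)
    with True show ?thesis by (simp add: S_def)
  next
    case False
    then have S: "S > 0" using S0 by simp
    define c where "c = S powr (1/p)"
    have c: "c > 0" "c powr p = S" "c\<^sup>2 = S powr (2/p)" 
      using S p by (simp_all add: c_def powr_powr powr_power)
    have "(\<Sum>i\<in>J. \<bar>x i / c\<bar> powr p) = S / c powr p"
      unfolding S_def sum_divide_distrib using c(1) by (intro sum.cong) (auto simp: powr_divide)
    then have "quad J a (\<lambda>i. x i / c) \<le> B" using S c by (intro B) simp
    then have "c\<^sup>2 * quad J a (\<lambda>i. x i / c) \<le> c\<^sup>2 * B" by (intro mult_left_mono) auto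
    moreover have "c\<^sup>2 * quad J a (\<lambda>i. x i / c) = quad J a x"
      using c(1) by (simp add: quad_scale[symmetric])
    ultimately show ?thesis using c(3) by (simp add: S_def[symmetric] mult.commute)
  qed
qed

text \<open>Convexity on the open half-line is extended to the endpoint 0, where the inequality
  reduces to \<open>s powr r \<le> s\<close> for \<open>0 < s < 1\<close>. Vanishing coordinates
  make this endpoint occur.\<close>

lemma convex_on_powr_nonneg:
  assumes "r \<ge> 1" shows "convex_on {0..} (\<lambda>x::real. x powr r)"
proof (rule convex_onI)
  fix t x y :: real assume t: "0 < t" "t < 1" and xy: "x \<in> {0..}" "y \<in> {0..}"
  have scale: "(s * z) powr r \<le> s * z powr r" if "0 < s" "s < 1" "z \<ge> 0" for s z :: real
  proof -
    have "s powr r \<le> s powr 1" using that assms by (intro powr_mono') auto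
    then show ?thesis using that by (simp add: powr_mult mult_right_mono)
  qed
  consider "x = 0" | "y = 0" | "x > 0" "y > 0" using xy by fastforce
  then show "((1 - t) *\<^sub>R x + t *\<^sub>R y) powr r \<le> (1 - t) * x powr r + t * y powr r"
  proof cases
    case 3
    then show ?thesis using convex_onD[OF powr_convex[OF assms], of t x y] t by simp
  qed (use t xy scale[of t y] scale[of "1-t" x] in auto)
qed simp

text \<open>Minkowski's inequality between the mixed norms \<open>\<ell>\<^sub>2(\<ell>\<^sub>p)\<close> and \<open>\<ell>\<^sub>p(\<ell>\<^sub>2)\<close>, by Jensen's
  inequality with the weights \<open>norm (\<sigma> i) powr p\<close>. It makes vector spins no better than scalar ones.\<close>

lemma sum_coordinate_powr_le_1:
  fixes \<sigma> :: "'i \<Rightarrow> real ^ 'k"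
  assumes p: "0 < p" "p \<le> 2" and J: "finite J" and one: "(\<Sum>i\<in>J. norm (\<sigma> i) powr p) = 1"
  shows "(\<Sum>k\<in>UNIV. (\<Sum>i\<in>J. \<bar>\<sigma> i $ k\<bar> powr p) powr (2 / p)) \<le> 1"
proof -
  define \<pi> where "\<pi> i = norm (\<sigma> i) powr p" for i
  \<comment> \<open>For \<open>\<sigma> i = 0\<close> the quotient takes the default value 0, which
    fits the weight \<open>\<pi> i = 0\<close>. It is also why \<open>t2\<close> below is an
    inequality and not an equation.\<close>
  define t where "t i k = (\<bar>\<sigma> i $ k\<bar> / norm (\<sigma> i)) powr p" for i k
  have pt: "\<bar>\<sigma> i $ k\<bar> powr p = \<pi> i * t i k" for i k
  proof (cases "\<sigma> i = 0")
    case False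
    then show ?thesis by (simp add: \<pi>_def t_def powr_divide)
  qed (simp add: \<pi>_def t_def)
  have tr: "t i k powr (2/p) = (\<bar>\<sigma> i $ k\<bar> / norm (\<sigma> i))\<^sup>2" for i k
    using p by (simp add: t_def powr_powr)
  have t2: "(\<Sum>k\<in>UNIV. t i k powr (2/p)) \<le> 1" for i
  proof -
    have "(\<Sum>k\<in>UNIV. t i k powr (2/p)) = (\<Sum>k\<in>UNIV. (\<sigma> i $ k)\<^sup>2) / (norm (\<sigma> i))\<^sup>2"
      by (simp add: tr power_divide sum_divide_distrib)
    also have "(\<Sum>k\<in>UNIV. (\<sigma> i $ k)\<^sup>2) = (norm (\<sigma> i))\<^sup>2"
      by (simp add: norm_vec_def L2_set_def sum_nonneg)
    finally show ?thesis by simp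
  qed
  have cvx: "convex_on {0..} (\<lambda>x. x powr (2/p))"
    using p by (intro convex_on_powr_nonneg) (simp add: divide_simps)
  have ne: "J \<noteq> {}" using one by auto
  have "(\<Sum>k\<in>UNIV. (\<Sum>i\<in>J. \<bar>\<sigma> i $ k\<bar> powr p) powr (2 / p))
      \<le> (\<Sum>k\<in>UNIV. \<Sum>i\<in>J. \<pi> i * t i k powr (2/p))"
  proof (rule sum_mono)
    fix k
    have "(\<Sum>i\<in>J. \<pi> i *\<^sub>R t i k) powr (2/p) \<le> (\<Sum>i\<in>J. \<pi> i * t i k powr (2/p))"
      by (rule convex_on_sum[OF J ne cvx]) (use one in \<open>auto simp: \<pi>_def t_def\<close>)
    then show "(\<Sum>i\<in>J. \<bar>\<sigma> i $ k\<bar> powr p) powr (2 / p) \<le> (\<Sum>i\<in>J. \<pi> i * t i k powr (2/p))"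
      by (simp add: pt)
  qed
  also have "\<dots> = (\<Sum>i\<in>J. \<pi> i * (\<Sum>k\<in>UNIV. t i k powr (2/p)))"
    by (subst sum.swap) (simp add: sum_distrib_left)
  also have "\<dots> \<le> (\<Sum>i\<in>J. \<pi> i * 1)"
    by (intro sum_mono mult_left_mono t2) (simp add: \<pi>_def)
  also have "\<dots> = 1" using one by (simp add: \<pi>_def)
  finally show ?thesis .
qed

text \<open>The coordinates of the spins decouple into scalar forms whose squared p-norms add up to
  at most 1. As the sum may fall short of 1, the sign of \<open>B\<close> matters.\<close>

lemma GP_le:
  assumes p: "0 < p" "p \<le> 2" and N: "N \<ge> 1" and B0: "B \<ge> 0"
    and B: "\<And>x. (\<Sum>i=1..N. \<bar>x i\<bar> powr p) = 1 \<Longrightarrow> quad {1..N} a x \<le> B"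
  shows "GP TYPE('k::finite) p N a \<le> B"
proof -
  obtain \<sigma> :: "nat \<Rightarrow> real ^ 'k" where \<sigma>: "norm_p2 p N \<sigma> = 1" "energy a N \<sigma> = GP TYPE('k) p N a"
    using GP_is_max[OF N p(1)] by blast
  have one: "(\<Sum>i=1..N. norm (\<sigma> i) powr p) = 1"
    using \<sigma>(1) norm_p2_eq_1_iff[OF p(1)] by blast
  have "energy a N \<sigma> \<le> (\<Sum>k\<in>UNIV. B * (\<Sum>i=1..N. \<bar>\<sigma> i $ k\<bar> powr p) powr (2 / p))"
    unfolding energy_eq_sum_quad by (intro sum_mono quad_le_homogeneous p B) auto
  also have "\<dots> \<le> B * 1"
    unfolding sum_distrib_left[symmetric]
    by (intro mult_left_mono sum_coordinate_powr_le_1 p one B0) auto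
  finally show ?thesis using \<sigma>(2) by simp
qed

lemma energy_le_GP:
  fixes \<sigma> :: "nat \<Rightarrow> real ^ 'k"
  assumes p: "p > 0" and N: "N \<ge> 1" and one: "(\<Sum>i=1..N. norm (\<sigma> i) powr p) = 1"
  shows "energy a N \<sigma> \<le> GP TYPE('k) p N a"
proof -
  define \<tau> where "\<tau> = restrict \<sigma> {1..N}"
  have "(\<Sum>i=1..N. norm (\<tau> i) powr p) = 1"
    using one by (simp add: \<tau>_def)
  then have "norm_p2 p N \<tau> = 1" using norm_p2_eq_1_iff[OF p] by blast
  moreover have "\<tau> \<in> configs N" by (simp add: configs_def \<tau>_def)
  ultimately have "energy a N \<tau> \<le> GP TYPE('k) p N a"
    using GP_is_max[OF N p, where 'k='k] by metis
  then show ?thesis by (simp add: energy_def \<tau>_def)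
qed

text \<open>Scalar spins embed along a fixed unit vector of the spin space.\<close>

lemma quad_le_GP:
  assumes p: "p > 0" and N: "N \<ge> 1" and one: "(\<Sum>i=1..N. \<bar>x i\<bar> powr p) = 1"
  shows "quad {1..N} a x \<le> GP TYPE('k::finite) p N a"
proof -
  obtain e :: "real ^ 'k" where e: "norm e = 1"
    using vector_choose_size[of 1] by auto
  then have "e \<bullet> e = 1" by (simp add: dot_square_norm)
  then have "quad {1..N} a x = energy a N (\<lambda>i. x i *\<^sub>R e)"
    by (simp add: quad_def energy_def mult.commute)
  also have "\<dots> \<le> GP TYPE('k) p N a"
    using one e by (intro energy_le_GP p N) simp
  finally show ?thesis .
qed

text \<open>Padding an optimal configuration with zero spins changes neither its norm nor its
  energy.\<close>

lemma GP_mono: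
  assumes p: "p > 0" and N: "1 \<le> N" "N \<le> N'"
  shows "GP TYPE('k::finite) p N a \<le> GP TYPE('k) p N' a"
proof -
  obtain \<sigma> :: "nat \<Rightarrow> real ^ 'k" where \<sigma>: "norm_p2 p N \<sigma> = 1" "energy a N \<sigma> = GP TYPE('k) p N a"
    using GP_is_max[OF N(1) p] by blast
  define \<tau> where "\<tau> i = (if i \<in> {1..N} then \<sigma> i else 0)" for i
  have ext: "(\<Sum>i=1..N'. f i) = (\<Sum>i=1..N. f i)" if "\<And>i. i \<notin> {1..N} \<Longrightarrow> f i = 0" for f :: "nat \<Rightarrow> real"
    using N that by (intro sum.mono_neutral_right) auto
  have "(\<Sum>i=1..N'. norm (\<tau> i) powr p) = (\<Sum>i=1..N. norm (\<sigma> i) powr p)"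
    by (subst ext) (auto simp: \<tau>_def)
  also have "\<dots> = 1" using \<sigma>(1) norm_p2_eq_1_iff[OF p] by blast
  finally have "energy a N' \<tau> \<le> GP TYPE('k) p N' a"
    using N by (intro energy_le_GP p) auto
  moreover have "energy a N' \<tau> = (\<Sum>i=1..N. \<Sum>j=1..N'. a i j * (\<tau> i \<bullet> \<tau> j))"
    unfolding energy_def by (rule ext) (auto simp: \<tau>_def)
  moreover have "\<dots> = (\<Sum>i=1..N. \<Sum>j=1..N. a i j * (\<tau> i \<bullet> \<tau> j))"
    by (intro sum.cong refl ext) (auto simp: \<tau>_def)
  moreover have "\<dots> = energy a N \<sigma>" by (simp add: energy_def \<tau>_def)
  ultimately show ?thesis using \<sigma>(2) by simp
qed

subsection \<open>From probability estimates to almost sure limits\<close>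

text \<open>Only a covering event for the failures is asked for, so \<open>P\<close> may be a
  non-measurable statement, such as one about \<open>GP\<close> or about all vectors at
  once.\<close>

definition (in prob_space) holds_except :: "('a \<Rightarrow> bool) \<Rightarrow> real \<Rightarrow> bool" where
  "holds_except P \<delta> \<longleftrightarrow> (\<exists>A\<in>events. prob A \<le> \<delta> \<and> (\<forall>\<omega>\<in>space M - A. P \<omega>))"

context prob_space
begin

lemma holds_exceptI:
  assumes "A \<in> events" "prob A \<le> \<delta>" "\<And>\<omega>. \<omega> \<in> space M \<Longrightarrow> \<omega> \<notin> A \<Longrightarrow> P \<omega>"
  shows "holds_except P \<delta>"
  unfolding holds_except_def using assms by blast

lemma holds_except_Collect:
  assumes "{\<omega>\<in>space M. Q \<omega>} \<in> events" "prob {\<omega>\<in>space M. Q \<omega>} \<le> \<delta>"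
  shows "holds_except (\<lambda>\<omega>. \<not> Q \<omega>) \<delta>"
  using assms by (intro holds_exceptI[of "{\<omega>\<in>space M. Q \<omega>}"]) auto

lemma holds_except_mono:
  assumes "holds_except P \<delta>" "\<delta> \<le> \<delta>'" "\<And>\<omega>. \<omega> \<in> space M \<Longrightarrow> P \<omega> \<Longrightarrow> Q \<omega>"
  shows "holds_except Q \<delta>'"
  using assms unfolding holds_except_def by (meson Diff_iff order_trans)

lemma holds_except_conj:
  assumes "holds_except P \<delta>" "holds_except Q \<delta>'"
  shows "holds_except (\<lambda>\<omega>. P \<omega> \<and> Q \<omega>) (\<delta> + \<delta>')"
proof -
  obtain A B where A: "A \<in> events" "prob A \<le> \<delta>" "\<forall>\<omega>\<in>space M - A. P \<omega>"
    and B: "B \<in> events" "prob B \<le> \<delta>'" "\<forall>\<omega>\<in>space M - B. Q \<omega>"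
    using assms unfolding holds_except_def by auto
  show ?thesis
    using A B measure_Un_le[OF A(1) B(1)] by (intro holds_exceptI[of "A \<union> B"]) auto
qed

lemma prob_le_of_holds_except:
  assumes "holds_except (\<lambda>\<omega>. \<not> Q \<omega>) \<delta>"
  shows "prob {\<omega>\<in>space M. Q \<omega>} \<le> \<delta>"
proof -
  obtain A where A: "A \<in> events" "prob A \<le> \<delta>" "\<forall>\<omega>\<in>space M - A. \<not> Q \<omega>"
    using assms unfolding holds_except_def by auto
  then have "prob {\<omega>\<in>space M. Q \<omega>} \<le> prob A" by (intro finite_measure_mono) auto
  with A show ?thesis by simp
qed

lemma AE_eventually_holds_except:
  assumes h: "\<And>n. holds_except (P n) (b n)" and b: "summable b"
  shows "AE \<omega> in M. \<forall>\<^sub>F n in sequentially. P n \<omega>"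
proof -
  obtain A where A: "\<And>n. A n \<in> events" "\<And>n. prob (A n) \<le> b n" "\<And>n. \<forall>\<omega>\<in>space M - A n. P n \<omega>"
    using h unfolding holds_except_def by metis
  have "AE \<omega> in M. \<forall>\<^sub>F n in sequentially. \<omega> \<in> space M - A n"
  proof (rule borel_cantelli_AE1)
    show "summable (\<lambda>n. prob (A n))"
      by (rule summable_comparison_test[OF _ b]) (use A in auto)
  qed (use A in \<open>auto simp: emeasure_eq_measure\<close>)
  then show ?thesis
    by eventually_elim (use A(3) in \<open>auto elim: eventually_mono\<close>)
qed

end

text \<open>Between neighbouring points of the subsequence both \<open>F\<close> and
  \<open>f\<close> are monotone, so \<open>F N / f N\<close> is squeezed between mixed quotients
  that differ from the known ones by the factor \<open>ratio\<close>. Positivity of \<open>c\<close>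
  makes \<open>F\<close> eventually positive, so that enlarging the denominator lowers the
  quotient.\<close>

lemma tendsto_of_subseq_monotone:
  fixes F f :: "nat \<Rightarrow> real"
  assumes F: "\<And>N N'. 1 \<le> N \<Longrightarrow> N \<le> N' \<Longrightarrow> F N \<le> F N'"
    and f: "\<And>N N'. L \<le> N \<Longrightarrow> N \<le> N' \<Longrightarrow> f N \<le> f N'" "\<And>N. L \<le> N \<Longrightarrow> f N > 0"
    and m: "strict_mono (m :: nat \<Rightarrow> nat)" and ratio: "(\<lambda>n. f (m (Suc n)) / f (m n)) \<longlonglongrightarrow> 1"
    and c: "c > 0" and sub: "(\<lambda>n. F (m n) / f (m n)) \<longlonglongrightarrow> c"
  shows "(\<lambda>N. F N / f N) \<longlonglongrightarrow> c"
proof -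
  \<comment> \<open>The position of the last subsequence point not exceeding
    \<open>N\<close>.\<close>
  define \<nu> where "\<nu> N = (GREATEST n. m n \<le> N)" for N
  have \<nu>: "m (\<nu> N) \<le> N" "N < m (Suc (\<nu> N))" if "m 0 \<le> N" for N
  proof -
    have bd: "n \<le> N" if "m n \<le> N" for n using strict_mono_imp_increasing[OF m, of n] that by linarith
    show "m (\<nu> N) \<le> N" unfolding \<nu>_def by (rule GreatestI_nat[where k=0 and b=N]) (use bd that in auto)
    show "N < m (Suc (\<nu> N))"
    proof (rule ccontr)
      assume "\<not> N < m (Suc (\<nu> N))"
      then have "Suc (\<nu> N) \<le> \<nu> N" unfolding \<nu>_def by (intro Greatest_le_nat[where b=N]) (use bd in auto)
      then show False by simp
    qed
  qed
  have \<nu>_top: "filterlim \<nu> at_top sequentially"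
    unfolding filterlim_at_top
  proof
    fix Z show "\<forall>\<^sub>F N in sequentially. Z \<le> \<nu> N"
      unfolding eventually_sequentially
    proof (intro exI[of _ "m Z"] allI impI)
      fix N assume N: "m Z \<le> N"
      have "m 0 \<le> m Z" using m by (simp add: strict_mono_less_eq)
      then have "m Z < m (Suc (\<nu> N))" using \<nu>(2)[of N] N by linarith
      then show "Z \<le> \<nu> N" using m by (simp add: strict_mono_less)
    qed
  qed
  have r1: "(\<lambda>n. F (m (Suc n)) / f (m (Suc n)) * (f (m (Suc n)) / f (m n))) \<longlonglongrightarrow> c * 1"
    by (intro tendsto_mult ratio LIMSEQ_Suc[OF sub])
  have r2: "(\<lambda>n. F (m n) / f (m n) * inverse (f (m (Suc n)) / f (m n))) \<longlonglongrightarrow> c * inverse 1"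
    by (intro tendsto_mult tendsto_inverse ratio sub) simp
  have ev_pos: "\<forall>\<^sub>F n in sequentially. F (m n) / f (m n) > 0"
    using order_tendstoD(1)[OF sub c] .
  have ev_big: "\<forall>\<^sub>F n in sequentially. m n \<ge> max 1 L"
  proof -
    have "filterlim m at_top sequentially" using m by (rule filterlim_subseq)
    then show ?thesis unfolding filterlim_at_top by blast
  qed
  note ev = eventually_compose_filterlim[OF eventually_conj[OF ev_pos ev_big] \<nu>_top]
  show ?thesis
  proof (rule tendsto_sandwich)
    show "(\<lambda>N. F (m (\<nu> N)) / f (m (\<nu> N)) * inverse (f (m (Suc (\<nu> N))) / f (m (\<nu> N)))) \<longlonglongrightarrow> c"
      using filterlim_compose[OF r2 \<nu>_top] by simp
    show "(\<lambda>N. F (m (Suc (\<nu> N))) / f (m (Suc (\<nu> N))) * (f (m (Suc (\<nu> N))) / f (m (\<nu> N)))) \<longlonglongrightarrow> c"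
      using filterlim_compose[OF r1 \<nu>_top] by simp
    have both: "\<forall>\<^sub>F N in sequentially. F (m (\<nu> N)) / f (m (\<nu> N)) * inverse (f (m (Suc (\<nu> N))) / f (m (\<nu> N))) \<le> F N / f N
       \<and> F N / f N \<le> F (m (Suc (\<nu> N))) / f (m (Suc (\<nu> N))) * (f (m (Suc (\<nu> N))) / f (m (\<nu> N)))"
      using ev eventually_ge_at_top[of "m 0"]
    proof eventually_elim
      case (elim N)
      note b = \<nu>[OF elim(2)]
      have pos: "f (m (\<nu> N)) > 0" "f N > 0" "f (m (Suc (\<nu> N))) > 0" using elim b by (auto intro!: f(2))
      have fle: "f (m (\<nu> N)) \<le> f N" "f N \<le> f (m (Suc (\<nu> N)))" using elim b by (auto intro!: f(1))
      have Fle: "F (m (\<nu> N)) \<le> F N" "F N \<le> F (m (Suc (\<nu> N)))" using elim b by (auto intro!: F)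
      have F0: "F (m (\<nu> N)) > 0" using elim pos by (simp add: zero_less_divide_iff)
      have "F (m (\<nu> N)) / f (m (Suc (\<nu> N))) \<le> F N / f N"
        using Fle fle pos F0 by (intro frac_le) auto
      moreover have "F N / f N \<le> F (m (Suc (\<nu> N))) / f (m (\<nu> N))"
        using Fle fle pos F0 by (intro frac_le) auto
      ultimately show ?case using pos by simp
    qed
    show "\<forall>\<^sub>F N in sequentially. F (m (\<nu> N)) / f (m (\<nu> N)) * inverse (f (m (Suc (\<nu> N))) / f (m (\<nu> N))) \<le> F N / f N"
      using both by eventually_elim blast
    show "\<forall>\<^sub>F N in sequentially. F N / f N \<le> F (m (Suc (\<nu> N))) / f (m (Suc (\<nu> N))) * (f (m (Suc (\<nu> N))) / f (m (\<nu> N)))"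
      using both by eventually_elim blast
  qed
qed

text \<open>Borel-Cantelli is applied for each \<epsilon> = 1/(k+1) separately, so that only
  countably many null sets are collected.\<close>

lemma (in prob_space) AE_tendsto_of_subseq:
  fixes F :: "nat \<Rightarrow> 'a \<Rightarrow> real" and f :: "nat \<Rightarrow> real"
  assumes F: "\<And>N N' \<omega>. 1 \<le> N \<Longrightarrow> N \<le> N' \<Longrightarrow> F N \<omega> \<le> F N' \<omega>"
    and f: "\<And>N N'. L \<le> N \<Longrightarrow> N \<le> N' \<Longrightarrow> f N \<le> f N'" "\<And>N. L \<le> N \<Longrightarrow> f N > 0"
    and m: "strict_mono (m :: nat \<Rightarrow> nat)" and ratio: "(\<lambda>n. f (m (Suc n)) / f (m n)) \<longlonglongrightarrow> 1"
    and c: "c > 0"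
    and P: "\<And>\<epsilon>. \<epsilon> > 0 \<Longrightarrow> \<exists>b. summable b \<and>
      (\<forall>\<^sub>F n in sequentially. holds_except (\<lambda>\<omega>. F (m n) \<omega> \<le> (c + \<epsilon>) * f (m n)) (b n))"
      "\<And>\<epsilon>. \<epsilon> > 0 \<Longrightarrow> \<exists>b. summable b \<and>
      (\<forall>\<^sub>F n in sequentially. holds_except (\<lambda>\<omega>. (c - \<epsilon>) * f (m n) \<le> F (m n) \<omega>) (b n))"
  shows "AE \<omega> in M. (\<lambda>N. 1 / f N * F N \<omega>) \<longlonglongrightarrow> c"
proof -
  have ev_AE: "AE \<omega> in M. \<forall>\<^sub>F n in sequentially. Q n \<omega>"
    if b: "summable b" "\<forall>\<^sub>F n in sequentially. holds_except (Q n) (b n)" for Q and b :: "nat \<Rightarrow> real"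
  proof -
    obtain n0 where n0: "\<And>n. n \<ge> n0 \<Longrightarrow> holds_except (Q n) (b n)"
      using b(2) unfolding eventually_sequentially by blast
    have "AE \<omega> in M. \<forall>\<^sub>F n in sequentially. Q (n + n0) \<omega>"
      by (rule AE_eventually_holds_except[where b="\<lambda>n. b (n + n0)"]) (use n0 b(1) in \<open>auto simp: summable_iff_shift\<close>)
    then show ?thesis by eventually_elim (rule eventually_sequentially_seg[THEN iffD1])
  qed
  have "AE \<omega> in M. \<forall>\<^sub>F n in sequentially. F (m n) \<omega> \<le> (c + 1 / Suc k) * f (m n)" for k :: nat
    using P(1)[of "1 / Suc k"] ev_AE by force
  then have up: "AE \<omega> in M. \<forall>k::nat. \<forall>\<^sub>F n in sequentially. F (m n) \<omega> \<le> (c + 1 / Suc k) * f (m n)"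
    by (simp add: AE_all_countable)
  have "AE \<omega> in M. \<forall>\<^sub>F n in sequentially. (c - 1 / Suc k) * f (m n) \<le> F (m n) \<omega>" for k :: nat
    using P(2)[of "1 / Suc k"] ev_AE by force
  then have lo: "AE \<omega> in M. \<forall>k::nat. \<forall>\<^sub>F n in sequentially. (c - 1 / Suc k) * f (m n) \<le> F (m n) \<omega>"
    by (simp add: AE_all_countable)
  have fpos: "\<forall>\<^sub>F n in sequentially. f (m n) > 0"
  proof -
    have "filterlim m at_top sequentially" using m by (rule filterlim_subseq)
    then have "\<forall>\<^sub>F n in sequentially. m n \<ge> L" unfolding filterlim_at_top by blast
    then show ?thesis by eventually_elim (rule f(2))
  qed
  from up lo show ?thesis
  proof eventually_elim
    case (elim \<omega>)
    have "(\<lambda>n. F (m n) \<omega> / f (m n)) \<longlonglongrightarrow> c"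
    proof (rule tendstoI)
      fix e :: real assume e: "e > 0"
      then obtain k :: nat where k: "1 / Suc k < e" using nat_approx_posE by blast
      from elim(1)[rule_format, of k] elim(2)[rule_format, of k] fpos
      show "\<forall>\<^sub>F n in sequentially. dist (F (m n) \<omega> / f (m n)) c < e"
      proof eventually_elim
        case (elim n)
        have "F (m n) \<omega> / f (m n) \<le> c + 1 / Suc k" "c - 1 / Suc k \<le> F (m n) \<omega> / f (m n)"
          using elim by (simp_all add: pos_divide_le_eq pos_le_divide_eq)
        then show ?case using k by (simp add: dist_real_def)
      qed
    qed
    then have "(\<lambda>N. F N \<omega> / f N) \<longlonglongrightarrow> c"
    proof (rule tendsto_of_subseq_monotone[where L=L and m=m, rotated -1])
      show "1 \<le> N \<Longrightarrow> N \<le> N' \<Longrightarrow> F N \<omega> \<le> F N' \<omega>" for N N' by (rule F)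
    qed (fact f m ratio c)+
    then show ?case by simp
  qed
qed

section \<open>Rows and symmetrised rows as iid families\<close>

context gaussian_matrix
begin

lemma row_iid: 
  assumes "r \<ge> 1" "J \<subseteq> {1..}" shows "iid_std_normal M (g r) J"
proof
  let ?X = "\<lambda>(i, j). g i j"
  have "indep_vars (\<lambda>j. PiM {(r,j)} (\<lambda>_. borel)) (\<lambda>j \<omega>. restrict (\<lambda>k. ?X k \<omega>) {(r,j)}) J"
    by (rule indep_vars_restrict[OF indep]) (use assms in \<open>auto simp: disjoint_family_on_def\<close>)
  then have "indep_vars (\<lambda>_. borel) (\<lambda>j \<omega>. (\<lambda>x. x (r,j)) (restrict (\<lambda>k. ?X k \<omega>) {(r,j)})) J"
    by (rule indep_vars_compose2) (intro measurable_component_singleton; simp)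
  then show "indep_vars (\<lambda>_. borel) (g r) J" by simp
qed (use assms entries_dist in auto)

text \<open>A quadratic form sees row and column \<open>r\<close> only through these sums. As
  \<open>r \<notin> J\<close>, the pairs of entries are disjoint for different \<open>j\<close>, and
  each pair consists of two distinct entries with total variance 2.\<close>

lemma symmetric_row_iid:
  assumes r: "r \<ge> 1" and J: "J \<subseteq> {1..}" "r \<notin> J"
  shows "iid_std_normal M (\<lambda>j \<omega>. (g r j \<omega> + g j r \<omega>) / sqrt 2) J"
proof
  let ?X = "\<lambda>(i, j). g i j"
  let ?K = "\<lambda>j. {(r,j),(j,r)}"
  have "indep_vars (\<lambda>j. PiM (?K j) (\<lambda>_. borel)) (\<lambda>j \<omega>. restrict (\<lambda>k. ?X k \<omega>) (?K j)) J"
    by (rule indep_vars_restrict[OF indep]) (use r J in \<open>auto simp: disjoint_family_on_def\<close>)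
  then have "indep_vars (\<lambda>_. borel) (\<lambda>j \<omega>. (\<lambda>x. (x (r,j) + x (j,r)) / sqrt 2) (restrict (\<lambda>k. ?X k \<omega>) (?K j))) J"
    by (rule indep_vars_compose2) (intro borel_measurable_divide borel_measurable_add measurable_component_singleton; simp)
  then show "indep_vars (\<lambda>_. borel) (\<lambda>j \<omega>. (g r j \<omega> + g j r \<omega>) / sqrt 2) J" by simp
next
  fix j assume j: "j \<in> J"
  have "indep_var (PiM {(r,j)} (\<lambda>_. borel)) (\<lambda>\<omega>. restrict (\<lambda>k. (\<lambda>(i, j). g i j) k \<omega>) {(r,j)})
      (PiM {(j,r)} (\<lambda>_. borel)) (\<lambda>\<omega>. restrict (\<lambda>k. (\<lambda>(i, j). g i j) k \<omega>) {(j,r)})"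
    by (rule indep_var_restrict[OF indep]) (use r J j in auto)
  then have "indep_var borel ((\<lambda>x. x (r,j)) \<circ> (\<lambda>\<omega>. restrict (\<lambda>k. (\<lambda>(i, j). g i j) k \<omega>) {(r,j)}))
      borel ((\<lambda>x. x (j,r)) \<circ> (\<lambda>\<omega>. restrict (\<lambda>k. (\<lambda>(i, j). g i j) k \<omega>) {(j,r)}))"
    by (rule indep_var_compose) (intro measurable_component_singleton; simp)+
  then have iv: "indep_var borel (g r j) borel (g j r)" by (simp add: comp_def)
  have "distributed M lborel (\<lambda>\<omega>. g r j \<omega> + g j r \<omega>) (normal_density (0 + 0) (sqrt (1\<^sup>2 + 1\<^sup>2)))"
    by (rule add_indep_normal[OF iv _ _ entries_dist entries_dist]) (use r J j in auto)
  then have "distributed M lborel (\<lambda>\<omega>. 0 + (1 / sqrt 2) * (g r j \<omega> + g j r \<omega>))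
      (normal_density (0 + (1 / sqrt 2) * (0 + 0)) (\<bar>1 / sqrt 2\<bar> * sqrt (1\<^sup>2 + 1\<^sup>2)))"
    by (rule normal_density_affine) auto
  then show "distributed M lborel (\<lambda>\<omega>. (g r j \<omega> + g j r \<omega>) / sqrt 2) std_normal_density" by simp
qed

end

context iid_std_normal
begin

lemma holds_except_abs_powr_sum:
  assumes J: "J \<subseteq> I" "finite J" "J \<noteq> {}" and q: "q \<ge> 0" and \<epsilon>: "\<epsilon> > 0"
  shows "holds_except (\<lambda>\<omega>. \<bar>(\<Sum>j\<in>J. \<bar>X j \<omega>\<bar> powr q) - real (card J) * abs_moment q\<bar> < \<epsilon> * real (card J))
    (abs_moment (2*q) / (\<epsilon>\<^sup>2 * real (card J)))"
proof -
  have [measurable]: "X j \<in> borel_measurable M" if "j \<in> J" for j using J that by auto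
  show ?thesis
    using holds_except_Collect[OF _ abs_powr_sum_deviation[OF assms]] by (simp add: not_le)
qed

lemma holds_except_abs_less:
  assumes J: "J \<subseteq> I" "finite J" and q: "q > 0" and s: "s > 0"
  shows "holds_except (\<lambda>\<omega>. \<forall>j\<in>J. \<bar>X j \<omega>\<bar> < s) (real (card J) * abs_moment q / s powr q)"
proof -
  have [measurable]: "X j \<in> borel_measurable M" if "j \<in> J" for j using J that by auto
  have "{\<omega>\<in>space M. \<exists>j\<in>J. \<bar>X j \<omega>\<bar> \<ge> s} \<in> events" using J(2) by measurable
  from holds_except_Collect[OF this prob_exists_large[OF assms]]
  show ?thesis by (simp add: not_le)
qed

end

subsection \<open>Upper bounds for \<open>1 < p \<le> 2\<close>\<close>

lemma conjugate_exponent_gt_1: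
  fixes p q :: real
  assumes "1 < p" "1 / p + 1 / q = 1" shows "1 < q"
proof -
  have "1/p < 1" "1/p > 0" using assms(1) by auto
  then have "0 < 1/q" "1/q < 1" using assms(2) by linarith+
  then show ?thesis by (metis divide_less_eq_1_pos zero_less_divide_1_iff)
qed

lemma Holder_sum:
  fixes a b :: "'i \<Rightarrow> real"
  assumes p: "1 < p" "1 < q" "1 / p + 1 / q = 1" and J: "finite J"
  shows "(\<Sum>i\<in>J. a i * b i) \<le> (\<Sum>i\<in>J. \<bar>a i\<bar> powr p) powr (1/p) * (\<Sum>i\<in>J. \<bar>b i\<bar> powr q) powr (1/q)"
proof -
  define A where "A = (\<Sum>i\<in>J. \<bar>a i\<bar> powr p)"
  define B where "B = (\<Sum>i\<in>J. \<bar>b i\<bar> powr q)"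
  have AB: "A \<ge> 0" "B \<ge> 0" by (simp_all add: A_def B_def sum_nonneg)
  show ?thesis
  proof (cases "A = 0 \<or> B = 0")
    case True
    then have "(\<Sum>i\<in>J. a i * b i) = 0"
      using J by (intro sum.neutral) (auto simp: A_def B_def sum_nonneg_eq_0_iff)
    then show ?thesis by simp
  next
    case False
    then have pos: "A > 0" "B > 0" using AB by auto
    define \<alpha> where "\<alpha> = A powr (1/p)"
    define \<beta> where "\<beta> = B powr (1/q)"
    have ab: "\<alpha> > 0" "\<beta> > 0" "\<alpha> powr p = A" "\<beta> powr q = B"
      using pos p by (simp_all add: \<alpha>_def \<beta>_def powr_powr)
    have "(\<Sum>i\<in>J. a i * b i) / (\<alpha> * \<beta>) \<le> (\<Sum>i\<in>J. \<bar>a i\<bar> powr p / A / p + \<bar>b i\<bar> powr q / B / q)"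
      unfolding sum_divide_distrib
    proof (rule sum_mono)
      fix i
      have "a i * b i / (\<alpha> * \<beta>) \<le> (\<bar>a i\<bar> / \<alpha>) * (\<bar>b i\<bar> / \<beta>)"
        using ab by (simp add: abs_mult[symmetric] divide_right_mono)
      also have "\<dots> \<le> (\<bar>a i\<bar> / \<alpha>) powr p / p + (\<bar>b i\<bar> / \<beta>) powr q / q"
        using p ab by (intro Youngs_inequality) auto
      also have "\<dots> = \<bar>a i\<bar> powr p / A / p + \<bar>b i\<bar> powr q / B / q"
        using ab by (simp add: powr_divide)
      finally show "a i * b i / (\<alpha> * \<beta>) \<le> \<bar>a i\<bar> powr p / A / p + \<bar>b i\<bar> powr q / B / q" .
    qed
    also have "\<dots> = A / A / p + B / B / q"
      unfolding sum.distrib sum_divide_distrib[symmetric] A_def[symmetric] B_def[symmetric] by simp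
    also have "\<dots> = 1" using pos p by simp
    finally show ?thesis using ab by (simp add: A_def[symmetric] B_def[symmetric] \<alpha>_def[symmetric] \<beta>_def[symmetric])
  qed
qed

text \<open>Each coordinate is at most the p-norm, so its square is at most
  \<open>\<bar>x i\<bar> powr p\<close> times the p-norm to the power 2 - p.\<close>

lemma L2_set_le_powr_sum:
  assumes p: "0 < p" "p \<le> 2" and J: "finite J"
  shows "L2_set x J \<le> (\<Sum>i\<in>J. \<bar>x i\<bar> powr p) powr (1/p)"
proof -
  define S where "S = (\<Sum>i\<in>J. \<bar>x i\<bar> powr p)"
  have S0: "S \<ge> 0" by (simp add: S_def sum_nonneg)
  have le: "\<bar>x i\<bar> \<le> S powr (1/p)" if "i \<in> J" for i
  proof -
    have "\<bar>x i\<bar> powr p \<le> S" unfolding S_def using that J by (intro member_le_sum) auto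
    then have "(\<bar>x i\<bar> powr p) powr (1/p) \<le> S powr (1/p)" using p by (intro powr_mono2) auto
    then show ?thesis using p by (simp add: powr_powr)
  qed
  have "(\<Sum>i\<in>J. (x i)\<^sup>2) \<le> (\<Sum>i\<in>J. \<bar>x i\<bar> powr p * (S powr (1/p)) powr (2 - p))"
  proof (rule sum_mono)
    fix i assume i: "i \<in> J"
    have "(x i)\<^sup>2 = \<bar>x i\<bar> powr (p + (2 - p))" by simp
    also have "\<dots> = \<bar>x i\<bar> powr p * \<bar>x i\<bar> powr (2 - p)" by (simp only: powr_add)
    also have "\<dots> \<le> \<bar>x i\<bar> powr p * (S powr (1/p)) powr (2 - p)"
      using le[OF i] p by (intro mult_left_mono powr_mono2) auto
    finally show "(x i)\<^sup>2 \<le> \<bar>x i\<bar> powr p * (S powr (1/p)) powr (2 - p)" .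
  qed
  also have "\<dots> = S * S powr ((2 - p)/p)"
    by (simp add: sum_distrib_right[symmetric] S_def[symmetric] powr_powr)
  also have "\<dots> = S powr (2/p)"
  proof (cases "S = 0")
    case False
    then have "S * S powr ((2 - p)/p) = S powr 1 * S powr ((2 - p)/p)" using S0 by simp
    also have "\<dots> = S powr (1 + (2 - p)/p)" by (simp only: powr_add)
    also have "1 + (2 - p)/p = 2/p" using p by (simp add: field_simps)
    finally show ?thesis .
  qed simp
  also have "\<dots> = (S powr (1/p))\<^sup>2" by (simp add: power2_eq_square powr_add[symmetric])
  finally have "L2_set x J \<le> sqrt ((S powr (1/p))\<^sup>2)"
    unfolding L2_set_def by (rule real_sqrt_le_mono)
  then show ?thesis by (simp add: S_def)
qed

text \<open>The coordinates of size at least \<open>\<delta>\<close> carry the Euclidean norm, the others the duality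
  with \<open>h\<close>; the factor \<open>2 powr (-2/p)\<close> is the maximum of \<open>(A (1 - A)) powr (1/p)\<close>.\<close>

lemma L2_set_mult_inner_on_le:
  assumes p: "1 < p" "p < 2" and q: "1 / p + 1 / q = 1" and \<delta>: "0 < \<delta>" "\<delta> \<le> 1" and J: "finite J"
    and x: "(\<Sum>i\<in>J. \<bar>x i\<bar> powr p) = 1" and m: "0 \<le> m" "\<And>j. j \<in> J \<Longrightarrow> \<bar>h j\<bar> \<le> m"
  shows "L2_set x J * inner_on J h x \<le>
    (2 powr (-2/p) + \<delta> powr (1 - p/2)) * (\<Sum>j\<in>J. \<bar>h j\<bar> powr q) powr (1/q) + 2 * \<delta> powr (-p) * m"
proof -
  have q1: "q > 1" by (rule conjugate_exponent_gt_1[OF p(1) q])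
  define U where "U = {i\<in>J. \<delta> \<le> \<bar>x i\<bar>}"
  define W where "W = J - U"
  have UW: "finite U" "finite W" "U \<inter> W = {}" "J = U \<union> W" using J by (auto simp: U_def W_def)
  define A where "A = (\<Sum>i\<in>U. \<bar>x i\<bar> powr p)"
  define B where "B = (\<Sum>i\<in>W. \<bar>x i\<bar> powr p)"
  define H where "H = (\<Sum>j\<in>J. \<bar>h j\<bar> powr q) powr (1/q)"
  define \<delta>' where "\<delta>' = \<delta> powr (1 - p/2)"
  have AB: "A \<ge> 0" "B \<ge> 0" "A + B = 1"
    using x UW by (auto simp: A_def B_def sum_nonneg sum.union_disjoint)
  have H0: "H \<ge> 0" by (simp add: H_def)
  have d': "0 \<le> \<delta>'" "\<delta>' \<le> 1" using \<delta> p by (auto simp: \<delta>'_def powr_le1)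
  have xle1: "\<bar>x i\<bar> \<le> 1" if "i \<in> J" for i
  proof (rule ccontr)
    assume "\<not> \<bar>x i\<bar> \<le> 1"
    then have "1 < \<bar>x i\<bar> powr p" using p by (simp add: gr_one_powr)
    also have "\<dots> \<le> 1" unfolding x[symmetric] using that J by (intro member_le_sum) auto
    finally show False by simp
  qed
  have L2: "L2_set x J \<le> A powr (1/p) + \<delta>'"
  proof -
    have "L2_set x J = sqrt ((\<Sum>i\<in>U. (x i)\<^sup>2) + (\<Sum>i\<in>W. (x i)\<^sup>2))"
      unfolding L2_set_def using UW by (simp add: sum.union_disjoint)
    also have "\<dots> \<le> L2_set x U + L2_set x W"
      unfolding L2_set_def by (rule sqrt_add_le_add_sqrt) (auto intro: sum_nonneg)
    also have "L2_set x U \<le> A powr (1/p)"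
      unfolding A_def using p UW by (intro L2_set_le_powr_sum) auto
    \<comment> \<open>Small coordinates have squares at most
      \<open>\<bar>x i\<bar> powr p * \<delta> powr (2 - p)\<close>; the total p-mass is at most
      1.\<close>
    also have "L2_set x W \<le> \<delta>'"
    proof -
      have "(\<Sum>i\<in>W. (x i)\<^sup>2) \<le> (\<Sum>i\<in>W. \<bar>x i\<bar> powr p * \<delta> powr (2 - p))"
      proof (rule sum_mono)
        fix i assume i: "i \<in> W"
        have "(x i)\<^sup>2 = \<bar>x i\<bar> powr (p + (2 - p))" by simp
        also have "\<dots> = \<bar>x i\<bar> powr p * \<bar>x i\<bar> powr (2 - p)" by (simp only: powr_add)
        also have "\<dots> \<le> \<bar>x i\<bar> powr p * \<delta> powr (2 - p)"
          using i p by (intro mult_left_mono powr_mono2) (auto simp: W_def U_def)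
        finally show "(x i)\<^sup>2 \<le> \<bar>x i\<bar> powr p * \<delta> powr (2 - p)" .
      qed
      also have "\<dots> = B * \<delta> powr (2 - p)" by (simp add: B_def sum_distrib_right)
      also have "\<dots> \<le> 1 * \<delta> powr (2 - p)" using AB by (intro mult_right_mono) auto
      also have "\<dots> = \<delta>'\<^sup>2" by (simp add: \<delta>'_def power2_eq_square powr_add[symmetric])
      finally have "L2_set x W \<le> sqrt (\<delta>'\<^sup>2)" unfolding L2_set_def by (rule real_sqrt_le_mono)
      then show ?thesis using d' by simp
    qed
    finally show ?thesis by simp
  qed
  \<comment> \<open>Every large coordinate uses up p-mass at least \<open>\<delta> powr p\<close>
    out of 1. Their share of the inner product is thus bounded by a constant times \<open>m\<close>,
    the largest entry of \<open>h\<close>.\<close>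
  have cardU: "real (card U) \<le> \<delta> powr (-p)"
  proof -
    have "real (card U) * \<delta> powr p = (\<Sum>i\<in>U. \<delta> powr p)" by simp
    also have "\<dots> \<le> A" unfolding A_def using p \<delta> by (intro sum_mono powr_mono2) (auto simp: U_def)
    also have "\<dots> \<le> 1" using AB by simp
    finally show ?thesis using \<delta> by (simp add: powr_minus field_simps)
  qed
  have in_le: "inner_on J h x \<le> \<delta> powr (-p) * m + B powr (1/p) * H"
  proof -
    have "inner_on J h x = (\<Sum>i\<in>U. h i * x i) + (\<Sum>i\<in>W. x i * h i)"
      unfolding inner_on_def using UW by (simp add: sum.union_disjoint mult.commute)
    also have "(\<Sum>i\<in>U. h i * x i) \<le> (\<Sum>i\<in>U. m)"
    proof (rule sum_mono)
      fix i assume i: "i \<in> U"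
      have "h i * x i \<le> \<bar>h i\<bar> * \<bar>x i\<bar>" by (simp add: abs_mult[symmetric])
      also have "\<dots> \<le> m * 1" using i UW m xle1 by (intro mult_mono) auto
      finally show "h i * x i \<le> m" by simp
    qed
    also have "\<dots> = real (card U) * m" by simp
    also have "\<dots> \<le> \<delta> powr (-p) * m" using cardU m by (intro mult_right_mono)
    also have "(\<Sum>i\<in>W. x i * h i) \<le> B powr (1/p) * (\<Sum>i\<in>W. \<bar>h i\<bar> powr q) powr (1/q)"
      unfolding B_def by (rule Holder_sum[OF p(1) q1 q UW(2)])
    also have "\<dots> \<le> B powr (1/p) * H"
      unfolding H_def using UW J q1 by (intro mult_left_mono powr_mono2 sum_mono2 sum_nonneg) auto
    finally show ?thesis by simp
  qed
  \<comment> \<open>The masses satisfy \<open>A + B = 1\<close>, hence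
    \<open>A * B \<le> 1/4\<close>, with equality for an even split.\<close>
  have AB4: "A powr (1/p) * B powr (1/p) \<le> 2 powr (-2/p)"
  proof -
    have "B = 1 - A" using AB(3) by simp
    moreover have "A * (1 - A) \<le> 1/4" using zero_le_power2[of "A - 1/2"]
      by (simp add: power2_eq_square algebra_simps)
    ultimately have "A * B \<le> 1/4" by (simp only:)
    then have "(A * B) powr (1/p) \<le> (1/4) powr (1/p)" using AB p by (intro powr_mono2) auto
    also have "(1/4::real) powr (1/p) = (2 powr (-2)) powr (1/p)" by (simp add: powr_minus)
    also have "\<dots> = 2 powr (-2/p)" by (simp add: powr_powr)
    finally show ?thesis using AB by (simp add: powr_mult)
  qed
  have A1: "A powr (1/p) \<le> 1" "B powr (1/p) \<le> 1" using AB p by (auto intro!: powr_le1)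
  define D where "D = \<delta> powr (-p) * m"
  have D0: "D \<ge> 0" using m by (simp add: D_def)
  have "L2_set x J * inner_on J h x \<le> L2_set x J * (D + B powr (1/p) * H)"
    using in_le by (intro mult_left_mono) (auto simp: D_def)
  also have "\<dots> \<le> (A powr (1/p) + \<delta>') * (D + B powr (1/p) * H)"
    using L2 D0 H0 by (intro mult_right_mono) auto
  also have "\<dots> = (A powr (1/p) * B powr (1/p)) * H + \<delta>' * (B powr (1/p) * H) + (A powr (1/p) + \<delta>') * D"
    by (simp add: algebra_simps)
  also have "\<dots> \<le> 2 powr (-2/p) * H + \<delta>' * (1 * H) + (1 + 1) * D"
    using AB4 A1 d' H0 D0 by (intro add_mono mult_right_mono mult_left_mono) auto
  finally show ?thesis by (simp add: H_def D_def \<delta>'_def algebra_simps)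
qed

context gaussian_matrix
begin

lemma holds_except_quad_le:
  assumes J: "finite J" "J \<subseteq> {1..}" and r: "1 \<le> r" "r \<notin> J" and s: "s\<^sup>2 = (1::real)"
    and h: "holds_except (\<lambda>\<omega>. \<forall>x\<in>V. sqrt 2 * L2_set x J * inner_on J (\<lambda>j. g r j \<omega>) x \<le> t) \<delta>"
  shows "holds_except (\<lambda>\<omega>. \<forall>x\<in>V. s * quad J (G \<omega>) x \<le> t) (2 * \<delta>)"
proof -
  have "prob {\<omega>\<in>space M. \<exists>x\<in>V. t < s * quad J (G \<omega>) x}
      \<le> 2 * prob {\<omega>\<in>space M. \<exists>x\<in>V. t < sqrt 2 * L2_set x J * inner_on J (\<lambda>j. g r j \<omega>) x}"
    by (rule prob_quad_gt_le[OF J r s])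
  also have "\<dots> \<le> 2 * \<delta>"
    using h by (intro mult_left_mono prob_le_of_holds_except) (auto simp: not_less)
  finally have p: "prob {\<omega>\<in>space M. \<exists>x\<in>V. t < s * quad J (G \<omega>) x} \<le> 2 * \<delta>" .
  have "{\<omega>\<in>space M. \<exists>x\<in>V. t < s * quad J (G \<omega>) x} \<in> events"
    by (rule sets_Collect_bex_separable)
      (intro continuous_intros borel_measurable_times borel_measurable_const quad_measurable J)+
  from holds_except_Collect[OF this p] show ?thesis by (simp add: not_less)
qed

text \<open>A row of fresh Gaussians has q-norm close to \<xi> \<open>N powr (1/q)\<close>, and all
  its entries are small on that scale, each outside an event of probability O(1/N). On these events
  the linear process is bounded deterministically, uniformly in the vector.\<close>

lemma quad_upper_mid:
  assumes p: "1 < p" "p < 2" and q: "1 / p + 1 / q = 1" and \<epsilon>: "\<epsilon> > 0"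
  shows "\<exists>C. \<forall>N\<ge>1. holds_except (quad_below p N ((2 powr (1/2 - 2/p) * abs_moment q powr (1/q) + \<epsilon>) * real N powr (1/q))) (C / real N)"
proof -
  have q1: "q > 1" by (rule conjugate_exponent_gt_1[OF p(1) q])
  define \<mu> where "\<mu> = abs_moment q"
  define \<xi> where "\<xi> = \<mu> powr (1/q)"
  have \<mu>: "\<mu> > 0" using q1 by (simp add: \<mu>_def abs_moment_pos)
  have \<xi>: "\<xi> > 0" "\<xi> powr q = \<mu>" using \<mu> q1 by (simp_all add: \<xi>_def powr_powr)
  \<comment> \<open>Together with \<open>s\<close> below, the three error terms amount to
    \<epsilon>/8, \<epsilon>/8 and \<epsilon>/4; the factor \<open>sqrt 2 \<le> 3/2\<close> leaves a
    total below \<epsilon>.\<close>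
  define \<eta> where "\<eta> = min 1 (\<epsilon>/8)"
  define \<delta>' where "\<delta>' = min 1 (\<epsilon> / (8 * (\<xi> + 1)))"
  have d': "0 < \<delta>'" "\<delta>' \<le> 1" using \<epsilon> \<xi> by (auto simp: \<delta>'_def)
  \<comment> \<open>The solution of \<open>\<delta> powr (1 - p/2) = \<delta>'\<close>, available
    because the exponent is positive.\<close>
  define \<delta> where "\<delta> = \<delta>' powr (1 / (1 - p/2))"
  have \<delta>: "0 < \<delta>" "\<delta> \<le> 1" "\<delta> powr (1 - p/2) = \<delta>'"
    using d' p by (auto simp: \<delta>_def powr_powr powr_le1)
  define s where "s = \<epsilon> / (8 * \<delta> powr (-p))"
  have s: "s > 0" using \<epsilon> \<delta> by (simp add: s_def)
  \<comment> \<open>The excess of the mean q-th power that still keeps the q-norm below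
    \<open>(\<xi> + \<eta>) * n\<close>.\<close>
  define \<kappa> where "\<kappa> = (\<xi> + \<eta>) powr q - \<mu>"
  have \<eta>: "\<eta> > 0" "\<eta> \<le> 1" "\<eta> \<le> \<epsilon>/8" using \<epsilon> by (auto simp: \<eta>_def)
  have \<kappa>: "\<kappa> > 0"
    using powr_less_mono2[of q \<xi> "\<xi> + \<eta>"] \<xi> \<eta> q1 by (simp add: \<kappa>_def)
  define C where "C = abs_moment (2*q) / \<kappa>\<^sup>2 + abs_moment (2*q) / s powr (2*q)"
  let ?c = "2 powr (1/2 - 2/p) * \<xi> + \<epsilon>"
  have bound: "sqrt 2 * ((2 powr (-2/p) + \<delta>') * (\<xi> + \<eta>) + 2 * \<delta> powr (-p) * s) \<le> ?c"
  proof -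
    have s2: "sqrt 2 \<le> 3/2" by (rule real_le_lsqrt) (auto simp: power2_eq_square)
    have a: "sqrt 2 * 2 powr (-2/p) = 2 powr (1/2 - 2/p)"
      by (simp add: powr_half_sqrt[symmetric] powr_add[symmetric])
    have b: "2 powr (-2/p) * \<eta> \<le> 1 * (\<epsilon>/8)" using \<eta> p powr_mono[of "-2/p" 0 2] by (intro mult_mono) auto
    have c: "\<delta>' * (\<xi> + \<eta>) \<le> \<epsilon> / (8 * (\<xi> + 1)) * (\<xi> + 1)"
      using \<eta> \<xi> \<epsilon> by (intro mult_mono) (auto simp: \<delta>'_def)
    have c': "\<epsilon> / (8 * (\<xi> + 1)) * (\<xi> + 1) = \<epsilon>/8" using \<xi> by (simp add: field_simps)
    have d: "2 * \<delta> powr (-p) * s = \<epsilon>/4" using \<delta> by (simp add: s_def)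
    have "sqrt 2 * ((2 powr (-2/p) + \<delta>') * (\<xi> + \<eta>) + 2 * \<delta> powr (-p) * s)
        = 2 powr (1/2 - 2/p) * \<xi> + sqrt 2 * (2 powr (-2/p) * \<eta> + \<delta>' * (\<xi> + \<eta>) + 2 * \<delta> powr (-p) * s)"
      unfolding a[symmetric] by (simp add: algebra_simps)
    also have "\<dots> \<le> 2 powr (1/2 - 2/p) * \<xi> + 3/2 * (\<epsilon>/8 + \<epsilon>/8 + \<epsilon>/4)"
    proof (intro add_left_mono mult_mono s2)
      show "2 powr (-2/p) * \<eta> + \<delta>' * (\<xi> + \<eta>) + 2 * \<delta> powr (-p) * s \<le> \<epsilon>/8 + \<epsilon>/8 + \<epsilon>/4"
        using b c c' d by linarith
      show "0 \<le> 2 powr (-2/p) * \<eta> + \<delta>' * (\<xi> + \<eta>) + 2 * \<delta> powr (-p) * s"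
        using \<eta> d' \<xi> s by (intro add_nonneg_nonneg mult_nonneg_nonneg) auto
    qed simp
    finally show ?thesis using \<epsilon> by simp
  qed
  show ?thesis
  proof (intro exI[of _ "2 * C"] allI impI)
    fix N :: nat assume N: "1 \<le> N"
    define n where "n = real N powr (1/q)"
    have n: "n > 0" "n powr q = real N" using N q1 by (simp_all add: n_def powr_powr)
    interpret R: iid_std_normal M "g (N+1)" "{1..N}" by (rule row_iid) auto
    have "holds_except (\<lambda>\<omega>. \<bar>(\<Sum>j\<in>{1..N}. \<bar>g (N+1) j \<omega>\<bar> powr q) - real (card {1..N}) * abs_moment q\<bar> < \<kappa> * real (card {1..N}))
        (abs_moment (2*q) / (\<kappa>\<^sup>2 * real (card {1..N})))"
      using N \<kappa> q1 by (intro R.holds_except_abs_powr_sum) auto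
    \<comment> \<open>The moment of order 2q makes the denominator quadratic in \<open>N\<close>,
      which beats the \<open>N\<close> terms of the union bound.\<close>
    moreover have "holds_except (\<lambda>\<omega>. \<forall>j\<in>{1..N}. \<bar>g (N+1) j \<omega>\<bar> < s * n)
        (real (card {1..N}) * abs_moment (2*q) / (s * n) powr (2*q))"
      using s n q1 by (intro R.holds_except_abs_less) auto
    ultimately have "holds_except (\<lambda>\<omega>. \<forall>x\<in>{x. (\<Sum>i=1..N. \<bar>x i\<bar> powr p) = 1}.
       sqrt 2 * L2_set x {1..N} * inner_on {1..N} (\<lambda>j. g (N+1) j \<omega>) x \<le> ?c * n) (C / real N)"
    proof (rule holds_except_mono[OF holds_except_conj])
      have "(s * n) powr (2*q) = s powr (2*q) * (n powr q) powr 2"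
        using s n(1) by (simp add: powr_mult powr_powr mult.commute)
      then have "(s * n) powr (2*q) = s powr (2*q) * (real N)\<^sup>2" using n by simp
      then show "abs_moment (2*q) / (\<kappa>\<^sup>2 * real (card {1..N})) + real (card {1..N}) * abs_moment (2*q) / (s * n) powr (2*q) \<le> C / real N"
        using N s by (simp add: C_def power2_eq_square field_simps)
    next
      fix \<omega>
      assume A: "\<bar>(\<Sum>j\<in>{1..N}. \<bar>g (N+1) j \<omega>\<bar> powr q) - real (card {1..N}) * abs_moment q\<bar> < \<kappa> * real (card {1..N})
        \<and> (\<forall>j\<in>{1..N}. \<bar>g (N+1) j \<omega>\<bar> < s * n)"
      let ?h = "\<lambda>j. g (N+1) j \<omega>"
      let ?H = "(\<Sum>j=1..N. \<bar>?h j\<bar> powr q) powr (1/q)"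
      have "(\<Sum>j=1..N. \<bar>?h j\<bar> powr q) \<le> (\<xi> + \<eta>) powr q * real N"
      proof -
        have "(\<Sum>j=1..N. \<bar>?h j\<bar> powr q) - real N * \<mu> < \<kappa> * real N"
          using A by (simp add: abs_less_iff \<mu>_def)
        then show ?thesis by (simp add: \<kappa>_def algebra_simps)
      qed
      then have "?H \<le> ((\<xi> + \<eta>) powr q * real N) powr (1/q)"
        using q1 by (intro powr_mono2) (auto intro: sum_nonneg)
      also have "\<dots> = (\<xi> + \<eta>) * n"
        using q1 \<xi> \<eta> by (simp add: powr_mult powr_powr n_def)
      finally have H: "?H \<le> (\<xi> + \<eta>) * n" .
      show "\<forall>x\<in>{x. (\<Sum>i=1..N. \<bar>x i\<bar> powr p) = 1}. sqrt 2 * L2_set x {1..N} * inner_on {1..N} ?h x \<le> ?c * n"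
      proof
        fix x :: "nat \<Rightarrow> real" assume "x \<in> {x. (\<Sum>i=1..N. \<bar>x i\<bar> powr p) = 1}"
        then have "L2_set x {1..N} * inner_on {1..N} ?h x \<le>
           (2 powr (-2/p) + \<delta> powr (1 - p/2)) * ?H + 2 * \<delta> powr (-p) * (s * n)"
          using A s n by (intro L2_set_mult_inner_on_le p q \<delta>) (auto intro: less_imp_le)
        also have "\<dots> \<le> (2 powr (-2/p) + \<delta>') * ((\<xi> + \<eta>) * n) + 2 * \<delta> powr (-p) * (s * n)"
          unfolding \<delta>(3) using s d' H by (intro add_mono mult_left_mono) auto
        finally have "sqrt 2 * (L2_set x {1..N} * inner_on {1..N} ?h x)
            \<le> sqrt 2 * ((2 powr (-2/p) + \<delta>') * ((\<xi> + \<eta>) * n) + 2 * \<delta> powr (-p) * (s * n))"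
          by (intro mult_left_mono) auto
        also have "\<dots> = sqrt 2 * ((2 powr (-2/p) + \<delta>') * (\<xi> + \<eta>) + 2 * \<delta> powr (-p) * s) * n"
          by (simp add: algebra_simps)
        also have "\<dots> \<le> ?c * n" using bound n by (intro mult_right_mono) auto
        finally show "sqrt 2 * L2_set x {1..N} * inner_on {1..N} ?h x \<le> ?c * n" by (simp add: mult.assoc)
      qed
    qed
    from holds_except_quad_le[OF _ _ _ _ _ this, of 1]
    show "holds_except (quad_below p N ((2 powr (1/2 - 2/p) * abs_moment q powr (1/q) + \<epsilon>) * real N powr (1/q))) (2 * C / real N)"
      by (simp add: \<xi>_def \<mu>_def n_def)
  qed
qed

text \<open>On the Euclidean sphere the linear process is at most \<open>sqrt 2\<close> times the
  length of the Gaussian row, by Cauchy-Schwarz; the squared length is close to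
  \<open>N\<close>.\<close>

lemma quad_upper_two:
  assumes \<epsilon>: "\<epsilon> > 0"
  shows "\<exists>C. \<forall>N\<ge>1. holds_except (quad_below 2 N ((sqrt 2 + \<epsilon>) * sqrt (real N))) (C / real N)"
proof -
  define \<kappa> where "\<kappa> = (sqrt 2 + \<epsilon>)\<^sup>2 / 2 - 1"
  have \<kappa>: "\<kappa> > 0" using \<epsilon> by (simp add: \<kappa>_def power2_sum add_pos_pos)
  show ?thesis
  proof (intro exI[of _ "2 * (abs_moment 4 / \<kappa>\<^sup>2)"] allI impI)
    fix N :: nat assume N: "1 \<le> N"
    interpret R: iid_std_normal M "g (N+1)" "{1..N}" by (rule row_iid) auto
    have "holds_except (\<lambda>\<omega>. \<bar>(\<Sum>j\<in>{1..N}. \<bar>g (N+1) j \<omega>\<bar> powr 2) - real (card {1..N}) * abs_moment 2\<bar> < \<kappa> * real (card {1..N}))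
        (abs_moment (2*2) / (\<kappa>\<^sup>2 * real (card {1..N})))"
      using N \<kappa> by (intro R.holds_except_abs_powr_sum) auto
    then have "holds_except (\<lambda>\<omega>. \<forall>x\<in>{x. (\<Sum>i=1..N. \<bar>x i\<bar> powr 2) = 1}.
       sqrt 2 * L2_set x {1..N} * inner_on {1..N} (\<lambda>j. g (N+1) j \<omega>) x \<le> (sqrt 2 + \<epsilon>) * sqrt (real N)) (abs_moment 4 / \<kappa>\<^sup>2 / real N)"
    proof (rule holds_except_mono, goal_cases)
      case (2 \<omega>)
      let ?h = "\<lambda>j. g (N+1) j \<omega>"
      have "2 * (\<Sum>j=1..N. (?h j)\<^sup>2) \<le> (sqrt 2 + \<epsilon>)\<^sup>2 * real N"
      proof -
        have "(\<Sum>j=1..N. (?h j)\<^sup>2) \<le> (1 + \<kappa>) * real N"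
          using 2 by (simp add: abs_moment_2 algebra_simps)
        moreover have "(sqrt 2 + \<epsilon>)\<^sup>2 = 2 * (1 + \<kappa>)" by (simp add: \<kappa>_def)
        ultimately show ?thesis by (simp add: algebra_simps)
      qed
      then have "sqrt (2 * (\<Sum>j=1..N. (?h j)\<^sup>2)) \<le> sqrt ((sqrt 2 + \<epsilon>)\<^sup>2 * real N)"
        by (rule real_sqrt_le_mono)
      then have h: "sqrt 2 * L2_set ?h {1..N} \<le> (sqrt 2 + \<epsilon>) * sqrt (real N)"
        using \<epsilon> by (simp add: L2_set_def real_sqrt_mult)
      show ?case
      proof
        fix x :: "nat \<Rightarrow> real" assume "x \<in> {x. (\<Sum>i=1..N. \<bar>x i\<bar> powr 2) = 1}"
        then have x: "L2_set x {1..N} = 1" by (simp add: L2_set_def)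
        have "inner_on {1..N} ?h x \<le> (\<Sum>j=1..N. \<bar>?h j\<bar> * \<bar>x j\<bar>)"
          unfolding inner_on_def by (intro sum_mono) (simp add: abs_mult[symmetric])
        also have "\<dots> \<le> L2_set ?h {1..N} * L2_set x {1..N}" by (rule L2_set_mult_ineq)
        finally have "sqrt 2 * inner_on {1..N} ?h x \<le> sqrt 2 * L2_set ?h {1..N}"
          unfolding x by (intro mult_left_mono) auto
        then show "sqrt 2 * L2_set x {1..N} * inner_on {1..N} ?h x \<le> (sqrt 2 + \<epsilon>) * sqrt (real N)"
          unfolding x using order.trans[OF _ h] by simp
      qed
    qed (simp add: field_simps)
    from holds_except_quad_le[OF _ _ _ _ _ this, of 1]
    show "holds_except (quad_below 2 N ((sqrt 2 + \<epsilon>) * sqrt (real N))) (2 * (abs_moment 4 / \<kappa>\<^sup>2) / real N)"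
      by simp
  qed
qed

end

subsection \<open>The lower bound for \<open>1 < p < 2\<close>\<close>

lemma quad_insert:
  assumes "finite J" "i \<notin> J"
  shows "quad (insert i J) a x = a i i * (x i)\<^sup>2 + x i * (\<Sum>j\<in>J. (a i j + a j i) * x j) + quad J a x"
  using assms unfolding quad_def
  by (simp add: sum.distrib sum_distrib_left algebra_simps power2_eq_square)

text \<open>The near-optimal vector puts half of the \<open>\<ell>\<^sub>p\<close> mass on the first coordinate and spreads the
  other half as the dual vector of the symmetrised first row.\<close>

lemma quad_dual_vector:
  fixes a :: "nat \<Rightarrow> nat \<Rightarrow> real" and w :: "nat \<Rightarrow> real"
  assumes p: "1 < p" and q: "1 / p + 1 / q = 1" and N: "N \<ge> 1"
    and w: "\<And>j. w j = (a 1 j + a j 1) / sqrt 2"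
    and S: "S = (\<Sum>j=2..N. \<bar>w j\<bar> powr q)" "S > 0"
  obtains x y where "(\<Sum>i=1..N. \<bar>x i\<bar> powr p) = 1" "(\<Sum>j=2..N. \<bar>y j\<bar> powr p) = 1"
    "(L2_set y {2..N})\<^sup>2 = (\<Sum>j=2..N. \<bar>w j\<bar> powr (2*q - 2)) / S powr (2/p)"
    "quad {1..N} a x = 2 powr (-2/p) * (a 1 1 + sqrt 2 * S powr (1/q) + quad {2..N} a y)"
proof -
  have q1: "q > 1" by (rule conjugate_exponent_gt_1[OF p q])
  have qp: "(q - 1) * p = q" using p q1 q by (simp add: field_simps)
  \<comment> \<open>The equality case of Hoelder's inequality, normalised by means of
    \<open>(q - 1) * p = q\<close>.\<close>
  define y where "y j = sgn (w j) * \<bar>w j\<bar> powr (q - 1) / S powr (1/p)" for j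
  \<comment> \<open>Chosen with \<open>c powr p = 1/2\<close>, the even split at which the upper
    bound is sharp.\<close>
  define c :: real where "c = 2 powr (-1/p)"
  have c: "c > 0" "c powr p = 1/2" "c\<^sup>2 = 2 powr (-2/p)"
  proof -
    have "(2 powr (-1/p)) powr p = 2 powr (-1/p * p)" by (rule powr_powr)
    also have "-1/p * p = -1" using p by simp
    finally show "c powr p = 1/2" by (simp add: c_def powr_minus)
    show "c > 0" "c\<^sup>2 = 2 powr (-2/p)" by (simp_all add: c_def power2_eq_square powr_add[symmetric])
  qed
  define x where "x i = c * (if i = 1 then 1 else y i)" for i :: nat
  have absy: "\<bar>y j\<bar> = \<bar>w j\<bar> powr (q - 1) / S powr (1/p)" for j
    using q1 by (cases "w j = 0") (auto simp: y_def abs_mult abs_sgn_eq)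
  have yp: "(\<Sum>j=2..N. \<bar>y j\<bar> powr p) = 1"
  proof -
    have "(\<Sum>j=2..N. \<bar>y j\<bar> powr p) = (\<Sum>j=2..N. \<bar>w j\<bar> powr q / S)"
      using S(2) p by (intro sum.cong refl) (simp add: absy powr_divide powr_powr qp)
    also have "\<dots> = 1" using S by (simp add: sum_divide_distrib[symmetric])
    finally show ?thesis .
  qed
  have y2: "(L2_set y {2..N})\<^sup>2 = (\<Sum>j=2..N. \<bar>w j\<bar> powr (2*q - 2)) / S powr (2/p)"
  proof -
    have "(y j)\<^sup>2 = \<bar>w j\<bar> powr (2*q - 2) / S powr (2/p)" for j
    proof -
      have "(y j)\<^sup>2 = \<bar>y j\<bar>\<^sup>2" by simp
      also have "\<dots> = (\<bar>w j\<bar> powr (q - 1))\<^sup>2 / (S powr (1/p))\<^sup>2" unfolding absy by (rule power_divide)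
      also have "(\<bar>w j\<bar> powr (q - 1))\<^sup>2 = \<bar>w j\<bar> powr (2*q - 2)"
        by (simp add: power2_eq_square powr_add[symmetric])
      also have "(S powr (1/p))\<^sup>2 = S powr (2/p)" by (simp add: power2_eq_square powr_add[symmetric])
      finally show ?thesis .
    qed
    then show ?thesis by (simp add: L2_set_def sum_nonneg sum_divide_distrib)
  qed
  have ins: "{1..N} = insert 1 {2..N}" using N by auto
  have xp: "(\<Sum>i=1..N. \<bar>x i\<bar> powr p) = 1"
  proof -
    have "(\<Sum>i=1..N. \<bar>x i\<bar> powr p) = \<bar>x 1\<bar> powr p + (\<Sum>i=2..N. \<bar>x i\<bar> powr p)"
      unfolding ins by simp
    also have "\<bar>x 1\<bar> powr p = 1/2" using c by (simp add: x_def)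
    also have "(\<Sum>i=2..N. \<bar>x i\<bar> powr p) = (\<Sum>i=2..N. 1/2 * \<bar>y i\<bar> powr p)"
      using c by (intro sum.cong refl) (auto simp: x_def abs_mult powr_mult)
    also have "\<dots> = 1/2" unfolding sum_distrib_left[symmetric] yp by simp
    finally show ?thesis by simp
  qed
  have wy: "(\<Sum>j=2..N. (a 1 j + a j 1) * y j) = sqrt 2 * S powr (1/q)"
  proof -
    have "(\<Sum>j=2..N. (a 1 j + a j 1) * y j) = (\<Sum>j=2..N. sqrt 2 * (\<bar>w j\<bar> powr q / S powr (1/p)))"
    proof (intro sum.cong refl)
      fix j
      have "(a 1 j + a j 1) * y j = sqrt 2 * (w j * y j)" by (simp add: w)
      also have "w j * y j = \<bar>w j\<bar> * \<bar>w j\<bar> powr (q - 1) / S powr (1/p)"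
      proof -
        have "w j * y j = (w j * sgn (w j)) * \<bar>w j\<bar> powr (q - 1) / S powr (1/p)" by (simp add: y_def)
        then show ?thesis by (simp only: abs_sgn[symmetric])
      qed
      also have "\<bar>w j\<bar> * \<bar>w j\<bar> powr (q - 1) = \<bar>w j\<bar> powr q"
        using powr_add[of "\<bar>w j\<bar>" 1 "q - 1"] by (cases "w j = 0") auto
      finally show "(a 1 j + a j 1) * y j = sqrt 2 * (\<bar>w j\<bar> powr q / S powr (1/p))" .
    qed
    also have "\<dots> = sqrt 2 * (S powr 1 / S powr (1/p))"
      using S by (simp add: sum_distrib_left[symmetric] sum_divide_distrib[symmetric])
    also have "S powr 1 / S powr (1/p) = S powr (1 - 1/p)" by (simp only: powr_diff)
    also have "1 - 1/p = 1/q" using q by simp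
    finally show ?thesis .
  qed
  have "quad {1..N} a x = c\<^sup>2 * quad (insert 1 {2..N}) a (\<lambda>i. if i = 1 then 1 else y i)"
    unfolding ins x_def by (rule quad_scale)
  also have "quad (insert 1 {2..N}) a (\<lambda>i. if i = 1 then 1 else y i)
     = a 1 1 + (\<Sum>j=2..N. (a 1 j + a j 1) * (if j = 1 then 1 else y j)) + quad {2..N} a (\<lambda>i. if i = 1 then 1 else y i)"
    by (subst quad_insert) auto
  also have "(\<Sum>j=2..N. (a 1 j + a j 1) * (if j = 1 then 1 else y j)) = (\<Sum>j=2..N. (a 1 j + a j 1) * y j)"
    by (intro sum.cong) auto
  also have "quad {2..N} a (\<lambda>i. if i = 1 then 1 else y i) = quad {2..N} a y"
    unfolding quad_def by (intro sum.cong) auto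
  also note c(3)
  finally show ?thesis using that[OF xp yp y2] wy by simp
qed

context gaussian_matrix
begin

text \<open>Besides the main term the dual vector leaves a diagonal entry and the form of the minor
  at \<open>y\<close>. As \<open>p < 2\<close>, the Euclidean norm of \<open>y\<close> tends to 0,
  and the comparison applied to the negated form makes the minor negligible.\<close>

lemma quad_lower_mid:
  assumes p: "1 < p" "p < 2" and q: "1 / p + 1 / q = 1" and \<epsilon>: "\<epsilon> > 0"
  shows "\<exists>C. \<forall>\<^sub>F N in sequentially. holds_except (quad_above p N ((2 powr (1/2 - 2/p) * abs_moment q powr (1/q) - \<epsilon>) * real N powr (1/q))) (C / real N)"
proof -
  have q1: "q > 1" by (rule conjugate_exponent_gt_1[OF p(1) q])
  define \<mu> where "\<mu> = abs_moment q"
  define \<mu>' where "\<mu>' = abs_moment (2*q - 2)"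
  define \<xi> where "\<xi> = \<mu> powr (1/q)"
  have \<mu>: "\<mu> > 0" using q1 by (simp add: \<mu>_def abs_moment_pos)
  have \<xi>: "\<xi> > 0" "\<xi> powr q = \<mu>" using \<mu> q1 by (simp_all add: \<xi>_def powr_powr)
  \<comment> \<open>The total loss is at most
    \<open>(sqrt 2 + 2) * \<eta> \<le> 4 * \<eta> \<le> \<epsilon>\<close>; the bound by \<xi>/2
    keeps \<open>\<xi> - \<eta>\<close> positive.\<close>
  define \<eta> where "\<eta> = min (\<epsilon>/4) (\<xi>/2)"
  have \<eta>: "\<eta> > 0" "\<eta> \<le> \<epsilon>/4" "\<eta> < \<xi>" using \<epsilon> \<xi> by (auto simp: \<eta>_def)
  \<comment> \<open>Half of the available gap goes to the deviation; the other half pays for the row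
    having N - 1 instead of \<open>N\<close> entries, once
    \<open>\<kappa> * N \<ge> \<mu>\<close>.\<close>
  define \<kappa> where "\<kappa> = (\<mu> - (\<xi> - \<eta>) powr q) / 2"
  have \<kappa>: "\<kappa> > 0" using powr_less_mono2[of q "\<xi> - \<eta>" \<xi>] \<xi> \<eta> q1 by (simp add: \<kappa>_def)
  \<comment> \<open>Makes the linear process at most \<open>\<eta> * n\<close> on vectors of
    Euclidean norm \<delta> and p-norm 1.\<close>
  define \<delta> where "\<delta> = \<eta> / (sqrt 2 * (\<mu> + 1) powr (1/q))"
  have \<delta>: "\<delta> > 0" using \<eta> \<mu> by (simp add: \<delta>_def)
  let ?c = "2 powr (1/2 - 2/p) * \<xi> - \<epsilon>"
  define K where "K = (\<mu>' + 1) / ((\<xi> - \<eta>) powr q) powr (2/p)"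
  define C1 where "C1 = abs_moment (2*q) / \<kappa>\<^sup>2"
  define C2 where "C2 = abs_moment (2*(2*q - 2))"
  define C3 where "C3 = abs_moment q / \<eta> powr q"
  define C4 where "C4 = abs_moment (2*q)"
  have ev: "\<forall>\<^sub>F N in sequentially. K * real N powr (1 - 2/p) \<le> \<delta>\<^sup>2"
  proof -
    have "1 - 2/p < 0" using p by simp
    then have "(\<lambda>N. K * real N powr (1 - 2/p)) \<longlonglongrightarrow> K * 0"
      by (intro tendsto_mult tendsto_const tendsto_neg_powr filterlim_real_sequentially)
    then have "\<forall>\<^sub>F N in sequentially. K * real N powr (1 - 2/p) < \<delta>\<^sup>2"
      by (rule order_tendstoD(2)) (use \<delta> in simp)
    then show ?thesis by eventually_elim simp
  qed
  have ev2: "\<forall>\<^sub>F N in sequentially. \<mu> / \<kappa> \<le> real N"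
    by (rule eventually_at_top_linorderI[of "nat \<lceil>\<mu> / \<kappa>\<rceil>"]) linarith
  have "\<forall>\<^sub>F N in sequentially. holds_except (quad_above p N (?c * real N powr (1/q))) ((2 * C1 + 2 * C2 + C3 + 4 * C4) / real N)"
    using ev ev2 eventually_ge_at_top[of 2]
  proof eventually_elim
    case (elim N)
    note big = elim(1) elim(2) and N = elim(3)
    define n where "n = real N powr (1/q)"
    have n: "n > 0" "n powr q = real N" using N q1 by (simp_all add: n_def powr_powr)
    define J where "J = {2..N}"
    have J: "finite J" "J \<subseteq> {1..}" "J \<noteq> {}" "1 \<notin> J" using N by (auto simp: J_def)
    have cJ: "real (card J) = real N - 1" using N by (simp add: J_def of_nat_diff)
    define w where "w j \<omega> = (g 1 j \<omega> + g j 1 \<omega>) / sqrt 2" for j \<omega>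
    interpret W: iid_std_normal M w J
      unfolding w_def using J by (intro symmetric_row_iid) auto
    interpret R: iid_std_normal M "g (N+1)" J by (rule row_iid) (use J in auto)
    interpret D: iid_std_normal M "g 1" "{1}" by (rule row_iid) auto
    \<comment> \<open>A deterministic set that contains the random vector \<open>y\<close> with high
      probability. The minor is bounded uniformly on \<open>V\<close>, so the randomness of
      \<open>y\<close> requires no conditioning.\<close>
    define V where "V = {v. (\<Sum>j\<in>J. \<bar>v j\<bar> powr p) = 1 \<and> L2_set v J \<le> \<delta>}"
    have inv: "1 / (real N - 1) \<le> 2 / real N" using N by (simp add: field_simps)
    have E1: "holds_except (\<lambda>\<omega>. \<bar>(\<Sum>j\<in>J. \<bar>w j \<omega>\<bar> powr q) - (real N - 1) * \<mu>\<bar> < \<kappa> * (real N - 1)) (2 * C1 / real N)"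
    proof (rule holds_except_mono)
      show "holds_except (\<lambda>\<omega>. \<bar>(\<Sum>j\<in>J. \<bar>w j \<omega>\<bar> powr q) - real (card J) * abs_moment q\<bar> < \<kappa> * real (card J))
          (abs_moment (2*q) / (\<kappa>\<^sup>2 * real (card J)))"
        using J \<kappa> q1 by (intro W.holds_except_abs_powr_sum) auto
      show "abs_moment (2*q) / (\<kappa>\<^sup>2 * real (card J)) \<le> 2 * C1 / real N"
        using mult_left_mono[OF inv, of C1] abs_moment_nonneg[of "2*q"] by (simp add: C1_def cJ mult.commute)
    qed (simp add: cJ \<mu>_def)
    have E2: "holds_except (\<lambda>\<omega>. \<bar>(\<Sum>j\<in>J. \<bar>w j \<omega>\<bar> powr (2*q - 2)) - (real N - 1) * \<mu>'\<bar> < 1 * (real N - 1)) (2 * C2 / real N)"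
    proof (rule holds_except_mono)
      show "holds_except (\<lambda>\<omega>. \<bar>(\<Sum>j\<in>J. \<bar>w j \<omega>\<bar> powr (2*q - 2)) - real (card J) * abs_moment (2*q - 2)\<bar> < 1 * real (card J))
          (abs_moment (2*(2*q - 2)) / (1\<^sup>2 * real (card J)))"
        using J q1 by (intro W.holds_except_abs_powr_sum) auto
      show "abs_moment (2*(2*q - 2)) / (1\<^sup>2 * real (card J)) \<le> 2 * C2 / real N"
        using mult_left_mono[OF inv, of C2] abs_moment_nonneg[of "2*(2*q-2)"] by (simp add: C2_def cJ mult.commute)
    qed (simp add: cJ \<mu>'_def)
    have E3: "holds_except (\<lambda>\<omega>. \<bar>g 1 1 \<omega>\<bar> < \<eta> * n) (C3 / real N)"
    proof (rule holds_except_mono)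
      show "holds_except (\<lambda>\<omega>. \<forall>j\<in>{1}. \<bar>g 1 j \<omega>\<bar> < \<eta> * n) (real (card {1::nat}) * abs_moment q / (\<eta> * n) powr q)"
        using \<eta> n q1 by (intro D.holds_except_abs_less) auto
      show "real (card {1::nat}) * abs_moment q / (\<eta> * n) powr q \<le> C3 / real N"
        using \<eta> n by (simp add: C3_def powr_mult)
    qed simp
    have "holds_except (\<lambda>\<omega>. \<bar>(\<Sum>j\<in>J. \<bar>g (N+1) j \<omega>\<bar> powr q) - real (card J) * abs_moment q\<bar> < 1 * real (card J))
          (abs_moment (2*q) / (1\<^sup>2 * real (card J)))"
      using J q1 by (intro R.holds_except_abs_powr_sum) auto
    then have E4': "holds_except (\<lambda>\<omega>. \<forall>v\<in>V. sqrt 2 * L2_set v J * inner_on J (\<lambda>j. g (N+1) j \<omega>) v \<le> \<eta> * n) (2 * C4 / real N)"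
    proof (rule holds_except_mono)
      show "abs_moment (2*q) / (1\<^sup>2 * real (card J)) \<le> 2 * C4 / real N"
        using mult_left_mono[OF inv, of C4] abs_moment_nonneg[of "2*q"] by (simp add: C4_def cJ mult.commute)
    next
      fix \<omega>
      assume A: "\<bar>(\<Sum>j\<in>J. \<bar>g (N+1) j \<omega>\<bar> powr q) - real (card J) * abs_moment q\<bar> < 1 * real (card J)"
      let ?h = "\<lambda>j. g (N+1) j \<omega>"
      let ?H = "(\<Sum>j\<in>J. \<bar>?h j\<bar> powr q) powr (1/q)"
      have "(\<Sum>j\<in>J. \<bar>?h j\<bar> powr q) \<le> (\<mu> + 1) * (real N - 1)"
        using A by (simp add: cJ \<mu>_def abs_less_iff algebra_simps)
      also have "\<dots> \<le> (\<mu> + 1) * real N" using \<mu> by (intro mult_left_mono) auto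
      finally have "?H \<le> ((\<mu> + 1) * real N) powr (1/q)"
        using q1 by (intro powr_mono2) (auto intro: sum_nonneg)
      also have "\<dots> = (\<mu> + 1) powr (1/q) * n" using \<mu> by (simp add: powr_mult n_def)
      finally have H: "?H \<le> (\<mu> + 1) powr (1/q) * n" .
      show "\<forall>v\<in>V. sqrt 2 * L2_set v J * inner_on J ?h v \<le> \<eta> * n"
      proof
        fix v assume v: "v \<in> V"
        have "inner_on J ?h v = (\<Sum>j\<in>J. v j * ?h j)" by (simp add: inner_on_def mult.commute)
        also have "\<dots> \<le> (\<Sum>j\<in>J. \<bar>v j\<bar> powr p) powr (1/p) * ?H"
          by (rule Holder_sum[OF p(1) q1 q J(1)])
        also have "\<dots> = ?H" using v by (simp add: V_def)
        finally have i: "inner_on J ?h v \<le> (\<mu> + 1) powr (1/q) * n" using H by simp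
        have "sqrt 2 * L2_set v J * inner_on J ?h v \<le> sqrt 2 * L2_set v J * ((\<mu> + 1) powr (1/q) * n)"
          using i by (intro mult_left_mono) auto
        also have "\<dots> \<le> sqrt 2 * \<delta> * ((\<mu> + 1) powr (1/q) * n)"
          using v n by (intro mult_right_mono mult_left_mono) (auto simp: V_def)
        also have "\<dots> = \<eta> * n" using \<mu> by (simp add: \<delta>_def field_simps)
        finally show "sqrt 2 * L2_set v J * inner_on J ?h v \<le> \<eta> * n" .
      qed
    qed
    have E4: "holds_except (\<lambda>\<omega>. \<forall>v\<in>V. (-1) * quad J (G \<omega>) v \<le> \<eta> * n) (2 * (2 * C4 / real N))"
      by (rule holds_except_quad_le[OF J(1,2) _ _ _ E4']) (auto simp: J_def)
    note E = holds_except_conj[OF holds_except_conj[OF E1 E2] holds_except_conj[OF E3 E4]]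
    show ?case
    proof (rule holds_except_mono[OF E])
      show "2 * C1 / real N + 2 * C2 / real N + (C3 / real N + 2 * (2 * C4 / real N)) \<le> (2 * C1 + 2 * C2 + C3 + 4 * C4) / real N"
        by (simp add: add_divide_distrib)
    next
      fix \<omega>
      assume A: "(\<bar>(\<Sum>j\<in>J. \<bar>w j \<omega>\<bar> powr q) - (real N - 1) * \<mu>\<bar> < \<kappa> * (real N - 1) \<and>
         \<bar>(\<Sum>j\<in>J. \<bar>w j \<omega>\<bar> powr (2*q - 2)) - (real N - 1) * \<mu>'\<bar> < 1 * (real N - 1)) \<and>
         \<bar>g 1 1 \<omega>\<bar> < \<eta> * n \<and> (\<forall>v\<in>V. (-1) * quad J (G \<omega>) v \<le> \<eta> * n)"
      define S where "S = (\<Sum>j\<in>J. \<bar>w j \<omega>\<bar> powr q)"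
      let ?a = "\<lambda>i j. g i j \<omega>"
      have S_ge: "S \<ge> (\<xi> - \<eta>) powr q * real N"
      proof -
        have "- (S - (real N - 1) * \<mu>) < \<kappa> * (real N - 1)" using A by (simp add: S_def abs_less_iff)
        moreover have "\<mu> \<le> \<kappa> * real N" using big(2) \<kappa> by (simp add: field_simps)
        moreover have "\<kappa> * 2 = \<mu> - (\<xi> - \<eta>) powr q" by (simp add: \<kappa>_def)
        then have "\<kappa> * 2 * real N = (\<mu> - (\<xi> - \<eta>) powr q) * real N" by simp
        ultimately show ?thesis using \<kappa> by (simp add: algebra_simps)
      qed
      have x0: "(\<xi> - \<eta>) powr q * real N > 0" using \<eta> N by simp
      have S0: "S > 0" using S_ge x0 by linarith
      have Sq: "(\<xi> - \<eta>) * n \<le> S powr (1/q)"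
      proof -
        have "(\<xi> - \<eta>) * n = ((\<xi> - \<eta>) powr q * real N) powr (1/q)"
          using \<eta> q1 by (simp add: powr_mult powr_powr n_def)
        also have "\<dots> \<le> S powr (1/q)" using S_ge x0 q1 by (intro powr_mono2) auto
        finally show ?thesis .
      qed
      obtain x y where xy: "(\<Sum>i=1..N. \<bar>x i\<bar> powr p) = 1" "(\<Sum>j=2..N. \<bar>y j\<bar> powr p) = 1"
        "(L2_set y {2..N})\<^sup>2 = (\<Sum>j=2..N. \<bar>w j \<omega>\<bar> powr (2*q - 2)) / S powr (2/p)"
        "quad {1..N} ?a x = 2 powr (-2/p) * (g 1 1 \<omega> + sqrt 2 * S powr (1/q) + quad {2..N} ?a y)"
      proof (rule quad_dual_vector[OF p(1) q _ _ _ S0])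
        show "1 \<le> N" using N by simp
        show "w j \<omega> = (?a 1 j + ?a j 1) / sqrt 2" for j by (simp add: w_def)
        show "S = (\<Sum>j=2..N. \<bar>w j \<omega>\<bar> powr q)" by (simp add: S_def J_def)
      qed
      have "(L2_set y J)\<^sup>2 \<le> (\<mu>' + 1) * real N / ((\<xi> - \<eta>) powr q * real N) powr (2/p)"
      proof -
        have "(\<Sum>j\<in>J. \<bar>w j \<omega>\<bar> powr (2*q - 2)) \<le> (\<mu>' + 1) * (real N - 1)"
        proof -
          have "(\<Sum>j\<in>J. \<bar>w j \<omega>\<bar> powr (2*q - 2)) - (real N - 1) * \<mu>' < 1 * (real N - 1)"
            using A unfolding abs_less_iff by blast
          then show ?thesis by (simp add: algebra_simps)
        qed
        also have "\<dots> \<le> (\<mu>' + 1) * real N" using abs_moment_nonneg[of "2*q-2"] by (intro mult_left_mono) (auto simp: \<mu>'_def)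
        finally show ?thesis
          unfolding J_def xy(3) using S_ge x0 p N abs_moment_nonneg[of "2*q-2"]
          by (intro frac_le powr_mono2) (auto simp: J_def \<mu>'_def intro: sum_nonneg)
      qed
      also have "\<dots> = K * (real N powr 1 / real N powr (2/p))"
        using N by (simp add: K_def powr_mult)
      also have "real N powr 1 / real N powr (2/p) = real N powr (1 - 2/p)" by (simp only: powr_diff)
      also have "K * real N powr (1 - 2/p) \<le> \<delta>\<^sup>2" by (rule big(1))
      finally have "L2_set y J \<le> \<delta>" using \<delta> by (simp add: power2_le_iff_abs_le)
      then have "y \<in> V" using xy(2) by (simp add: V_def J_def)
      then have Qy: "- (\<eta> * n) \<le> quad {2..N} ?a y" using A by (auto simp: J_def)
      have g11: "- (\<eta> * n) \<le> g 1 1 \<omega>" using A by linarith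
      have s2: "sqrt 2 * \<eta> \<le> 2 * \<eta>" using \<eta> real_sqrt_le_mono[of 2 4] by (intro mult_right_mono) auto
      have pw: "2 powr (-2/p) \<le> 1" using p powr_mono[of "-2/p" 0 2] by simp
      have a: "2 powr (-2/p) * sqrt 2 = 2 powr (1/2 - 2/p)"
        by (simp add: powr_half_sqrt[symmetric] powr_add[symmetric])
      have "2 powr (-2/p) * ((sqrt 2 + 2) * \<eta>) \<le> 1 * (4 * \<eta>)"
        using pw s2 \<eta> by (intro mult_mono) (auto simp: algebra_simps)
      then have z: "2 powr (-2/p) * ((sqrt 2 + 2) * \<eta>) \<le> \<epsilon>" using \<eta>(2) by linarith
      have "?c \<le> 2 powr (-2/p) * (sqrt 2 * \<xi>) - 2 powr (-2/p) * ((sqrt 2 + 2) * \<eta>)"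
        using z by (simp add: a[symmetric] mult.assoc)
      also have "\<dots> = 2 powr (-2/p) * (sqrt 2 * (\<xi> - \<eta>) - 2 * \<eta>)" by (simp add: algebra_simps)
      finally have "?c * n \<le> 2 powr (-2/p) * (sqrt 2 * (\<xi> - \<eta>) - 2 * \<eta>) * n"
        using n by (intro mult_right_mono) auto
      also have "\<dots> = 2 powr (-2/p) * (- (\<eta> * n) + sqrt 2 * ((\<xi> - \<eta>) * n) + - (\<eta> * n))" by (simp add: algebra_simps)
      also have "\<dots> \<le> quad {1..N} ?a x"
        unfolding xy(4) using g11 Sq Qy by (intro mult_left_mono add_mono) auto
      finally show "\<exists>x. (\<Sum>i=1..N. \<bar>x i\<bar> powr p) = 1 \<and> ?c * real N powr (1/q) \<le> quad {1..N} ?a x"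
        using xy(1) by (auto simp: n_def)
    qed
  qed
  then show ?thesis unfolding \<xi>_def \<mu>_def by blast
qed

end

subsection \<open>The lower bound for \<open>p = 2\<close>\<close>

context gaussian_matrix
begin

text \<open>One step of the recursion: maximising over the first coordinate leaves the quadratic form of
  the minor plus a rank-one perturbation along the (independent) first row, whose direction may be
  replaced by any other one by rotation invariance.\<close>

lemma prob_rank_one_step:
  assumes m: "m < N" and D: "D > 0" "D = T + s - c"
    and h: "holds_except (\<lambda>\<omega>. - s < g (Suc m) (Suc m) \<omega> \<and>
      4 * b\<^sup>2 \<le> (\<Sum>j\<in>{Suc m<..N}. (g (Suc m) j \<omega> + g j (Suc m) \<omega>)\<^sup>2)) \<delta>"
    and b: "b > 0" and c': "c' = b\<^sup>2 / D"
    and IH: "\<And>u. inner_on {Suc m<..N} u u = 1 \<Longrightarrow>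
      prob {\<omega>\<in>space M. \<forall>x. quad {Suc m<..N} (G \<omega>) x + c' * (inner_on {Suc m<..N} u x)\<^sup>2 \<le> T * inner_on {Suc m<..N} x x} \<le> \<beta>"
    and \<beta>: "\<beta> \<ge> 0"
  shows "prob {\<omega>\<in>space M. \<forall>x. quad {m<..N} (G \<omega>) x + c * (x (Suc m))\<^sup>2 \<le> T * inner_on {m<..N} x x} \<le> \<delta> + \<beta>"
proof -
  define J where "J = {Suc m<..N}"
  define r where "r = Suc m"
  have J: "finite J" "r \<notin> J" "J \<subseteq> {1..}" "r \<ge> 1" by (auto simp: J_def r_def)
  have ins: "{m<..N} = insert r J" using m by (auto simp: J_def r_def)
  define IA where "IA = {r} \<times> J \<union> J \<times> {r}"
  define IB where "IB = J \<times> J"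
  let ?PA = "PiM IA (\<lambda>_. borel :: real measure)" and ?PB = "PiM IB (\<lambda>_. borel :: real measure)"
  define W where "W z = (\<Sum>j\<in>J. (z (r,j) + z (j,r))\<^sup>2)" for z :: "nat \<times> nat \<Rightarrow> real"
  define L where "L z x = (\<Sum>j\<in>J. (z (r,j) + z (j,r)) * x j)" for z :: "nat \<times> nat \<Rightarrow> real" and x
  \<comment> \<open>The inequality for the minor multiplied by the squared length \<open>W\<close>
    of the symmetrised row. Without the division it is polynomial in the entries, hence measurable
    and continuous in \<open>x\<close>.\<close>
  define F where "F x p = W (fst p) * (quad J (\<lambda>i j. snd p (i,j)) x - T * inner_on J x x) + c' * (L (fst p) x)\<^sup>2" for x p
  define Q where "Q = {p\<in>space (?PA \<Otimes>\<^sub>M ?PB). 4 * b\<^sup>2 \<le> W (fst p) \<and> (\<forall>x\<in>UNIV. F x p \<le> 0)}"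
  have mA: "(\<lambda>p. fst p k) \<in> borel_measurable (?PA \<Otimes>\<^sub>M ?PB)" if "k \<in> IA" for k
    using measurable_comp[OF measurable_fst measurable_component_singleton[OF that]] by (simp add: comp_def)
  have mB: "(\<lambda>p. snd p k) \<in> borel_measurable (?PA \<Otimes>\<^sub>M ?PB)" if "k \<in> IB" for k
    using measurable_comp[OF measurable_snd measurable_component_singleton[OF that]] by (simp add: comp_def)
  note ms = borel_measurable_sum borel_measurable_add borel_measurable_times borel_measurable_power
    borel_measurable_diff borel_measurable_const
  have W_meas: "(\<lambda>p. W (fst p)) \<in> borel_measurable (?PA \<Otimes>\<^sub>M ?PB)"
    unfolding W_def by (intro ms mA) (auto simp: IA_def)
  have F_meas: "F x \<in> borel_measurable (?PA \<Otimes>\<^sub>M ?PB)" for x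
    unfolding F_def L_def quad_def by (intro ms mA mB W_meas) (auto simp: IA_def IB_def)
  have F_cont: "continuous_on UNIV (\<lambda>x. F x p)" for p
    unfolding F_def L_def inner_on_def by (intro continuous_intros)
  have Q: "Q \<in> sets (?PA \<Otimes>\<^sub>M ?PB)"
    unfolding Q_def
    by (intro sets.sets_Collect_conj sets_Collect_ball_separable F_cont F_meas borel_measurable_le W_meas borel_measurable_const)
  let ?X = "\<lambda>(i, j). g i j"
  let ?XA = "\<lambda>\<omega>. \<lambda>k\<in>IA. ?X k \<omega>" and ?XB = "\<lambda>\<omega>. \<lambda>k\<in>IB. ?X k \<omega>"
  have bpos: "4 * b\<^sup>2 > 0" using b by simp
  have c'0: "c' > 0" using b D c' by simp
  have sec: "prob {\<omega>\<in>space M. (?XA \<omega>, ?XB \<omega>) \<in> Q} \<le> \<beta>"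
  proof (rule prob_le_section[OF _ _ _ Q])
    show "IA \<subseteq> {1..} \<times> {1..}" "IB \<subseteq> {1..} \<times> {1..}" "IA \<inter> IB = {}" using J by (auto simp: IA_def IB_def)
    fix z :: "nat \<times> nat \<Rightarrow> real" assume z: "z \<in> space ?PA"
    show "prob {\<omega>\<in>space M. (z, ?XB \<omega>) \<in> Q} \<le> \<beta>"
    proof (cases "4 * b\<^sup>2 \<le> W z")
      case False
      then have "{\<omega>\<in>space M. (z, ?XB \<omega>) \<in> Q} = {}" by (auto simp: Q_def)
      then show ?thesis using \<beta> by (simp only: measure_empty)
    next
      case True
      then have Wz: "W z > 0" using bpos by linarith
      \<comment> \<open>With the row frozen, its direction is a fixed unit vector, to which the
        hypothesis on the minor applies.\<close>
      define u where "u j = (z (r,j) + z (j,r)) / sqrt (W z)" for j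
      have u1: "inner_on J u u = 1"
        using Wz by (simp add: inner_on_def u_def power2_eq_square[symmetric] power_divide sum_divide_distrib[symmetric] W_def)
      have uL: "inner_on J u x = L z x / sqrt (W z)" for x
        by (simp add: inner_on_def u_def L_def sum_divide_distrib)
      have "{\<omega>\<in>space M. (z, ?XB \<omega>) \<in> Q} \<subseteq>
        {\<omega>\<in>space M. \<forall>x. quad J (G \<omega>) x + c' * (inner_on J u x)\<^sup>2 \<le> T * inner_on J x x}"
      proof safe
        fix \<omega> x assume "\<omega> \<in> space M" "(z, ?XB \<omega>) \<in> Q"
        then have "F x (z, ?XB \<omega>) \<le> 0" by (simp add: Q_def)
        moreover have "quad J (\<lambda>i j. ?XB \<omega> (i,j)) x = quad J (G \<omega>) x"
          unfolding quad_def by (intro sum.cong refl) (simp add: IB_def)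
        ultimately have "W z * (quad J (G \<omega>) x - T * inner_on J x x) + c' * (L z x)\<^sup>2 \<le> 0"
          by (simp add: F_def)
        then have "(W z * (quad J (G \<omega>) x - T * inner_on J x x) + c' * (L z x)\<^sup>2) / W z \<le> 0"
          using Wz by (simp add: divide_nonpos_pos)
        then show "quad J (G \<omega>) x + c' * (inner_on J u x)\<^sup>2 \<le> T * inner_on J x x"
          using Wz by (simp add: uL power_divide add_divide_distrib)
      qed
      moreover have "{\<omega>\<in>space M. \<forall>x\<in>UNIV. quad J (G \<omega>) x + c' * (inner_on J u x)\<^sup>2 - T * inner_on J x x \<le> 0} \<in> events"
      proof (rule sets_Collect_ball_separable)
        show "continuous_on UNIV (\<lambda>x. quad J (G \<omega>) x + c' * (inner_on J u x)\<^sup>2 - T * inner_on J x x)" for \<omega>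
          unfolding inner_on_def by (intro continuous_intros)
        show "(\<lambda>\<omega>. quad J (G \<omega>) x + c' * (inner_on J u x)\<^sup>2 - T * inner_on J x x) \<in> borel_measurable M" for x
          by (intro ms quad_measurable J)
      qed
      ultimately have "prob {\<omega>\<in>space M. (z, ?XB \<omega>) \<in> Q} \<le>
        prob {\<omega>\<in>space M. \<forall>x. quad J (G \<omega>) x + c' * (inner_on J u x)\<^sup>2 \<le> T * inner_on J x x}"
        by (intro finite_measure_mono) auto
      also have "\<dots> \<le> \<beta>" using IH[of u] u1 by (simp add: J_def)
      finally show ?thesis .
    qed
  qed
  have "holds_except (\<lambda>\<omega>. - s < g r r \<omega> \<and> 4 * b\<^sup>2 \<le> (\<Sum>j\<in>J. (g r j \<omega> + g j r \<omega>)\<^sup>2)) \<delta>"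
    using h by (simp only: J_def r_def)
  then obtain A where A: "A \<in> events" "prob A \<le> \<delta>"
    and A'': "\<forall>\<omega>\<in>space M - A. - s < g r r \<omega> \<and> 4 * b\<^sup>2 \<le> (\<Sum>j\<in>J. (g r j \<omega> + g j r \<omega>)\<^sup>2)"
    unfolding holds_except_def by (elim bexE conjE)
  note A' = bspec[OF A'']
  have mXA: "?XA \<in> measurable M ?PA" and mXB: "?XB \<in> measurable M ?PB"
    using J by (intro measurable_restrict X_measurable; auto simp: IA_def IB_def)+
  have EvQ: "{\<omega>\<in>space M. (?XA \<omega>, ?XB \<omega>) \<in> Q} \<in> events"
    using measurable_sets[OF measurable_Pair[OF mXA mXB] Q] by (simp add: vimage_def Int_def conj_commute)
  let ?E = "{\<omega>\<in>space M. \<forall>x. quad {m<..N} (G \<omega>) x + c * (x (Suc m))\<^sup>2 \<le> T * inner_on {m<..N} x x}"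
  have "?E \<subseteq> A \<union> {\<omega>\<in>space M. (?XA \<omega>, ?XB \<omega>) \<in> Q}"
  proof
    fix \<omega> assume E: "\<omega> \<in> ?E"
    show "\<omega> \<in> A \<union> {\<omega>\<in>space M. (?XA \<omega>, ?XB \<omega>) \<in> Q}"
    proof (cases "\<omega> \<in> A")
      case False
      let ?a = "\<lambda>i j. g i j \<omega>"
      have sp: "\<omega> \<in> space M" using E by simp
      have a: "- s < g r r \<omega>" "4 * b\<^sup>2 \<le> (\<Sum>j\<in>J. (g r j \<omega> + g j r \<omega>)\<^sup>2)" using A'[of \<omega>] False sp by auto
      have WX: "W (?XA \<omega>) = (\<Sum>j\<in>J. (g r j \<omega> + g j r \<omega>)\<^sup>2)"
        unfolding W_def by (intro sum.cong refl) (auto simp: IA_def)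
      have LX: "L (?XA \<omega>) x = (\<Sum>j\<in>J. (g r j \<omega> + g j r \<omega>) * x j)" for x
        unfolding L_def by (intro sum.cong refl) (auto simp: IA_def)
      have QX: "quad J (\<lambda>i j. ?XB \<omega> (i,j)) x = quad J ?a x" for x
        unfolding quad_def by (intro sum.cong refl) (simp add: IB_def)
      have Fle: "F x (?XA \<omega>, ?XB \<omega>) \<le> 0" for x
      proof -
        define l where "l = L (?XA \<omega>) x"
        \<comment> \<open>The maximiser of \<open>t * l - D * t\<^sup>2\<close>, whose maximum is
          \<open>l\<^sup>2 / (4 * D)\<close>.\<close>
        define t where "t = l / (2 * D)"
        define y where "y = x(r := t)"
        have yJ: "y j = x j" if "j \<in> J" for j using that J by (auto simp: y_def)
        have yr: "y r = t" by (simp add: y_def)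
        have "quad (insert r J) ?a y + c * (y r)\<^sup>2 \<le> T * inner_on (insert r J) y y"
          using E unfolding ins r_def[symmetric] by blast
        moreover have "quad (insert r J) ?a y = g r r \<omega> * t\<^sup>2 + t * l + quad J ?a x"
        proof -
          have "(\<Sum>j\<in>J. (?a r j + ?a j r) * y j) = l" unfolding l_def LX by (intro sum.cong refl) (simp add: yJ)
          moreover have "quad J ?a y = quad J ?a x" unfolding quad_def by (intro sum.cong refl) (simp add: yJ)
          ultimately show ?thesis using J by (simp add: quad_insert yr)
        qed
        moreover have "inner_on (insert r J) y y = t\<^sup>2 + inner_on J x x"
        proof -
          have "inner_on (insert r J) y y = t\<^sup>2 + (\<Sum>j\<in>J. y j * y j)"
            unfolding inner_on_def using J by (simp add: yr power2_eq_square)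
          also have "(\<Sum>j\<in>J. y j * y j) = inner_on J x x" unfolding inner_on_def by (intro sum.cong refl) (simp add: yJ)
          finally show ?thesis .
        qed
        ultimately have 1: "g r r \<omega> * t\<^sup>2 + t * l + quad J ?a x + c * t\<^sup>2 \<le> T * t\<^sup>2 + T * inner_on J x x"
          by (simp add: yr distrib_left)
        have 2: "(T - g r r \<omega> - c) * t\<^sup>2 \<le> D * t\<^sup>2"
          using a D by (intro mult_right_mono) auto
        have 3: "t * l - D * t\<^sup>2 = l\<^sup>2 / (4 * D)"
          using D(1) by (simp add: t_def power2_eq_square field_simps)
        have 4: "quad J ?a x - T * inner_on J x x \<le> - (l\<^sup>2 / (4 * D))"
          using 1 2 3 by (simp add: algebra_simps)
        have W0: "W (?XA \<omega>) > 0" using a(2) bpos WX by linarith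
        \<comment> \<open>The row has squared length at least \<open>4 * b\<^sup>2\<close>, so
          \<open>l\<^sup>2 / (4 * D)\<close> is at least \<open>b\<^sup>2 / D\<close> times the
          squared inner product with its direction: the new weight \<open>c'\<close>.\<close>
        have "c' * l\<^sup>2 = 4 * b\<^sup>2 * (l\<^sup>2 / (4 * D))" using D(1) by (simp add: c')
        also have "\<dots> \<le> W (?XA \<omega>) * (l\<^sup>2 / (4 * D))"
          using a(2) WX D(1) by (intro mult_right_mono) auto
        also have "\<dots> \<le> - (W (?XA \<omega>) * (quad J ?a x - T * inner_on J x x))"
          using mult_left_mono[OF 4, of "W (?XA \<omega>)"] W0 by simp
        finally have "W (?XA \<omega>) * (quad J ?a x - T * inner_on J x x) + c' * l\<^sup>2 \<le> 0" by linarith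
        then show ?thesis unfolding F_def fst_conv snd_conv QX l_def .
      qed
      have "?XA \<omega> \<in> space ?PA" "?XB \<omega> \<in> space ?PB" by (auto simp: space_PiM)
      then have "(?XA \<omega>, ?XB \<omega>) \<in> Q"
        using a(2) WX Fle by (simp add: Q_def space_pair_measure)
      then show ?thesis using sp by simp
    qed simp
  qed
  then have "prob ?E \<le> prob (A \<union> {\<omega>\<in>space M. (?XA \<omega>, ?XB \<omega>) \<in> Q})"
    using A EvQ by (intro finite_measure_mono) auto
  also have "\<dots> \<le> prob A + prob {\<omega>\<in>space M. (?XA \<omega>, ?XB \<omega>) \<in> Q}"
    using A EvQ by (intro measure_Un_le) auto
  finally show ?thesis using A sec by linarith
qed

text \<open>Induction on a number \<open>l\<close> of steps that suffices to lift the weight from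
  \<open>c\<close> to \<open>\<theta> * b\<close>. Each step gains at least
  \<open>(1 - \<theta>\<^sup>2/4) / \<theta> * b\<close> and costs at most one \<delta>; at
  \<open>\<theta> * b = T + s\<close> a single diagonal entry refutes the inequality.\<close>

lemma prob_rank_one_perturbation:
  assumes b: "b > 0" and \<theta>: "0 < \<theta>" "\<theta> < 2" and T: "T + s = \<theta> * b" and k: "k < N"
    and h: "\<And>m. m \<le> k \<Longrightarrow> holds_except (\<lambda>\<omega>. - s < g (Suc m) (Suc m) \<omega> \<and>
      4 * b\<^sup>2 \<le> (\<Sum>j\<in>{Suc m<..N}. (g (Suc m) j \<omega> + g j (Suc m) \<omega>)\<^sup>2)) \<delta>"
  shows "l + m \<le> k \<Longrightarrow> 0 \<le> c \<Longrightarrow> \<theta> * b - c \<le> real l * ((1 - \<theta>\<^sup>2/4) / \<theta> * b) \<Longrightarrow> inner_on {m<..N} u u = 1 \<Longrightarrow>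
    prob {\<omega>\<in>space M. \<forall>x. quad {m<..N} (G \<omega>) x + c * (inner_on {m<..N} u x)\<^sup>2 \<le> T * inner_on {m<..N} x x}
      \<le> (real l + 1) * \<delta>"
proof (induction l arbitrary: m c u)
  case (0 m c u)
  note h0 = h[of m]
  define e where "e i = (if i = Suc m then 1 else 0 :: real)" for i
  have mN: "m < N" using 0 k by simp
  have ex: "inner_on {m<..N} e x = x (Suc m)" for x
    using mN by (simp add: inner_on_def e_def if_distrib[of "\<lambda>z. z * _"] sum.delta cong: if_cong)
  have ee: "inner_on {m<..N} e e = 1" unfolding ex by (simp add: e_def)
  obtain A where A: "A \<in> events" "prob A \<le> \<delta>" and A': "\<And>\<omega>. \<omega> \<in> space M - A \<Longrightarrow> - s < g (Suc m) (Suc m) \<omega>"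
    using h0 0 unfolding holds_except_def by auto
  have "prob {\<omega>\<in>space M. \<forall>x. quad {m<..N} (G \<omega>) x + c * (inner_on {m<..N} u x)\<^sup>2 \<le> T * inner_on {m<..N} x x}
    = prob {\<omega>\<in>space M. \<forall>x. quad {m<..N} (G \<omega>) x + c * (inner_on {m<..N} e x)\<^sup>2 \<le> T * inner_on {m<..N} x x}"
    by (rule prob_quad_rotation[where m=N, OF _ 0(4) ee]) auto
  also have "\<dots> \<le> prob A"
  proof (rule finite_measure_mono[OF _ A(1)], rule subsetI, rule ccontr)
    fix \<omega> assume w: "\<omega> \<in> {\<omega>\<in>space M. \<forall>x. quad {m<..N} (G \<omega>) x + c * (inner_on {m<..N} e x)\<^sup>2 \<le> T * inner_on {m<..N} x x}"
      and "\<omega> \<notin> A"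
    then have g: "- s < g (Suc m) (Suc m) \<omega>" using A' by auto
    \<comment> \<open>Tested at the first basis vector, the inequality reads
      \<open>g (Suc m) (Suc m) \<omega> + c \<le> T\<close>, which contradicts
      \<open>c \<ge> T + s\<close> and the lower bound on the entry.\<close>
    have "quad {m<..N} (G \<omega>) e + c * (inner_on {m<..N} e e)\<^sup>2 \<le> T * inner_on {m<..N} e e"
      using w by blast
    moreover have "quad {m<..N} (G \<omega>) e = g (Suc m) (Suc m) \<omega>"
    proof -
      have ins: "{m<..N} = insert (Suc m) {Suc m<..N}" using mN by auto
      have "quad {Suc m<..N} (G \<omega>) e = 0" unfolding quad_def by (intro sum.neutral ballI) (auto simp: e_def)
      moreover have "(\<Sum>j\<in>{Suc m<..N}. (g (Suc m) j \<omega> + g j (Suc m) \<omega>) * e j) = 0" by (intro sum.neutral) (auto simp: e_def)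
      ultimately show ?thesis unfolding ins by (subst quad_insert) (auto simp: e_def)
    qed
    ultimately have "g (Suc m) (Suc m) \<omega> + c \<le> T" using ee by simp
    then show False using g T 0(3) by simp
  qed
  finally show ?case using A(2) by simp
next
  case (Suc l m c u)
  define e where "e i = (if i = Suc m then 1 else 0 :: real)" for i
  have mN: "m < N" using Suc k by simp
  have ex: "inner_on {m<..N} e x = x (Suc m)" for x
    using mN by (simp add: inner_on_def e_def if_distrib[of "\<lambda>z. z * _"] sum.delta cong: if_cong)
  have ee: "inner_on {m<..N} e e = 1" unfolding ex by (simp add: e_def)
  have \<delta>0: "\<delta> \<ge> 0"
    using h[of 0] unfolding holds_except_def by (meson measure_nonneg order_trans zero_le)
  define \<eta> where "\<eta> = (1 - \<theta>\<^sup>2/4) / \<theta>"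
  have \<eta>: "\<eta> \<ge> 0"
  proof -
    have "\<theta>\<^sup>2 \<le> 2\<^sup>2" using \<theta> by (intro power_mono) auto
    then show ?thesis using \<theta> by (simp add: \<eta>_def)
  qed
  show ?case
  \<comment> \<open>If the weight has already reached \<open>\<theta> * b\<close>, then
    \<open>D\<close> would not be positive and no elimination is made; the same \<open>m\<close> and
    \<open>c\<close> satisfy the induction hypothesis.\<close>
  proof (cases "\<theta> * b \<le> c")
    case True
    have "prob {\<omega>\<in>space M. \<forall>x. quad {m<..N} (G \<omega>) x + c * (inner_on {m<..N} u x)\<^sup>2 \<le> T * inner_on {m<..N} x x}
      \<le> (real l + 1) * \<delta>"
    proof (rule Suc.IH)
      have "0 \<le> real l * ((1 - \<theta>\<^sup>2/4) / \<theta> * b)" using \<eta> b by (simp add: \<eta>_def[symmetric])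
      then show "\<theta> * b - c \<le> real l * ((1 - \<theta>\<^sup>2/4) / \<theta> * b)" using True by linarith
    qed (use Suc in auto)
    also have "\<dots> \<le> (real (Suc l) + 1) * \<delta>" using \<delta>0 by (intro mult_right_mono) auto
    finally show ?thesis .
  next
    case False
    define D where "D = \<theta> * b - c"
    have D: "D > 0" "D \<le> \<theta> * b" using False Suc.prems(2) by (auto simp: D_def)
    define c' where "c' = b\<^sup>2 / D"
    \<comment> \<open>The product \<open>(\<theta> * b - D) * D\<close> peaks at
      \<open>\<theta>\<^sup>2 * b\<^sup>2 / 4\<close>, which stays below \<open>b\<^sup>2\<close> as
      \<theta> < 2. The missing part is the gain per step, estimated with
      \<open>D \<le> \<theta> * b\<close>.\<close>
    have c'_ge: "c + \<eta> * b \<le> c'"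
    proof -
      have "(\<theta> * b - D) * D \<le> \<theta>\<^sup>2 / 4 * b\<^sup>2"
        using zero_le_power2[of "\<theta> * b / 2 - D"] by (simp add: power2_eq_square algebra_simps)
      moreover have "\<eta> * b * D \<le> \<eta> * b * (\<theta> * b)" using \<eta> b D by (intro mult_left_mono) auto
      moreover have "\<eta> * b * (\<theta> * b) = (1 - \<theta>\<^sup>2/4) * b\<^sup>2" using \<theta> by (simp add: \<eta>_def power2_eq_square)
      ultimately have "(\<theta> * b - D) * D + \<eta> * b * D \<le> b\<^sup>2" by (simp add: algebra_simps)
      then have "(c + \<eta> * b) * D \<le> b\<^sup>2" by (simp add: D_def algebra_simps)
      then show ?thesis using D by (simp add: c'_def pos_le_divide_eq)
    qed
    have "prob {\<omega>\<in>space M. \<forall>x. quad {m<..N} (G \<omega>) x + c * (inner_on {m<..N} u x)\<^sup>2 \<le> T * inner_on {m<..N} x x}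
      = prob {\<omega>\<in>space M. \<forall>x. quad {m<..N} (G \<omega>) x + c * (inner_on {m<..N} e x)\<^sup>2 \<le> T * inner_on {m<..N} x x}"
      by (rule prob_quad_rotation[where m=N, OF _ Suc.prems(4) ee]) auto
    also have "\<dots> \<le> \<delta> + (real l + 1) * \<delta>"
      unfolding ex
    proof (rule prob_rank_one_step[OF mN D(1) _ h b c'_def])
      show "D = T + s - c" using T by (simp add: D_def)
      show "m \<le> k" using Suc.prems(1) by simp
      show "0 \<le> (real l + 1) * \<delta>" using \<delta>0 by simp
      show "prob {\<omega>\<in>space M. \<forall>x. quad {Suc m<..N} (G \<omega>) x + c' * (inner_on {Suc m<..N} u x)\<^sup>2 \<le> T * inner_on {Suc m<..N} x x}
         \<le> (real l + 1) * \<delta>" if "inner_on {Suc m<..N} u u = 1" for u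
      proof (rule Suc.IH[OF _ _ _ that])
        show "l + Suc m \<le> k" using Suc.prems(1) by simp
        show "0 \<le> c'" using D by (simp add: c'_def)
        show "\<theta> * b - c' \<le> real l * ((1 - \<theta>\<^sup>2/4) / \<theta> * b)"
          using c'_ge Suc.prems(3) unfolding \<eta>_def[symmetric] by (simp add: algebra_simps)
      qed
    qed
    finally show ?thesis by (simp add: algebra_simps)
  qed
qed

end

context gaussian_matrix
begin

text \<open>All scales are proportional to \<open>sqrt N\<close>, so \<theta> and the number
  \<open>k\<close> of eliminations are constants. Starting from weight 0, the form fails to stay
  below \<open>T \<bar>x\<bar>\<^sup>2\<close> outside an event of probability O(1/N).\<close>

lemma quad_lower_two:
  assumes \<epsilon>: "\<epsilon> > 0"
  shows "\<exists>C. \<forall>\<^sub>F N in sequentially. holds_except (quad_above 2 N ((sqrt 2 - \<epsilon>) * sqrt (real N))) (C / real N)"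
proof -
  define \<eta> where "\<eta> = min 1 \<epsilon>"
  have \<eta>: "\<eta> > 0" "\<eta> \<le> 1" "\<eta> \<le> \<epsilon>" using \<epsilon> by (auto simp: \<eta>_def)
  \<comment> \<open>A slack in \<open>b = \<rho> * sqrt (N / 2)\<close>: the squared length of a
    symmetrised row, about \<open>2 * N\<close>, then exceeds \<open>4 * b\<^sup>2\<close> even
    after \<open>k\<close> coordinates are gone.\<close>
  define \<rho> where "\<rho> = 1 - \<eta>/4"
  have \<rho>: "\<rho> > 0" "\<rho> < 1" using \<eta> by (auto simp: \<rho>_def)
  \<comment> \<open>The ratio of \<open>T + s\<close> to \<open>b\<close>, where \<open>T\<close>
    gives up \<eta> and \<open>s\<close> recovers \<eta>/4 in units of \<open>sqrt N\<close>. The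
    slack in \<rho> is small enough to keep it below 2.\<close>
  define \<theta> where "\<theta> = (sqrt 2 - 3/4 * \<eta>) * sqrt 2 / \<rho>"
  have s2: "sqrt 2 \<ge> 1" "sqrt 2 \<le> 2" using real_sqrt_le_mono[of 2 4] by auto
  have num: "(sqrt 2 - 3/4 * \<eta>) * sqrt 2 = 2 - 3/4 * (sqrt 2 * \<eta>)" by (simp add: algebra_simps)
  have \<theta>: "0 < \<theta>" "\<theta> < 2"
  proof -
    have "sqrt 2 - 3/4 * \<eta> > 0" using s2 \<eta> by linarith
    then show "0 < \<theta>" using \<rho> by (simp add: \<theta>_def)
    define z where "z = sqrt 2 * \<eta>"
    have "1 * \<eta> \<le> z" unfolding z_def using s2 \<eta> by (intro mult_right_mono) auto
    then have "2 - 3/4 * z < 2 - \<eta> / 2" using \<eta>(1) by (simp add: field_simps)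
    moreover have "2 * \<rho> = 2 - \<eta> / 2" by (simp add: \<rho>_def)
    ultimately have "(sqrt 2 - 3/4 * \<eta>) * sqrt 2 < 2 * \<rho>" unfolding num z_def[symmetric] by simp
    then show "\<theta> < 2" using \<rho> by (simp add: \<theta>_def pos_divide_less_eq)
  qed
  define h where "h = (1 - \<theta>\<^sup>2/4) / \<theta>"
  have h: "h > 0"
  proof -
    have "\<theta>\<^sup>2 < 2\<^sup>2" using \<theta> by (intro power_strict_mono) auto
    then show ?thesis using \<theta> by (simp add: h_def)
  qed
  define k where "k = nat \<lceil>\<theta> / h\<rceil>"
  have k: "\<theta> \<le> real k * h"
  proof -
    have "\<theta> / h \<le> real k" unfolding k_def by linarith
    then show ?thesis using h by (simp add: pos_divide_le_eq)
  qed
  \<comment> \<open>Puts \<open>1 - \<kappa>\<close> midway between \<open>\<rho>\<^sup>2\<close>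
    and 1, leaving room both for the deviation and for the lost coordinates.\<close>
  define \<kappa> where "\<kappa> = (1 - \<rho>\<^sup>2) / 2"
  have \<rho>2: "\<rho>\<^sup>2 < 1" using \<rho> by (simp add: power_less_one_iff)
  have \<kappa>: "\<kappa> > 0" "1 - \<kappa> > \<rho>\<^sup>2" "\<kappa> < 1" using \<rho>2 by (auto simp: \<kappa>_def field_simps add_pos_nonneg)
  define C1 where "C1 = 16 / \<eta>\<^sup>2 + 2 * abs_moment 4 / \<kappa>\<^sup>2"
  have lim: "(\<lambda>N. (1 - \<kappa>) * (real N - real k - 1) / real N) \<longlonglongrightarrow> 1 - \<kappa>" by real_asymp
  have "\<forall>\<^sub>F N in sequentially. \<rho>\<^sup>2 < (1 - \<kappa>) * (real N - real k - 1) / real N"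
    by (rule order_tendstoD(1)[OF lim \<kappa>(2)])
  then have "\<forall>\<^sub>F N in sequentially. holds_except (quad_above 2 N ((sqrt 2 - \<epsilon>) * sqrt (real N))) ((real k + 1) * C1 / real N)"
    using eventually_ge_at_top[of "2 * k + 2"]
  proof eventually_elim
    case (elim N)
    have N: "N > 0" "k < N" "real N > 0" using elim(2) by auto
    define T where "T = (sqrt 2 - \<eta>) * sqrt (real N)"
    define s where "s = \<eta>/4 * sqrt (real N)"
    define b where "b = \<rho> * sqrt (real N / 2)"
    have b: "b > 0" using \<rho> N by (simp add: b_def)
    have Ts: "T + s = \<theta> * b"
    proof -
      have "\<theta> * b = (sqrt 2 - 3/4 * \<eta>) * (sqrt 2 * sqrt (real N / 2))" using \<rho> by (simp add: \<theta>_def b_def)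
      also have "sqrt 2 * sqrt (real N / 2) = sqrt (real N)" by (simp add: real_sqrt_mult[symmetric])
      finally show ?thesis by (simp add: T_def s_def algebra_simps)
    qed
    have b2: "4 * b\<^sup>2 = 2 * (\<rho>\<^sup>2 * real N)" by (simp add: b_def power_mult_distrib)
    have row: "holds_except (\<lambda>\<omega>. - s < g (Suc m) (Suc m) \<omega> \<and>
      4 * b\<^sup>2 \<le> (\<Sum>j\<in>{Suc m<..N}. (g (Suc m) j \<omega> + g j (Suc m) \<omega>)\<^sup>2)) (C1 / real N)" if m: "m \<le> k" for m
    proof -
      define J where "J = {Suc m<..N}"
      have J: "finite J" "J \<subseteq> {1..}" "Suc m \<notin> J" "J \<noteq> {}" using m elim(2) by (auto simp: J_def)
      have cJ: "real (card J) = real N - real m - 1" using m N by (simp add: J_def of_nat_diff)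
      define w where "w j \<omega> = (g (Suc m) j \<omega> + g j (Suc m) \<omega>) / sqrt 2" for j \<omega>
      interpret W: iid_std_normal M w J unfolding w_def using J by (intro symmetric_row_iid) auto
      interpret D: iid_std_normal M "g (Suc m)" "{Suc m}" by (rule row_iid) auto
      have cJ2: "real (card J) \<ge> real N / 2" using m elim(2) unfolding cJ by linarith
      have E1: "holds_except (\<lambda>\<omega>. \<bar>(\<Sum>j\<in>J. \<bar>w j \<omega>\<bar> powr 2) - real (card J) * abs_moment 2\<bar> < \<kappa> * real (card J))
          (abs_moment (2*2) / (\<kappa>\<^sup>2 * real (card J)))"
        using J \<kappa> by (intro W.holds_except_abs_powr_sum) auto
      have E2: "holds_except (\<lambda>\<omega>. \<forall>j\<in>{Suc m}. \<bar>g (Suc m) j \<omega>\<bar> < s) (real (card {Suc m}) * abs_moment 2 / s powr 2)"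
        using \<eta> N by (intro D.holds_except_abs_less) (auto simp: s_def)
      show ?thesis
      proof (rule holds_except_mono[OF holds_except_conj[OF E1 E2]])
        have "abs_moment 4 / (\<kappa>\<^sup>2 * real (card J)) \<le> abs_moment 4 / (\<kappa>\<^sup>2 * (real N / 2))"
          using cJ2 \<kappa> N abs_moment_nonneg[of 4] by (intro divide_left_mono mult_left_mono) auto
        then have "abs_moment 4 / (\<kappa>\<^sup>2 * real (card J)) \<le> 2 * abs_moment 4 / \<kappa>\<^sup>2 / real N" by (simp add: mult.commute)
        moreover have "1 / s powr 2 = 16 / \<eta>\<^sup>2 / real N"
          using \<eta> N by (simp add: s_def power_mult_distrib power_divide)
        ultimately show "abs_moment (2*2) / (\<kappa>\<^sup>2 * real (card J)) + real (card {Suc m}) * abs_moment 2 / s powr 2 \<le> C1 / real N"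
          by (simp add: C1_def abs_moment_2 add_divide_distrib)
      next
        fix \<omega>
        assume A: "\<bar>(\<Sum>j\<in>J. \<bar>w j \<omega>\<bar> powr 2) - real (card J) * abs_moment 2\<bar> < \<kappa> * real (card J) \<and> (\<forall>j\<in>{Suc m}. \<bar>g (Suc m) j \<omega>\<bar> < s)"
        then have "real (card J) - (\<Sum>j\<in>J. (w j \<omega>)\<^sup>2) < \<kappa> * real (card J)"
          by (simp add: abs_moment_2 abs_less_iff)
        then have "(1 - \<kappa>) * real (card J) \<le> (\<Sum>j\<in>J. (w j \<omega>)\<^sup>2)" by (simp add: algebra_simps)
        moreover have "(1 - \<kappa>) * (real N - real k - 1) \<le> (1 - \<kappa>) * real (card J)"
          using m \<kappa> unfolding cJ by (intro mult_left_mono) auto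
        moreover have "\<rho>\<^sup>2 * real N < (1 - \<kappa>) * (real N - real k - 1)"
          using elim(1) N by (simp add: pos_less_divide_eq)
        ultimately have "4 * b\<^sup>2 \<le> 2 * (\<Sum>j\<in>J. (w j \<omega>)\<^sup>2)" unfolding b2 by linarith
        also have "\<dots> = (\<Sum>j\<in>J. (g (Suc m) j \<omega> + g j (Suc m) \<omega>)\<^sup>2)"
          by (simp add: sum_distrib_left w_def power_divide)
        finally show "- s < g (Suc m) (Suc m) \<omega> \<and> 4 * b\<^sup>2 \<le> (\<Sum>j\<in>{Suc m<..N}. (g (Suc m) j \<omega> + g j (Suc m) \<omega>)\<^sup>2)"
          using A by (auto simp: J_def abs_less_iff)
      qed
    qed
    define e where "e i = (if i = 1 then 1 else 0 :: real)" for i :: nat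
    have e1: "inner_on {0<..N} e e = 1"
      using N by (simp add: inner_on_def e_def if_distrib[of "\<lambda>z. z * _"] sum.delta cong: if_cong)
    have "prob {\<omega>\<in>space M. \<forall>x. quad {0<..N} (G \<omega>) x + 0 * (inner_on {0<..N} e x)\<^sup>2 \<le> T * inner_on {0<..N} x x}
      \<le> (real k + 1) * (C1 / real N)"
    proof (rule prob_rank_one_perturbation[OF b \<theta> Ts N(2) row])
      show "\<theta> * b - 0 \<le> real k * ((1 - \<theta>\<^sup>2/4) / \<theta> * b)"
        using mult_right_mono[OF k, of b] b by (simp add: h_def)
    qed (use e1 in auto)
    moreover have io: "{0<..N} = {1..N}" by auto
    ultimately have pr: "prob {\<omega>\<in>space M. \<forall>x\<in>UNIV. quad {1..N} (G \<omega>) x - T * inner_on {1..N} x x \<le> 0}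
      \<le> (real k + 1) * C1 / real N" by simp
    have ms: "{\<omega>\<in>space M. \<forall>x\<in>UNIV. quad {1..N} (G \<omega>) x - T * inner_on {1..N} x x \<le> 0} \<in> events"
    proof (rule sets_Collect_ball_separable)
      show "continuous_on UNIV (\<lambda>x. quad {1..N} (G \<omega>) x - T * inner_on {1..N} x x)" for \<omega>
        unfolding inner_on_def by (intro continuous_intros)
      show "(\<lambda>\<omega>. quad {1..N} (G \<omega>) x - T * inner_on {1..N} x x) \<in> borel_measurable M" for x
        by (intro borel_measurable_diff borel_measurable_const quad_measurable) auto
    qed
    show ?case
    \<comment> \<open>By contraposition: if no unit vector reaches the level, homogeneity bounds the
      form by \<open>T \<bar>x\<bar>\<^sup>2\<close> everywhere, which is the unlikely
      event.\<close>
    proof (rule holds_except_mono[OF holds_except_Collect[OF ms pr] order_refl], rule ccontr)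
      fix \<omega>
      assume 1: "\<not> (\<forall>x\<in>UNIV. quad {1..N} (G \<omega>) x - T * inner_on {1..N} x x \<le> 0)"
        and 2: "\<nexists>x. (\<Sum>i=1..N. \<bar>x i\<bar> powr 2) = 1 \<and> (sqrt 2 - \<epsilon>) * sqrt (real N) \<le> quad {1..N} (G \<omega>) x"
      have Tge: "(sqrt 2 - \<epsilon>) * sqrt (real N) \<le> T" unfolding T_def using \<eta> by (intro mult_right_mono) auto
      have "quad {1..N} (G \<omega>) x \<le> T * inner_on {1..N} x x" for x
      proof -
        have "quad {1..N} (G \<omega>) x \<le> T * (\<Sum>i\<in>{1..N}. \<bar>x i\<bar> powr 2) powr (2/2)"
          using 2 Tge by (intro quad_le_homogeneous) (auto simp: not_le intro: less_imp_le order_trans)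
        then show ?thesis by (simp add: inner_on_def power2_eq_square sum_nonneg)
      qed
      then show False using 1 by simp
    qed
  qed
  then show ?thesis by blast
qed

end

section \<open>Gaussian tail bounds\<close>

lemma expectation_exp_std_gauss:
  "integrable std_gauss (\<lambda>x. exp (t * x))" "(\<integral>x. exp (t * x) \<partial>std_gauss) = exp (t\<^sup>2 / 2)"
proof -
  have eq: "std_normal_density x * exp (t * x) = exp (t\<^sup>2/2) * normal_density t 1 x" for x
    by (simp add: normal_density_def exp_add[symmetric] power2_eq_square field_simps)
  show "integrable std_gauss (\<lambda>x. exp (t * x))"
    by (subst integrable_density) (auto simp: eq)
  show "(\<integral>x. exp (t * x) \<partial>std_gauss) = exp (t\<^sup>2 / 2)"
    by (subst integral_density) (auto simp: eq)
qed

text \<open>Only the unit interval next to \<open>t\<close> is counted, with the density at its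
  right end. Replacing \<open>t\<close> by \<open>t + 1\<close> in the exponent is harmless at
  levels of order \<open>sqrt (ln N)\<close>.\<close>

lemma measure_std_gauss_atLeast_ge:
  assumes t: "t \<ge> 0"
  shows "measure std_gauss {t..} \<ge> exp (- (t + 1)\<^sup>2 / 2) / sqrt (2 * pi)"
proof -
  interpret G: prob_space std_gauss by (rule prob_space_std_gauss)
  let ?c = "exp (- (t + 1)\<^sup>2 / 2) / sqrt (2 * pi)"
  have "emeasure std_gauss {t..t+1} = (\<integral>\<^sup>+x. ennreal (std_normal_density x) * indicator {t..t+1} x \<partial>lborel)"
    by (subst emeasure_density) auto
  also have "\<dots> \<ge> (\<integral>\<^sup>+x. ennreal ?c * indicator {t..t+1} x \<partial>lborel)"
  proof (rule nn_integral_mono)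
    fix x
    show "ennreal ?c * indicator {t..t+1} x \<le> ennreal (std_normal_density x) * indicator {t..t+1} x"
    proof (cases "x \<in> {t..t+1}")
      case True
      then have "x\<^sup>2 \<le> (t+1)\<^sup>2" using t by (intro power_mono) auto
      then have "?c \<le> std_normal_density x" by (simp add: std_normal_density_def divide_right_mono)
      then show ?thesis by (simp add: ennreal_leI mult_right_mono)
    qed simp
  qed
  also have "(\<integral>\<^sup>+x. ennreal ?c * indicator {t..t+1} x \<partial>lborel) = ennreal ?c"
    by (subst nn_integral_cmult_indicator) auto
  finally have "?c \<le> measure std_gauss {t..t+1}" by (simp add: G.emeasure_eq_measure)
  also have "\<dots> \<le> measure std_gauss {t..}" by (intro G.finite_measure_mono) auto
  finally show ?thesis .
qed

lemma (in prob_space) holds_except_ball: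
  assumes "finite S" "\<And>i. i \<in> S \<Longrightarrow> holds_except (P i) (\<delta> i)"
  shows "holds_except (\<lambda>\<omega>. \<forall>i\<in>S. P i \<omega>) (\<Sum>i\<in>S. \<delta> i)"
  using assms
proof (induction S rule: finite_induct)
  case empty
  show ?case by (rule holds_exceptI[of "{}"]) auto
next
  case (insert i S)
  have "holds_except (\<lambda>\<omega>. P i \<omega> \<and> (\<forall>i\<in>S. P i \<omega>)) (\<delta> i + (\<Sum>i\<in>S. \<delta> i))"
    using insert by (intro holds_except_conj) auto
  then show ?case using insert by simp
qed

context iid_std_normal
begin

text \<open>Chernoff's bound with the optimal parameters \<open>t\<close> and \<open>-t\<close>, one
  for each tail, and a union bound over \<open>J\<close>.\<close>

lemma holds_except_abs_less_exp:
  assumes J: "J \<subseteq> I" "finite J" and t: "t > 0"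
  shows "holds_except (\<lambda>\<omega>. \<forall>j\<in>J. \<bar>X j \<omega>\<bar> < t) (real (card J) * (2 * exp (- t\<^sup>2 / 2)))"
proof -
  have "holds_except (\<lambda>\<omega>. \<forall>j\<in>J. \<bar>X j \<omega>\<bar> < t) (\<Sum>j\<in>J. 2 * exp (- t\<^sup>2 / 2))"
  proof (rule holds_except_ball[OF J(2)])
    fix j assume j: "j \<in> J"
    then have jI: "j \<in> I" using J by auto
    have [measurable]: "X j \<in> borel_measurable M" using jI by simp
    have one: "holds_except (\<lambda>\<omega>. \<not> exp (s * X j \<omega>) \<ge> exp (s\<^sup>2)) (exp (- s\<^sup>2 / 2))" for s
    proof (rule holds_except_Collect)
      have "prob {\<omega>\<in>space M. exp (s * X j \<omega>) \<ge> exp (s\<^sup>2)} \<le> expectation (\<lambda>\<omega>. exp (s * X j \<omega>)) / exp (s\<^sup>2)"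
        by (rule integral_Markov_inequality_measure[where A="{}"])
          (use integrable_X[OF jI expectation_exp_std_gauss(1)] in auto)
      also have "\<dots> = exp (s\<^sup>2/2) / exp (s\<^sup>2)"
        using expectation_X[OF jI, of "\<lambda>x. exp (s * x)"] expectation_exp_std_gauss(2)[of s] by simp
      also have "\<dots> = exp (- s\<^sup>2 / 2)" by (simp add: exp_diff[symmetric])
      finally show "prob {\<omega>\<in>space M. exp (s * X j \<omega>) \<ge> exp (s\<^sup>2)} \<le> exp (- s\<^sup>2 / 2)" .
    qed measurable
    show "holds_except (\<lambda>\<omega>. \<bar>X j \<omega>\<bar> < t) (2 * exp (- t\<^sup>2 / 2))"
    proof (rule holds_except_mono[OF holds_except_conj[OF one[of t] one[of "-t"]]])
      fix \<omega> assume "\<not> exp (t\<^sup>2) \<le> exp (t * X j \<omega>) \<and> \<not> exp ((-t)\<^sup>2) \<le> exp (- t * X j \<omega>)"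
      then have "t * X j \<omega> < t * t" "t * (- X j \<omega>) < t * t" by (auto simp: power2_eq_square)
      then have "X j \<omega> < t" "- X j \<omega> < t" using t mult_less_cancel_left_pos by blast+
      then show "\<bar>X j \<omega>\<bar> < t" by linarith
    qed simp
  qed
  then show ?thesis by simp
qed

text \<open>By independence all variables stay below \<open>t\<close> with probability
  \<open>(1 - \<pi>) ^ n \<le> exp (- n * \<pi>)\<close>, which is then weakened to
  \<open>1 / (n * c)\<close> using the lower tail bound \<open>c\<close> for \<pi>.\<close>

lemma holds_except_bex_ge:
  assumes J: "J \<subseteq> I" "finite J" "J \<noteq> {}" and t: "t \<ge> 0"
  shows "holds_except (\<lambda>\<omega>. \<exists>j\<in>J. t \<le> X j \<omega>) (sqrt (2 * pi) * exp ((t + 1)\<^sup>2 / 2) / real (card J))"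
proof -
  define \<pi> where "\<pi> = measure std_gauss {t..}"
  define c where "c = exp (- (t + 1)\<^sup>2 / 2) / sqrt (2 * pi)"
  interpret G: prob_space std_gauss by (rule prob_space_std_gauss)
  have \<pi>: "\<pi> \<le> 1" "c \<le> \<pi>" "c > 0"
    using measure_std_gauss_atLeast_ge[OF t] by (auto simp: \<pi>_def c_def)
  have n: "real (card J) > 0" using J by (simp add: card_gt_0_iff)
  have [measurable]: "X j \<in> borel_measurable M" if "j \<in> J" for j using that J by auto
  have p1: "prob {\<omega>\<in>space M. X j \<omega> < t} = 1 - \<pi>" if "j \<in> J" for j
  proof -
    have [measurable]: "X j \<in> borel_measurable M" using that by simp
    have "{\<omega>\<in>space M. X j \<omega> < t} = space M - {\<omega>\<in>space M. X j \<omega> \<in> {t..}}" by auto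
    then have "prob {\<omega>\<in>space M. X j \<omega> < t} = 1 - prob {\<omega>\<in>space M. X j \<omega> \<in> {t..}}"
      using prob_compl[of "{\<omega>\<in>space M. X j \<omega> \<in> {t..}}"] by simp
    then show ?thesis using prob_X[of j "{t..}"] that J by (auto simp: \<pi>_def)
  qed
  have "prob {\<omega>\<in>space M. \<forall>j\<in>J. X j \<omega> < t} = prob (\<Inter>j\<in>J. X j -` {..<t} \<inter> space M)"
    using J by (intro arg_cong[where f=prob]) auto
  also have "\<dots> = (\<Prod>j\<in>J. prob (X j -` {..<t} \<inter> space M))"
    using J by (intro indep_varsD[OF indep]) auto
  also have "\<dots> = (\<Prod>j\<in>J. 1 - \<pi>)"
    using p1 by (intro prod.cong refl) (simp add: vimage_def Int_def conj_commute)
  also have "\<dots> = (1 - \<pi>) ^ card J" by simp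
  also have "\<dots> \<le> (exp (- \<pi>)) ^ card J"
    using \<pi> exp_ge_add_one_self[of "-\<pi>"] by (intro power_mono) auto
  also have "\<dots> = exp (- (real (card J) * \<pi>))" by (simp add: exp_of_nat_mult[symmetric])
  also have "\<dots> \<le> exp (- (real (card J) * c))" using \<pi> n by simp
  also have "\<dots> \<le> 1 / (real (card J) * c)"
  proof -
    have "real (card J) * c \<le> exp (real (card J) * c)" using exp_ge_add_one_self[of "real (card J) * c"] by linarith
    moreover have "real (card J) * c > 0" using n \<pi> by simp
    ultimately show ?thesis by (simp add: exp_minus field_simps)
  qed
  also have "\<dots> = sqrt (2 * pi) * exp ((t + 1)\<^sup>2 / 2) / real (card J)"
    by (simp add: c_def exp_minus field_simps)
  finally have "prob {\<omega>\<in>space M. \<forall>j\<in>J. X j \<omega> < t} \<le> sqrt (2 * pi) * exp ((t + 1)\<^sup>2 / 2) / real (card J)" .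
  moreover have "{\<omega>\<in>space M. \<forall>j\<in>J. X j \<omega> < t} \<in> events" using J(2) by measurable
  ultimately have "holds_except (\<lambda>\<omega>. \<not> (\<forall>j\<in>J. X j \<omega> < t)) (sqrt (2 * pi) * exp ((t + 1)\<^sup>2 / 2) / real (card J))"
    by (intro holds_except_Collect)
  then show ?thesis by (simp add: not_less)
qed

end

subsection \<open>The case \<open>p = 1\<close> and the limits\<close>

context gaussian_matrix
begin

text \<open>On the unit sphere of the 1-norm the form is at most the largest symmetrised entry in
  absolute value. The off-diagonal ones have variance 1/2 and there are about
  \<open>N\<^sup>2\<close> of them; the \<open>N\<close> diagonal ones have variance 1. Both
  families have maxima of order \<open>sqrt (2 * ln N)\<close>.\<close>

lemma quad_upper_one:
  assumes \<epsilon>: "\<epsilon> > 0" and N: "N \<ge> 2"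
  shows "holds_except (quad_below 1 N ((sqrt 2 + \<epsilon>) * sqrt (ln (real N)))) (4 * real N powr (-\<epsilon>))"
proof -
  define t where "t = (sqrt 2 + \<epsilon>) * sqrt (ln (real N))"
  have ln0: "ln (real N) > 0" using N by simp
  have t: "t > 0" using \<epsilon> ln0 by (simp add: t_def add_pos_pos)
  have t2: "t\<^sup>2 \<ge> (2 + 2 * \<epsilon>) * ln (real N)"
  proof -
    have "1 * \<epsilon> \<le> sqrt 2 * \<epsilon>" using \<epsilon> by (intro mult_right_mono) auto
    moreover have "(sqrt 2 + \<epsilon>)\<^sup>2 = 2 + 2 * (sqrt 2 * \<epsilon>) + \<epsilon>\<^sup>2" by (simp add: power2_sum)
    ultimately have "2 + 2 * \<epsilon> \<le> (sqrt 2 + \<epsilon>)\<^sup>2" using zero_le_power2[of \<epsilon>] by linarith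
    then show ?thesis using ln0 by (simp add: t_def power_mult_distrib mult_right_mono)
  qed
  have NN: "real N powr a = exp (a * ln (real N))" for a using N by (simp add: powr_def)
  \<comment> \<open>Normalised to variance 1, the off-diagonal level is \<open>sqrt 2 * t\<close>;
    the exponent thus doubles and compensates for the \<open>N\<^sup>2\<close> pairs.\<close>
  have bound2: "exp (- (sqrt 2 * t)\<^sup>2 / 2) \<le> real N powr (-2 - 2 * \<epsilon>)"
    using t2 by (simp add: NN power_mult_distrib algebra_simps)
  have bound1: "exp (- t\<^sup>2 / 2) \<le> real N powr (-1 - \<epsilon>)"
    using t2 by (simp add: NN algebra_simps)
  have off: "holds_except (\<lambda>\<omega>. \<forall>j\<in>{1..N} - {i}. \<bar>(g i j \<omega> + g j i \<omega>) / sqrt 2\<bar> < sqrt 2 * t)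
      (real N * (2 * real N powr (-2 - 2 * \<epsilon>)))" if i: "i \<in> {1..N}" for i
  proof -
    interpret W: iid_std_normal M "\<lambda>j \<omega>. (g i j \<omega> + g j i \<omega>) / sqrt 2" "{1..N} - {i}"
      using i by (intro symmetric_row_iid) auto
    show ?thesis
    proof (rule holds_except_mono)
      show "holds_except (\<lambda>\<omega>. \<forall>j\<in>{1..N} - {i}. \<bar>(g i j \<omega> + g j i \<omega>) / sqrt 2\<bar> < sqrt 2 * t)
        (real (card ({1..N} - {i})) * (2 * exp (- (sqrt 2 * t)\<^sup>2 / 2)))"
        using t by (intro W.holds_except_abs_less_exp) auto
      show "real (card ({1..N} - {i})) * (2 * exp (- (sqrt 2 * t)\<^sup>2 / 2)) \<le> real N * (2 * real N powr (-2 - 2 * \<epsilon>))"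
        using bound2 i by (intro mult_mono) auto
    qed
  qed
  have "holds_except (\<lambda>\<omega>. \<forall>k\<in>(\<lambda>i. (i,i)) ` {1..N}. \<bar>(case k of (i, j) \<Rightarrow> g i j) \<omega>\<bar> < t)
      (real (card ((\<lambda>i. (i,i)) ` {1..N})) * (2 * exp (- t\<^sup>2 / 2)))"
    using t by (intro holds_except_abs_less_exp) auto
  then have diag: "holds_except (\<lambda>\<omega>. \<forall>i\<in>{1..N}. \<bar>g i i \<omega>\<bar> < t) (real N * (2 * real N powr (-1 - \<epsilon>)))"
  proof (rule holds_except_mono)
    have "card ((\<lambda>i. (i,i)) ` {1..N}) = N" by (subst card_image) (auto simp: inj_on_def)
    then show "real (card ((\<lambda>i. (i,i)) ` {1..N})) * (2 * exp (- t\<^sup>2 / 2)) \<le> real N * (2 * real N powr (-1 - \<epsilon>))"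
      using bound1 by (simp add: mult_left_mono)
  qed auto
  have "holds_except (\<lambda>\<omega>. \<forall>i\<in>{1..N}. \<forall>j\<in>{1..N} - {i}. \<bar>(g i j \<omega> + g j i \<omega>) / sqrt 2\<bar> < sqrt 2 * t)
      (\<Sum>i\<in>{1..N}. real N * (2 * real N powr (-2 - 2 * \<epsilon>)))"
    by (intro holds_except_ball off) auto
  from holds_except_conj[OF this diag] show ?thesis
  proof (rule holds_except_mono)
    have pw: "real N * real N powr a = real N powr (1 + a)" for a
      using N by (simp add: powr_add)
    have "(\<Sum>i\<in>{1..N}. real N * (2 * real N powr (-2 - 2 * \<epsilon>))) + real N * (2 * real N powr (-1 - \<epsilon>))
      = 2 * (real N * (real N * real N powr (-2 - 2 * \<epsilon>))) + 2 * (real N * real N powr (-1 - \<epsilon>))" by simp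
    also have "\<dots> = 2 * real N powr (-2*\<epsilon>) + 2 * real N powr (-\<epsilon>)" unfolding pw by simp
    also have "\<dots> \<le> 2 * real N powr (-\<epsilon>) + 2 * real N powr (-\<epsilon>)"
      using \<epsilon> N by (intro add_mono mult_left_mono powr_mono) auto
    finally show "(\<Sum>i\<in>{1..N}. real N * (2 * real N powr (-2 - 2 * \<epsilon>))) + real N * (2 * real N powr (-1 - \<epsilon>))
      \<le> 4 * real N powr (-\<epsilon>)" by simp
  next
    fix \<omega>
    assume A: "(\<forall>i\<in>{1..N}. \<forall>j\<in>{1..N} - {i}. \<bar>(g i j \<omega> + g j i \<omega>) / sqrt 2\<bar> < sqrt 2 * t) \<and> (\<forall>i\<in>{1..N}. \<bar>g i i \<omega>\<bar> < t)"
    have sym: "\<bar>(g i j \<omega> + g j i \<omega>) / 2\<bar> \<le> t" if "i \<in> {1..N}" "j \<in> {1..N}" for i j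
    proof (cases "i = j")
      case True
      then show ?thesis using A that by (auto intro: less_imp_le)
    next
      case False
      then have "\<bar>(g i j \<omega> + g j i \<omega>) / sqrt 2\<bar> < sqrt 2 * t" using A that by auto
      then have "\<bar>g i j \<omega> + g j i \<omega>\<bar> < sqrt 2 * t * sqrt 2" by (simp add: abs_divide pos_divide_less_eq)
      also have "sqrt 2 * t * sqrt 2 = t * (sqrt 2 * sqrt 2)" by (simp only: mult_ac)
      finally show ?thesis by simp
    qed
    show "quad_below 1 N ((sqrt 2 + \<epsilon>) * sqrt (ln (real N))) \<omega>"
    proof (intro allI impI)
      fix x :: "nat \<Rightarrow> real" assume x: "(\<Sum>i=1..N. \<bar>x i\<bar> powr 1) = 1"
      have "quad {1..N} (\<lambda>i j. g j i \<omega>) x = quad {1..N} (G \<omega>) x"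
        unfolding quad_def by (subst sum.swap) (simp add: mult.commute)
      then have "quad {1..N} (G \<omega>) x = (quad {1..N} (G \<omega>) x + quad {1..N} (\<lambda>i j. g j i \<omega>) x) / 2" by simp
      also have "\<dots> = (\<Sum>i=1..N. \<Sum>j=1..N. (g i j \<omega> + g j i \<omega>) / 2 * (x i * x j))"
        unfolding quad_def by (simp add: sum.distrib[symmetric] sum_divide_distrib distrib_right add_divide_distrib)
      also have "\<dots> \<le> (\<Sum>i=1..N. \<Sum>j=1..N. t * (\<bar>x i\<bar> * \<bar>x j\<bar>))"
      proof (intro sum_mono)
        fix i j assume ij: "i \<in> {1..N}" "j \<in> {1..N}"
        have "(g i j \<omega> + g j i \<omega>) / 2 * (x i * x j) \<le> \<bar>(g i j \<omega> + g j i \<omega>) / 2\<bar> * \<bar>x i * x j\<bar>"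
          by (metis abs_ge_self abs_mult)
        also have "\<dots> \<le> t * \<bar>x i * x j\<bar>" using sym[OF ij] by (intro mult_right_mono) auto
        finally show "(g i j \<omega> + g j i \<omega>) / 2 * (x i * x j) \<le> t * (\<bar>x i\<bar> * \<bar>x j\<bar>)" by (simp add: abs_mult)
      qed
      also have "\<dots> = t * ((\<Sum>i=1..N. \<bar>x i\<bar>) * (\<Sum>i=1..N. \<bar>x i\<bar>))"
        by (simp only: sum_product) (simp only: sum_distrib_left)
      also have "\<dots> = t" using x by simp
      finally show "quad {1..N} (G \<omega>) x \<le> (sqrt 2 + \<epsilon>) * sqrt (ln (real N))" by (simp add: t_def)
    qed
  qed
qed

text \<open>Basis vectors pick out the diagonal entries, and the maximum of \<open>N\<close>
  independent ones already reaches the level.\<close>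

lemma quad_lower_one:
  assumes \<epsilon>: "\<epsilon> > 0"
  shows "\<exists>C a. a > 0 \<and> (\<forall>\<^sub>F N in sequentially. holds_except (quad_above 1 N ((sqrt 2 - \<epsilon>) * sqrt (ln (real N)))) (C * real N powr (-a)))"
proof -
  define \<eta> where "\<eta> = min 1 \<epsilon>"
  have \<eta>: "\<eta> > 0" "\<eta> \<le> 1" "\<eta> \<le> \<epsilon>" using \<epsilon> by (auto simp: \<eta>_def)
  have s2: "sqrt 2 \<ge> 1" by simp
  have "filterlim (\<lambda>N. sqrt (ln (real N))) at_top sequentially" by real_asymp
  then have ev: "\<forall>\<^sub>F N in sequentially. 2 / \<eta> \<le> sqrt (ln (real N))" unfolding filterlim_at_top by blast
  have "\<forall>\<^sub>F N in sequentially. holds_except (quad_above 1 N ((sqrt 2 - \<epsilon>) * sqrt (ln (real N)))) (sqrt (2 * pi) * real N powr (-(\<eta>/4)))"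
    using ev eventually_ge_at_top[of 2]
  proof eventually_elim
    case (elim N)
    note N = elim(2)
    define L where "L = sqrt (ln (real N))"
    have ln0: "ln (real N) > 0" using N by simp
    have L: "L > 0" "L\<^sup>2 = ln (real N)" using ln0 by (simp_all add: L_def)
    define t where "t = (sqrt 2 - \<eta>) * L"
    have "sqrt 2 - \<eta> \<ge> 0" using s2 \<eta> by linarith
    then have t0: "t \<ge> 0" using L by (simp add: t_def)
    \<comment> \<open>The extra 1 from the tail bound is absorbed by half of \<eta> once
      \<open>sqrt (ln N) \<ge> 2 / \<eta>\<close>.\<close>
    have t1: "t + 1 \<le> (sqrt 2 - \<eta>/2) * L"
    proof -
      have "2 \<le> L * \<eta>" using elim(1) \<eta> by (simp add: L_def pos_divide_le_eq)
      then show ?thesis by (simp add: t_def algebra_simps)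
    qed
    have t2: "(t + 1)\<^sup>2 / 2 \<le> (1 - \<eta>/4) * ln (real N)"
    proof -
      have "(t + 1)\<^sup>2 \<le> ((sqrt 2 - \<eta>/2) * L)\<^sup>2" using t0 t1 by (intro power_mono) auto
      also have "\<dots> = (2 - sqrt 2 * \<eta> + \<eta>\<^sup>2/4) * ln (real N)"
        by (simp add: power_mult_distrib L(2) power2_diff power_divide)
      also have "\<dots> \<le> (2 - \<eta> / 2) * ln (real N)"
      proof (intro mult_right_mono)
        have "\<eta>\<^sup>2 \<le> \<eta>" using \<eta> by (simp add: power2_eq_square mult_left_le)
        moreover define z where "z = sqrt 2 * \<eta>"
        moreover have "1 * \<eta> \<le> z" unfolding z_def using \<eta> by (intro mult_right_mono) auto
        ultimately show "2 - sqrt 2 * \<eta> + \<eta>\<^sup>2/4 \<le> 2 - \<eta> / 2"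
          using \<eta> unfolding z_def[symmetric] by (simp add: field_simps)
      qed (use ln0 in auto)
      finally show ?thesis by (simp add: algebra_simps)
    qed
    let ?D = "(\<lambda>i. (i,i)) ` {1..N}"
    have cD: "card ?D = N" by (subst card_image) (auto simp: inj_on_def)
    have "holds_except (\<lambda>\<omega>. \<exists>k\<in>?D. t \<le> (case k of (i, j) \<Rightarrow> g i j) \<omega>) (sqrt (2 * pi) * exp ((t + 1)\<^sup>2 / 2) / real (card ?D))"
      using t0 N by (intro holds_except_bex_ge) auto
    then show ?case
    proof (rule holds_except_mono)
      have "exp ((t + 1)\<^sup>2 / 2) \<le> exp ((1 - \<eta>/4) * ln (real N))" using t2 by simp
      also have "\<dots> = real N powr (1 - \<eta>/4)" using N by (simp add: powr_def)
      also have "\<dots> = real N * real N powr (-(\<eta>/4))" using N powr_add[of "real N" 1 "-(\<eta>/4)"] by simp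
      finally have "exp ((t + 1)\<^sup>2 / 2) / real N \<le> real N powr (-(\<eta>/4))"
        using N by (simp add: pos_divide_le_eq mult.commute)
      then have "sqrt (2 * pi) * (exp ((t + 1)\<^sup>2 / 2) / real N) \<le> sqrt (2 * pi) * real N powr (-(\<eta>/4))"
        by (intro mult_left_mono) auto
      then show "sqrt (2 * pi) * exp ((t + 1)\<^sup>2 / 2) / real (card ?D) \<le> sqrt (2 * pi) * real N powr (-(\<eta>/4))"
        unfolding cD by simp
    next
      fix \<omega> assume "\<exists>k\<in>?D. t \<le> (case k of (i, j) \<Rightarrow> g i j) \<omega>"
      then obtain i where i: "i \<in> {1..N}" "t \<le> g i i \<omega>" by auto
      define x where "x j = (if j = i then 1 else 0 :: real)" for j
      have "(\<Sum>j=1..N. \<bar>x j\<bar> powr 1) = (\<Sum>j=1..N. if j = i then 1 else 0)"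
        by (intro sum.cong) (auto simp: x_def)
      also have "\<dots> = 1" using i by simp
      finally have x1: "(\<Sum>j=1..N. \<bar>x j\<bar> powr 1) = 1" .
      have "(\<Sum>j=1..N. g k j \<omega> * (x k * x j)) = (if k = i then g i i \<omega> else 0)" for k
      proof -
        have "(\<Sum>j=1..N. g k j \<omega> * (x k * x j)) = (\<Sum>j=1..N. if j = i then g k i \<omega> * x k else 0)"
          by (intro sum.cong) (auto simp: x_def)
        also have "\<dots> = g k i \<omega> * x k" using i by simp
        finally show ?thesis by (simp add: x_def)
      qed
      then have q: "quad {1..N} (G \<omega>) x = g i i \<omega>" using i by (simp add: quad_def)
      have "(sqrt 2 - \<epsilon>) * sqrt (ln (real N)) \<le> t"
        unfolding t_def L_def[symmetric] using \<eta> L by (intro mult_right_mono) auto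
      then show "quad_above 1 N ((sqrt 2 - \<epsilon>) * sqrt (ln (real N))) \<omega>"
        using x1 q i by (intro exI[of _ x]) auto
    qed
  qed
  then show ?thesis using \<eta> by (intro exI[of _ "sqrt (2 * pi)"] exI[of _ "\<eta>/4"]) auto
qed

section \<open>Almost sure limits of the maxima\<close>

lemma AE_GP_tendsto:
  fixes f b :: "nat \<Rightarrow> real"
  assumes p: "0 < p" "p \<le> 2"
    and f: "\<And>N N'. L \<le> N \<Longrightarrow> N \<le> N' \<Longrightarrow> f N \<le> f N'" "\<And>N. L \<le> N \<Longrightarrow> f N > 0"
    and m: "strict_mono (m :: nat \<Rightarrow> nat)" and ratio: "(\<lambda>n. f (m (Suc n)) / f (m n)) \<longlonglongrightarrow> 1"
    and c: "c > 0"
    and up: "\<And>\<epsilon>. \<epsilon> > 0 \<Longrightarrow> \<exists>b. summable (\<lambda>n. b (m n)) \<and> (\<forall>\<^sub>F N in sequentially.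
      holds_except (quad_below p N ((c + \<epsilon>) * f N)) (b N))"
    and lo: "\<And>\<epsilon>. \<epsilon> > 0 \<Longrightarrow> \<exists>b. summable (\<lambda>n. b (m n)) \<and> (\<forall>\<^sub>F N in sequentially.
      holds_except (quad_above p N ((c - \<epsilon>) * f N)) (b N))"
  shows "AE \<omega> in M. (\<lambda>N. 1 / f N * GP TYPE('k::finite) p N (G \<omega>)) \<longlonglongrightarrow> c"
proof -
  have mtop: "filterlim m at_top sequentially" using m by (rule filterlim_subseq)
  note ev = eventually_compose_filterlim[OF _ mtop]
  show ?thesis
  proof (rule AE_tendsto_of_subseq[where L=L and m=m, OF _ f m ratio c])
    show "GP TYPE('k) p N (G \<omega>) \<le> GP TYPE('k) p N' (G \<omega>)"
      if "1 \<le> N" "N \<le> N'" for N N' \<omega>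
      by (rule GP_mono[OF p(1) that])
  next
    fix \<epsilon> :: real assume \<epsilon>: "\<epsilon> > 0"
    obtain b where b: "summable (\<lambda>n. b (m n))" "\<forall>\<^sub>F N in sequentially.
      holds_except (quad_below p N ((c + \<epsilon>) * f N)) (b N)"
      using up[OF \<epsilon>] by auto
    have "\<forall>\<^sub>F N in sequentially. holds_except (\<lambda>\<omega>. GP TYPE('k) p N (G \<omega>) \<le> (c + \<epsilon>) * f N) (b N)"
      using b(2) eventually_ge_at_top[of "max 1 L"]
    proof eventually_elim
      case (elim N)
      show ?case
      proof (rule holds_except_mono[OF elim(1) order_refl])
        fix \<omega> assume "quad_below p N ((c + \<epsilon>) * f N) \<omega>"
        moreover have "0 \<le> (c + \<epsilon>) * f N" using c \<epsilon> f(2)[of N] elim(2) by simp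
        ultimately show "GP TYPE('k) p N (G \<omega>) \<le> (c + \<epsilon>) * f N"
          using elim(2) by (intro GP_le p) auto
      qed
    qed
    from ev[OF this] b(1)
    show "\<exists>b. summable b \<and> (\<forall>\<^sub>F n in sequentially.
        holds_except (\<lambda>\<omega>. GP TYPE('k) p (m n) (G \<omega>) \<le> (c + \<epsilon>) * f (m n)) (b n))"
      by (intro exI[of _ "\<lambda>n. b (m n)"] conjI)
  next
    fix \<epsilon> :: real assume \<epsilon>: "\<epsilon> > 0"
    obtain b where b: "summable (\<lambda>n. b (m n))" "\<forall>\<^sub>F N in sequentially.
      holds_except (quad_above p N ((c - \<epsilon>) * f N)) (b N)"
      using lo[OF \<epsilon>] by auto
    have "\<forall>\<^sub>F N in sequentially. holds_except (\<lambda>\<omega>. (c - \<epsilon>) * f N \<le> GP TYPE('k) p N (G \<omega>)) (b N)"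
      using b(2) eventually_ge_at_top[of 1]
    proof eventually_elim
      case (elim N)
      show ?case
      proof (rule holds_except_mono[OF elim(1) order_refl])
        fix \<omega> assume "quad_above p N ((c - \<epsilon>) * f N) \<omega>"
        then obtain x where x: "(\<Sum>i=1..N. \<bar>x i\<bar> powr p) = 1" "(c - \<epsilon>) * f N \<le> quad {1..N} (G \<omega>) x" by blast
        then show "(c - \<epsilon>) * f N \<le> GP TYPE('k) p N (G \<omega>)"
          using quad_le_GP[OF p(1) elim(2) x(1), where 'k='k] by (meson order_trans)
      qed
    qed
    from ev[OF this] b(1)
    show "\<exists>b. summable b \<and> (\<forall>\<^sub>F n in sequentially.
        holds_except (\<lambda>\<omega>. (c - \<epsilon>) * f (m n) \<le> GP TYPE('k) p (m n) (G \<omega>)) (b n))"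
      by (intro exI[of _ "\<lambda>n. b (m n)"] conjI)
  qed
qed

lemma summable_over_squares: "summable (\<lambda>n. C / real ((Suc n)\<^sup>2))"
proof -
  have "summable (\<lambda>n. inverse (real (Suc n) ^ 2))"
    by (subst summable_Suc_iff[where f="\<lambda>n. inverse (real n ^ 2)"]) (rule inverse_power_summable, simp)
  then have "summable (\<lambda>n. C * inverse (real (Suc n) ^ 2))" by (rule summable_mult)
  then show ?thesis by (simp add: divide_inverse)
qed

text \<open>Bounds of order \<open>1/N\<close> become summable along the squares, which are still
  dense enough for consecutive values of \<open>N powr a\<close> to have ratio tending to 1.\<close>

lemma AE_GP_tendsto_power:
  assumes p: "0 < p" "p \<le> 2" and a: "a > 0" and c: "c > 0"
    and up: "\<And>\<epsilon>. \<epsilon> > 0 \<Longrightarrow> \<exists>C. \<forall>N\<ge>1. holds_except (quad_below p N ((c + \<epsilon>) * real N powr a)) (C / real N)"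
    and lo: "\<And>\<epsilon>. \<epsilon> > 0 \<Longrightarrow> \<exists>C. \<forall>\<^sub>F N in sequentially.
      holds_except (quad_above p N ((c - \<epsilon>) * real N powr a)) (C / real N)"
  shows "AE \<omega> in M. (\<lambda>N. 1 / real N powr a * GP TYPE('k::finite) p N (G \<omega>)) \<longlonglongrightarrow> c"
proof (rule AE_GP_tendsto[where L=1 and m="\<lambda>n. (Suc n)\<^sup>2"])
  show "real N powr a \<le> real N' powr a" if "1 \<le> N" "N \<le> N'" for N N'
    using that a by (intro powr_mono2) auto
  show "strict_mono (\<lambda>n. (Suc n)\<^sup>2)" by (intro strict_monoI power_strict_mono) auto
  have "(\<lambda>n. (real ((Suc (Suc n))\<^sup>2) / real ((Suc n)\<^sup>2)) powr a) \<longlonglongrightarrow> 1 powr a"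
    by (intro tendsto_powr tendsto_const) (simp, real_asymp, simp)
  then show "(\<lambda>n. real ((Suc (Suc n))\<^sup>2) powr a / real ((Suc n)\<^sup>2) powr a) \<longlonglongrightarrow> 1"
    by (simp add: powr_divide)
next
  fix \<epsilon> :: real assume \<epsilon>: "\<epsilon> > 0"
  obtain C where C: "\<forall>N\<ge>1. holds_except (quad_below p N ((c + \<epsilon>) * real N powr a)) (C / real N)"
    using up[OF \<epsilon>] by blast
  show "\<exists>b. summable (\<lambda>n. b ((Suc n)\<^sup>2)) \<and> (\<forall>\<^sub>F N in sequentially.
      holds_except (quad_below p N ((c + \<epsilon>) * real N powr a)) (b N))"
    using summable_over_squares[of C] C
    by (intro exI[of _ "\<lambda>N. C / real N"] conjI eventually_at_top_linorderI[of 1]) auto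
next
  fix \<epsilon> :: real assume \<epsilon>: "\<epsilon> > 0"
  obtain C where C: "\<forall>\<^sub>F N in sequentially. holds_except (quad_above p N ((c - \<epsilon>) * real N powr a)) (C / real N)"
    using lo[OF \<epsilon>] by blast
  show "\<exists>b. summable (\<lambda>n. b ((Suc n)\<^sup>2)) \<and> (\<forall>\<^sub>F N in sequentially.
      holds_except (quad_above p N ((c - \<epsilon>) * real N powr a)) (b N))"
    using summable_over_squares[of C] C by (intro exI[of _ "\<lambda>N. C / real N"] conjI)
qed (use p c in auto)

lemma AE_GP_mid:
  assumes p: "1 < p" "p < 2" and q: "1 / p + 1 / q = 1"
  shows "AE \<omega> in M. (\<lambda>N. 1 / real N powr (1/q) * GP TYPE('k::finite) p N (G \<omega>))
    \<longlonglongrightarrow> 2 powr (1/2 - 2/p) * abs_moment q powr (1/q)"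
proof (rule AE_GP_tendsto_power)
  have q1: "q > 1" by (rule conjugate_exponent_gt_1[OF p(1) q])
  show "2 powr (1/2 - 2/p) * abs_moment q powr (1/q) > 0" "1 / q > 0"
    using abs_moment_pos[of q] q1 by simp_all
  show "0 < p" "p \<le> 2" using p by auto
qed (fact quad_upper_mid[OF p q] quad_lower_mid[OF p q])+

lemma AE_GP_two:
  "AE \<omega> in M. (\<lambda>N. 1 / sqrt (real N) * GP TYPE('k::finite) 2 N (G \<omega>)) \<longlonglongrightarrow> sqrt 2"
proof -
  have s: "sqrt (real N) = real N powr (1/2)" for N by (simp add: powr_half_sqrt)
  show ?thesis
    unfolding s
  proof (rule AE_GP_tendsto_power)
    fix \<epsilon> :: real assume "\<epsilon> > 0"
    then show "\<exists>C. \<forall>N\<ge>1. holds_except (quad_below 2 N ((sqrt 2 + \<epsilon>) * real N powr (1/2))) (C / real N)"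
      and "\<exists>C. \<forall>\<^sub>F N in sequentially. holds_except (quad_above 2 N ((sqrt 2 - \<epsilon>) * real N powr (1/2))) (C / real N)"
      unfolding s[symmetric] by (fact quad_upper_two quad_lower_two)+
  qed auto
qed

lemma summable_over_powers_of_2: 
  assumes "a > 0" shows "summable (\<lambda>n. C * real (2 ^ n) powr (-a))"
proof -
  have "real (2 ^ n) powr (-a) = (2 powr (-a)) ^ n" for n
    by (simp add: powr_realpow[symmetric] powr_powr mult.commute)
  moreover have "2 powr (-a) < 1" using assms powr_less_mono[of "-a" 0 2] by simp
  ultimately show ?thesis by (simp add: summable_geometric summable_mult)
qed

text \<open>The failure bounds \<open>N powr (-a)\<close> may have a small exponent, so powers of 2
  are used, along which they decay geometrically. The slow normalisation \<open>sqrt (ln N)\<close>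
  still has ratio tending to 1 there; it is positive from \<open>N = 2\<close> on.\<close>

lemma AE_GP_one:
  "AE \<omega> in M. (\<lambda>N. 1 / sqrt (ln (real N)) * GP TYPE('k::finite) 1 N (G \<omega>)) \<longlonglongrightarrow> sqrt 2"
proof (rule AE_GP_tendsto[where L=2 and m="\<lambda>n. 2 ^ n"])
  show "strict_mono (\<lambda>n. 2 ^ n :: nat)" by (intro strict_monoI power_strict_increasing) auto
  have "sqrt (ln (real (2 ^ Suc n))) / sqrt (ln (real (2 ^ n))) = sqrt (real (Suc n) / real n)" for n
  proof -
    have e: "ln (real (2 ^ k)) = real k * ln 2" for k by (simp add: ln_realpow)
    show ?thesis unfolding e real_sqrt_divide[symmetric] by simp
  qed
  moreover have "(\<lambda>n. sqrt (real (Suc n) / real n)) \<longlonglongrightarrow> 1" by simp real_asymp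
  ultimately show "(\<lambda>n. sqrt (ln (real (2 ^ Suc n))) / sqrt (ln (real (2 ^ n)))) \<longlonglongrightarrow> 1" by simp
next
  fix \<epsilon> :: real assume \<epsilon>: "\<epsilon> > 0"
  show "\<exists>b. summable (\<lambda>n. b (2 ^ n)) \<and> (\<forall>\<^sub>F N in sequentially. holds_except (quad_below 1 N ((sqrt 2 + \<epsilon>) * sqrt (ln (real N)))) (b N))"
    using summable_over_powers_of_2[OF \<epsilon>, of 4] quad_upper_one[OF \<epsilon>]
    by (intro exI[of _ "\<lambda>N. 4 * real N powr (-\<epsilon>)"] conjI eventually_at_top_linorderI[of 2])
next
  fix \<epsilon> :: real assume \<epsilon>: "\<epsilon> > 0"
  obtain C a where Ca: "a > 0" "\<forall>\<^sub>F N in sequentially. holds_except (quad_above 1 N ((sqrt 2 - \<epsilon>) * sqrt (ln (real N)))) (C * real N powr (-a))"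
    using quad_lower_one[OF \<epsilon>] by blast
  show "\<exists>b. summable (\<lambda>n. b (2 ^ n)) \<and> (\<forall>\<^sub>F N in sequentially. holds_except (quad_above 1 N ((sqrt 2 - \<epsilon>) * sqrt (ln (real N)))) (b N))"
    using summable_over_powers_of_2[OF Ca(1), of C] Ca(2) by (intro exI[of _ "\<lambda>N. C * real N powr (-a)"] conjI)
qed auto

end

theorem theorem1p1:
  fixes M :: "'a measure"
    and g :: "nat \<Rightarrow> nat \<Rightarrow> 'a \<Rightarrow> real"
    and h :: "'a \<Rightarrow> real"
  assumes "prob_space M"
    and "prob_space.indep_vars M (\<lambda>_. borel) (\<lambda>(i, j). g i j) ({1..} \<times> {1..})"
    and "\<And>i j. i \<ge> 1 \<Longrightarrow> j \<ge> 1 \<Longrightarrow> distributed M lborel (g i j) std_normal_density"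
    and "distributed M lborel h std_normal_density"
  shows
    "(\<forall>p p' :: real. 1 < p \<and> p < 2 \<and> 1 / p + 1 / p' = 1 \<longrightarrow>
        (AE \<omega> in M. (\<lambda>N. 1 / real N powr (1 / p') * GP TYPE('k::finite) p N (\<lambda>i j. g i j \<omega>))
           \<longlonglongrightarrow> 2 powr (1 / 2 - 2 / p) * (prob_space.expectation M (\<lambda>\<omega>. \<bar>h \<omega>\<bar> powr p')) powr (1 / p')))
     \<and> (AE \<omega> in M. (\<lambda>N. 1 / sqrt (ln (real N)) * GP TYPE('k) 1 N (\<lambda>i j. g i j \<omega>)) \<longlonglongrightarrow> sqrt 2)
     \<and> (AE \<omega> in M. (\<lambda>N. 1 / sqrt (real N) * GP TYPE('k) 2 N (\<lambda>i j. g i j \<omega>)) \<longlonglongrightarrow> sqrt 2)"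
proof -
  interpret gaussian_matrix M g
    by (intro gaussian_matrix.intro gaussian_matrix_axioms.intro assms)
  \<comment> \<open>\<open>h\<close> enters only through its law, so its moments are those of
    \<open>std_gauss\<close>.\<close>
  have "prob_space.expectation M (\<lambda>\<omega>. \<bar>h \<omega>\<bar> powr q) = abs_moment q" for q
    unfolding abs_moment_def
    by (subst distributed_integral[OF assms(4), symmetric]) (auto simp: integral_density)
  then show ?thesis using AE_GP_mid[where 'k='k] AE_GP_one[where 'k='k] AE_GP_two[where 'k='k] by simp
qed

end
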